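(* Let $p$ be an odd prime and $G$ a finite non-abelian $p$-group with cyclic center. If $C_G\big(Z(\gamma_3(G)G^p)\big)\not\le\gamma_3(G)G^p$, then $G$ has a non-inner automorphism of order $p$.
   Context: $\gamma_3(G)$ is the third term of the lower central series and $G^p=\langle g^p:g\in G\rangle$. *)

theory Defs
  imports "HOL-Algebra.Algebra"
begin

definition grp_center :: "('a, 'b) monoid_scheme \<Rightarrow> 'a set" where
  "grp_center G = {z \<in> carrier G. \<forall>g \<in> carrier G. z \<otimes>\<^bsub>G\<^esub> g = g \<otimes>\<^bsub>G\<^esub> z}"

definition subgroup_center :: "('a, 'b) monoid_scheme \<Rightarrow> 'a set \<Rightarrow> 'a set" where
  "subgroup_center G H = {z \<in> H. \<forall>h \<in> H. z \<otimes>\<^bsub>G\<^esub> h = h \<otimes>\<^bsub>G\<^esub> z}"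

definition centralizer :: "('a, 'b) monoid_scheme \<Rightarrow> 'a set \<Rightarrow> 'a set" where
  "centralizer G H = {g \<in> carrier G. \<forall>h \<in> H. g \<otimes>\<^bsub>G\<^esub> h = h \<otimes>\<^bsub>G\<^esub> g}"

definition commutator_subgroup :: "('a, 'b) monoid_scheme \<Rightarrow> 'a set \<Rightarrow> 'a set \<Rightarrow> 'a set" where
  "commutator_subgroup G H K = generate G
     (\<Union>h \<in> H. \<Union>k \<in> K. {h \<otimes>\<^bsub>G\<^esub> k \<otimes>\<^bsub>G\<^esub> inv\<^bsub>G\<^esub> h \<otimes>\<^bsub>G\<^esub> inv\<^bsub>G\<^esub> k})"

fun lower_central :: "('a, 'b) monoid_scheme \<Rightarrow> nat \<Rightarrow> 'a set" where
  "lower_central G 0 = carrier G"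
| "lower_central G (Suc 0) = carrier G"
| "lower_central G (Suc (Suc n)) =
     commutator_subgroup G (lower_central G (Suc n)) (carrier G)"

definition power_subgroup :: "('a, 'b) monoid_scheme \<Rightarrow> nat \<Rightarrow> 'a set" where
  "power_subgroup G p = generate G ((\<lambda>g. g [^]\<^bsub>G\<^esub> p) ` carrier G)"

definition inner_auto :: "('a, 'b) monoid_scheme \<Rightarrow> ('a \<Rightarrow> 'a) \<Rightarrow> bool" where
  "inner_auto G f \<longleftrightarrow> (\<exists>g \<in> carrier G. \<forall>x \<in> carrier G.
      f x = g \<otimes>\<^bsub>G\<^esub> x \<otimes>\<^bsub>G\<^esub> inv\<^bsub>G\<^esub> g)"

end

theory Submission
  imports Defs "HOL-Number_Theory.Cong"
begin

text \<open>
  Assume that every automorphism of order \<open>p\<close> is inner, and put \<open>N = \<gamma>\<^sub>3(G)G\<^sup>p\<close>; let \<open>z\<close> generate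
  the subgroup of order \<open>p\<close> of the cyclic center. If \<open>V\<close> is an abelian normal subgroup of exponent
  \<open>p\<close> and \<open>\<delta>\<close> is a derivation of \<open>G\<close> into \<open>V\<close> with trivial third iterate, then \<open>g \<mapsto> \<delta>(g)g\<close> has order
  dividing \<open>p\<close> because \<open>p\<close> is odd, so \<open>\<delta>\<close> is the commutator map of some element of \<open>G\<close>. Encode an
  element \<open>t\<close> by the function \<open>h \<mapsto> ev [h,t]\<close> with values in the integers modulo \<open>p\<close>, where \<open>ev\<close> is
  additive with \<open>ev z = 1\<close>: a function on \<open>G/N\<close> all of whose differences \<open>F(hg) - F(h)\<close> are realized, up
  to constants, by elements of order \<open>p\<close> is then realized itself.

  The homomorphisms realize a group \<open>D\<close> with \<open>C(D) = \<Phi>(G)\<close>. The group \<open>G/N\<close> has class at most 2 and exponent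
  \<open>p\<close>, so it is an elementary abelian group under Baer's addition, whose linear functions realize a group
  \<open>T \<le> C(N)\<close> with \<open>C(T) = N\<close>. The hypothesis \<open>C(Z(N)) \<not>\<le> N\<close> therefore yields some \<open>t\<close> in \<open>T\<close> outside \<open>N\<close>.
  For a noncentral \<open>a\<close> in \<open>D\<close> of order \<open>p\<close>, the product of the functions of \<open>a\<close> and \<open>t\<close> is realized by
  some \<open>s\<close> that centralizes \<open>N\<close> and satisfies \<open>[g,s] \<in> tN\<close> for some \<open>g\<close>, whereas \<open>[G,s] \<le> N\<close> because
  \<open>s\<close> lies in \<open>\<Phi>(G)\<close>. This needs that certain elements of \<open>T \<inter> N\<close> have order \<open>p\<close> modulo the center, which
  can be arranged by changing \<open>t\<close>, since \<open>T/(T \<inter> N)\<close> is not cyclic.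
\<close>

section \<open>Preliminaries on groups\<close>

text \<open>Functions are graded by degree. Those of \<open>D\<close> are linear, those of
  \<open>T\<close> have linear differences, and a product of one from \<open>W\<close> with one from
  \<open>T\<close> is cubic. An element of \<open>V\<close> can be recovered from its function
  because a nontrivial normal subgroup contains \<open>z\<close>. So a derivation identity needs to
  be checked on functions only, where it telescopes. The recurring obstacle is the order of the
  values. A linear difference is realized in \<open>D\<close>, but the derivation argument needs
  elements of order \<open>p\<close>. On \<open>T\<close> the p-th power is central, and
  \<open>hgt\<close> records it modulo p-th powers of the center. Height zero means order
  \<open>p\<close> up to a central factor. Heights are additive on \<open>T\<close>, so a family of
  wrong heights is again a homomorphism. If \<open>D\<close> has an element of nonzero height, such
  a family is cancelled by a product of two linear functions; if not, no wrong heights occur in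
  \<open>D\<close>. For the cubic function the heights form the bilinear form
  \<open>\<beta>\<close>. Several additive conditions must then hold at \<open>t\<close>, whereas
  non-cyclicity of \<open>T/(T \<inter> N)\<close> supplies only one. The final case distinction
  makes all but one of them automatic or correctable.\<close>

lemma prime_power_dvd:
  fixes p m :: nat
  assumes p: "Factorial_Ring.prime p" and m: "m \<noteq> 1" and dvd: "m dvd p ^ n"
  shows "p dvd m"
proof -
  obtain i where i: "m = p ^ i" using dvd divides_primepow_nat[OF p] by blast
  then have "i \<noteq> 0" using m by (intro notI) simp
  then show ?thesis by (simp add: i)
qed

lemma cong_lin:
  fixes m :: int
  shows "[a = b] (mod m) \<Longrightarrow> x - y = (a - b) * u \<Longrightarrow> [x = y] (mod m)"
    and "[a = b] (mod m) \<Longrightarrow> [a' = b'] (mod m) \<Longrightarrow> x - y = (a - b) * u + (a' - b') * u' \<Longrightarrow> [x = y] (mod m)"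
    and "[a = b] (mod m) \<Longrightarrow> [a' = b'] (mod m) \<Longrightarrow> [a'' = b''] (mod m) \<Longrightarrow>
       x - y = (a - b) * u + (a' - b') * u' + (a'' - b'') * u'' \<Longrightarrow> [x = y] (mod m)"
    and "[a = b] (mod m) \<Longrightarrow> [a' = b'] (mod m) \<Longrightarrow> [a'' = b''] (mod m) \<Longrightarrow> [a''' = b'''] (mod m) \<Longrightarrow>
       x - y = (a - b) * u + (a' - b') * u' + (a'' - b'') * u'' + (a''' - b''') * u''' \<Longrightarrow> [x = y] (mod m)"
  by (simp_all add: cong_iff_dvd_diff)

section \<open>Homomorphisms into the integers modulo \<open>p\<close>, and normal subgroups of
  \<open>p\<close>-groups\<close>

context group
begin

definition cm :: "'a \<Rightarrow> 'a \<Rightarrow> 'a" where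
  "cm g h = g \<otimes> h \<otimes> inv g \<otimes> inv h"

lemma cm_closed [simp, intro]: "g \<in> carrier G \<Longrightarrow> h \<in> carrier G \<Longrightarrow> cm g h \<in> carrier G"
  by (simp add: cm_def)

lemma mult_inv_cancel [simp]:
  "x \<in> carrier G \<Longrightarrow> y \<in> carrier G \<Longrightarrow> x \<otimes> (inv x \<otimes> y) = y"
  "x \<in> carrier G \<Longrightarrow> y \<in> carrier G \<Longrightarrow> inv x \<otimes> (x \<otimes> y) = y"
  by (simp_all flip: m_assoc)

lemma conj_eq_cm: "g \<in> carrier G \<Longrightarrow> h \<in> carrier G \<Longrightarrow> g \<otimes> h \<otimes> inv g = cm g h \<otimes> h"
  by (simp add: cm_def m_assoc)

lemma cm_eq_one_iff: "g \<in> carrier G \<Longrightarrow> h \<in> carrier G \<Longrightarrow> cm g h = \<one> \<longleftrightarrow> g \<otimes> h = h \<otimes> g"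
  unfolding cm_def by (metis inv_closed inv_solve_right' m_closed one_closed l_one r_one inv_solve_right)

lemma cm_inv: "g \<in> carrier G \<Longrightarrow> h \<in> carrier G \<Longrightarrow> inv (cm g h) = cm h g"
  by (simp add: cm_def m_assoc inv_mult_group)

definition addmod :: "'a set \<Rightarrow> int \<Rightarrow> ('a \<Rightarrow> int) \<Rightarrow> bool" where
  "addmod H m f \<longleftrightarrow> (\<forall>x\<in>H. \<forall>y\<in>H. [f (x \<otimes> y) = f x + f y] (mod m))"

text \<open>Modulo \<open>S\<close> the group is elementary abelian. Take \<open>M\<close> maximal
  among the subgroups that contain \<open>S\<close> and avoid \<open>u\<close>. Every nontrivial
  cyclic subgroup of \<open>G/M\<close> then contains the image of \<open>u\<close>, so this image
  generates \<open>G/M\<close>, and \<open>f\<close> is the exponent.\<close>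

lemma exists_hom_mod:
  fixes p :: nat
  assumes fin: "finite (carrier G)" and p: "Factorial_Ring.prime p"
    and S: "subgroup S G"
    and pw: "\<And>x. x \<in> carrier G \<Longrightarrow> x [^] p \<in> S"
    and cmS: "\<And>x y. x \<in> carrier G \<Longrightarrow> y \<in> carrier G \<Longrightarrow> cm x y \<in> S"
    and u: "u \<in> carrier G" "u \<notin> S"
  shows "\<exists>f. addmod (carrier G) (int p) f \<and> (\<forall>s \<in> S. [f s = 0] (mod int p)) \<and> [f u = 1] (mod int p)"
proof -
  define \<M> where "\<M> = {M. subgroup M G \<and> S \<subseteq> M \<and> u \<notin> M}"
  have "\<M> \<subseteq> Pow (carrier G)" unfolding \<M>_def using subgroup.subset by blast
  then have "finite \<M>" using fin finite_subset by blast
  moreover have "S \<in> \<M>" using S u by (simp add: \<M>_def)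
  ultimately obtain M where M: "M \<in> \<M>" and Mmax: "\<And>M'. M' \<in> \<M> \<Longrightarrow> M \<subseteq> M' \<Longrightarrow> M = M'"
    using finite_has_maximal[of \<M>] by (metis empty_iff)
  have sM: "subgroup M G" and SM: "S \<subseteq> M" and uM: "u \<notin> M" using M by (auto simp: \<M>_def)
  have nM: "M \<lhd> G"
  proof (rule normal_invI[OF sM])
    fix x h assume "x \<in> carrier G" "h \<in> M"
    then show "x \<otimes> h \<otimes> inv x \<in> M"
      using cmS[of x h] SM sM conj_eq_cm by (metis subgroup.m_closed subgroup.mem_carrier subsetD)
  qed
  interpret M: normal M G by (rule nM)
  interpret Q: group "G Mod M" by (rule M.factorgroup_is_group)
  define q where "q = (\<lambda>x. M #> x)"
  have qhom: "q \<in> hom G (G Mod M)" unfolding q_def by (rule M.r_coset_hom_Mod)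
  interpret q: group_hom G "G Mod M" q
    by (intro group_hom.intro group_hom_axioms.intro qhom is_group M.factorgroup_is_group)
  have qone: "q x = \<one>\<^bsub>G Mod M\<^esub> \<longleftrightarrow> x \<in> M" if "x \<in> carrier G" for x
  proof -
    have "\<one>\<^bsub>G Mod M\<^esub> = M" by (simp add: FactGroup_def)
    moreover have "M #> x = M \<longleftrightarrow> x \<in> M"
      using coset_join1[OF _ that sM] coset_join2[OF that sM] by blast
    ultimately show ?thesis by (simp add: q_def)
  qed
  have qp: "q x [^]\<^bsub>G Mod M\<^esub> p = \<one>\<^bsub>G Mod M\<^esub>" if "x \<in> carrier G" for x
    using qone[of "x [^] p"] pw[OF that] SM that q.hom_nat_pow[OF that, of p] by auto
  have ordq: "Q.ord (q u) = p"
  proof -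
    have "Q.ord (q u) dvd p" using qp[OF u(1)] Q.pow_eq_id[of "q u" p] u by simp
    moreover have "Q.ord (q u) \<noteq> 1" using Q.ord_eq_1[of "q u"] qone u uM by simp
    ultimately show ?thesis using p by (metis prime_nat_iff)
  qed
  have gen: "\<exists>k::int. q g = q u [^]\<^bsub>G Mod M\<^esub> k" if g: "g \<in> carrier G" for g
  proof (cases "g \<in> M")
    case True
    then have "q g = q u [^]\<^bsub>G Mod M\<^esub> (0::int)" using qone g by simp
    then show ?thesis by blast
  next
    case False
    \<comment> \<open>The preimage of the cyclic group generated by \<open>q g\<close>. It is
      strictly larger than \<open>M\<close>, so by maximality it contains \<open>u\<close>.\<close>
    define M' where "M' = {x \<in> carrier G. \<exists>i::int. q x = q g [^]\<^bsub>G Mod M\<^esub> i}"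
    have sM': "subgroup M' G"
    proof (rule subgroupI)
      show "M' \<subseteq> carrier G" by (auto simp: M'_def)
      show "M' \<noteq> {}" using g unfolding M'_def by (auto intro!: exI[of _ g] exI[of _ "1::int"])
      show "inv a \<in> M'" if "a \<in> M'" for a
        using that g unfolding M'_def by (auto simp: Q.int_pow_neg[symmetric])
      show "a \<otimes> b \<in> M'" if "a \<in> M'" "b \<in> M'" for a b
      proof -
        from that obtain i j :: int where "a \<in> carrier G" "q a = q g [^]\<^bsub>G Mod M\<^esub> i"
          "b \<in> carrier G" "q b = q g [^]\<^bsub>G Mod M\<^esub> j" unfolding M'_def by blast
        then have "q (a \<otimes> b) = q g [^]\<^bsub>G Mod M\<^esub> (i + j)" using g by (simp add: Q.int_pow_mult)
        then show ?thesis using \<open>a \<in> carrier G\<close> \<open>b \<in> carrier G\<close> unfolding M'_def by auto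
      qed
    qed
    have "M \<subseteq> M'"
    proof
      fix x assume "x \<in> M"
      then have "x \<in> carrier G" "q x = q g [^]\<^bsub>G Mod M\<^esub> (0::int)"
        using qone subgroup.mem_carrier[OF sM] by simp_all
      then show "x \<in> M'" unfolding M'_def by blast
    qed
    moreover have "g \<in> M'" using g unfolding M'_def by (auto intro!: exI[of _ "1::int"])
    ultimately have "u \<in> M'" using Mmax[of M'] sM' SM False unfolding \<M>_def by auto
    then obtain i :: int where i: "q u = q g [^]\<^bsub>G Mod M\<^esub> i" unfolding M'_def by blast
    have gp: "q g [^]\<^bsub>G Mod M\<^esub> int p = \<one>\<^bsub>G Mod M\<^esub>" using qp[OF g] by (simp add: int_pow_int)
    have "\<not> int p dvd i"
    proof
      assume "int p dvd i"
      then obtain l where "i = int p * l" by blast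
      then have "q u = (q g [^]\<^bsub>G Mod M\<^esub> int p) [^]\<^bsub>G Mod M\<^esub> l"
        using i Q.int_pow_pow[of "q g" "int p" l] g by simp
      then have "q u = \<one>\<^bsub>G Mod M\<^esub>" by (simp only: gp Q.int_pow_one)
      then show False using qone u uM by simp
    qed
    then have "coprime i (int p)" using p
      by (metis coprime_commute prime_imp_coprime prime_nat_int_transfer)
    then obtain k where k: "[i * k = 1] (mod int p)" using cong_solve_coprime_int by blast
    have "q u [^]\<^bsub>G Mod M\<^esub> k = q g [^]\<^bsub>G Mod M\<^esub> (i * k)"
      using i g by (simp add: Q.int_pow_pow)
    also have "\<dots> = q g [^]\<^bsub>G Mod M\<^esub> (1::int)"
    proof (subst Q.int_pow_eq)
      show "q g \<in> carrier (G Mod M)" using g by simp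
      have "Q.ord (q g) dvd p" using qp[OF g] Q.pow_eq_id[of "q g" p] g by simp
      then show "int (Q.ord (q g)) dvd 1 - i * k"
        using k by (meson cong_iff_dvd_diff cong_sym dvd_trans of_nat_dvd_iff)
    qed
    finally show ?thesis using g by (metis Q.int_pow_1 q.hom_closed)
  qed
  define f where "f g = (SOME k::int. q g = q u [^]\<^bsub>G Mod M\<^esub> k)" for g
  have f: "q g = q u [^]\<^bsub>G Mod M\<^esub> f g" if "g \<in> carrier G" for g
    unfolding f_def by (rule someI_ex) (rule gen[OF that])
  have fcong: "[f g = k] (mod int p)" if "g \<in> carrier G" "q g = q u [^]\<^bsub>G Mod M\<^esub> k" for g k
  proof -
    have "q u [^]\<^bsub>G Mod M\<^esub> k = q u [^]\<^bsub>G Mod M\<^esub> f g" using f that by simp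
    then show ?thesis using Q.int_pow_eq[of "q u" k "f g"] u ordq
      by (metis cong_iff_dvd_diff q.hom_closed)
  qed
  have "addmod (carrier G) (int p) f"
    unfolding addmod_def
  proof (intro ballI)
    fix x y assume xy: "x \<in> carrier G" "y \<in> carrier G"
    have "q (x \<otimes> y) = q u [^]\<^bsub>G Mod M\<^esub> (f x + f y)"
      using xy u by (simp only: q.hom_mult f[OF xy(1)] f[OF xy(2)] Q.int_pow_mult q.hom_closed)
    then show "[f (x \<otimes> y) = f x + f y] (mod int p)" using fcong xy by simp
  qed
  moreover have "[f s = 0] (mod int p)" if s: "s \<in> S" for s
  proof (rule fcong)
    show sG: "s \<in> carrier G" using SM s subgroup.mem_carrier[OF sM] by blast
    show "q s = q u [^]\<^bsub>G Mod M\<^esub> (0::int)" using qone[OF sG] SM s by auto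
  qed
  moreover have "[f u = 1] (mod int p)" by (rule fcong) (simp_all add: u)
  ultimately show ?thesis by blast
qed

text \<open>Class equation for the conjugation action on \<open>K\<close>: if no nontrivial element
  of \<open>K\<close> were central, all classes in \<open>K\<close> except that of the identity
  would have size divisible by \<open>p\<close>, and so would \<open>K\<close>, which forces
  \<open>p\<close> to divide 1.\<close>

lemma normal_meets_center:
  fixes p :: nat
  assumes fin: "finite (carrier G)" and p: "Factorial_Ring.prime p" and card: "card (carrier G) = p ^ n"
    and K: "K \<lhd> G" and K1: "K \<noteq> {\<one>}"
  shows "\<exists>c \<in> K. c \<noteq> \<one> \<and> c \<in> grp_center G"
proof (rule ccontr)
  assume neg: "\<not> ?thesis"
  interpret K: normal K G by (rule K)
  define act where "act = (\<lambda>g. \<lambda>h \<in> carrier G. g \<otimes> h \<otimes> inv g)"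
  interpret A: group_action G "carrier G" act
    unfolding act_def using action_by_conjugation by simp
  have orb: "orbit G act x = {g \<otimes> x \<otimes> inv g | g. g \<in> carrier G}" if "x \<in> carrier G" for x
    using that unfolding orbit_def act_def by auto
  have orbK: "orbit G act x \<subseteq> K" if "x \<in> K" for x
    using that K.inv_op_closed2 by (auto simp: orb K.mem_carrier)
  have cardorb: "card (orbit G act x) dvd p ^ n" if "x \<in> carrier G" for x
    using A.orbit_stabilizer_theorem[OF that] card by (metis dvd_triv_left order_def)
  have finK: "finite K" using fin K.subset finite_subset by blast
  define Os where "Os = orbit G act ` K"
  have UOs: "\<Union>Os = K" unfolding Os_def using orbK A.orbit_refl K.mem_carrier by blast
  have disj: "disjoint Os"
  proof (rule disjointI)
    fix a b assume ab: "a \<in> Os" "b \<in> Os" "a \<noteq> b"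
    then have "a \<in> orbits G (carrier G) act" "b \<in> orbits G (carrier G) act"
      using K.mem_carrier unfolding Os_def orbits_def by blast+
    then show "a \<inter> b = {}" using A.disjoint_union[of a b] ab(3) by simp
  qed
  have one: "orbit G act \<one> = {\<one>}"
  proof -
    have "g \<otimes> \<one> \<otimes> inv g = \<one>" if "g \<in> carrier G" for g using that by simp
    then have "{g \<otimes> \<one> \<otimes> inv g | g. g \<in> carrier G} = {\<one>}" using one_closed by force
    then show ?thesis using orb[OF one_closed] by simp
  qed
  have oneOs: "{\<one>} \<in> Os" using one K.one_closed unfolding Os_def by (metis imageI)
  have dvd: "p dvd card B" if "B \<in> Os - {{\<one>}}" for B
  proof -
    have "B \<in> orbit G act ` K" using that by (simp add: Os_def)
    then obtain x where x: "B = orbit G act x" "x \<in> K" by (rule imageE)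
    have xc: "x \<in> carrier G" using x(2) by simp
    have "x \<noteq> \<one>" using that x(1) one by (intro notI) simp
    then have "x \<notin> grp_center G" using neg x(2) by blast
    then obtain g where g: "g \<in> carrier G" "x \<otimes> g \<noteq> g \<otimes> x"
      using xc unfolding grp_center_def by blast
    have "g \<otimes> x \<otimes> inv g \<in> B" "x \<in> B"
      using x xc g orb A.orbit_refl by auto
    moreover have "g \<otimes> x \<otimes> inv g \<noteq> x"
      using g xc inv_solve_right'[of x "g \<otimes> x" g] by simp
    ultimately have "card B \<noteq> 1" using card_1_singletonE[of B] by (metis singletonD)
    moreover have "card B dvd p ^ n" using cardorb xc x by blast
    ultimately show ?thesis using prime_power_dvd[OF p] by blast
  qed
  have "card K = card {\<one>} + card (\<Union>(Os - {{\<one>}}))"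
  proof -
    have "K = {\<one>} \<union> \<Union>(Os - {{\<one>}})" using UOs oneOs insert_Diff[OF oneOs] Union_insert[of "{\<one>}" "Os - {{\<one>}}"] by simp
    moreover have "{\<one>} \<inter> \<Union>(Os - {{\<one>}}) = {}"
    proof -
      have "\<one> \<notin> \<Union>(Os - {{\<one>}})"
      proof
        assume "\<one> \<in> \<Union>(Os - {{\<one>}})"
        then obtain B where B: "\<one> \<in> B" "B \<in> Os - {{\<one>}}" by (rule UnionE)
        from B(2) have "B \<in> Os" by (rule DiffD1)
        moreover from B(2) have "{\<one>} \<noteq> B" using DiffD2 singletonI by metis
        ultimately have "{\<one>} \<inter> B = {}" by (intro disjointD[OF disj oneOs])
        with B(1) show False by (metis IntI empty_iff singletonI)
      qed
      then show ?thesis by simp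
    qed
    moreover have "finite (\<Union>(Os - {{\<one>}}))"
      by (rule finite_subset[OF _ finK]) (use UOs in blast)
    ultimately show ?thesis using card_Un_disjoint[of "{\<one>}" "\<Union>(Os - {{\<one>}})"] by simp
  qed
  moreover have "p dvd card (\<Union>(Os - {{\<one>}}))"
  proof -
    have "card (\<Union>(Os - {{\<one>}})) = (\<Sum>B\<in>Os - {{\<one>}}. card B)"
    proof (rule card_Union_disjoint)
      show "pairwise disjnt (Os - {{\<one>}})"
        using disj by (auto simp: disjoint_def pairwise_def disjnt_def)
      show "finite B" if "B \<in> Os - {{\<one>}}" for B
        by (rule finite_subset[OF _ finK]) (use that UOs in blast)
    qed
    then show ?thesis using dvd_sum[of "Os - {{\<one>}}" p card] dvd by simp
  qed
  moreover have "p dvd card K"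
  proof -
    have "card K dvd p ^ n" using lagrange[OF K.is_subgroup] card by (metis dvd_triv_right order_def)
    moreover have "card K \<noteq> 1" using K1 K.one_closed card_1_singletonE[of K] by (metis singletonD)
    ultimately show ?thesis using prime_power_dvd[OF p] by blast
  qed
  ultimately have "p dvd card {\<one>}"
    using dvd_add_left_iff[of p "card (\<Union>(Os - {{\<one>}}))" "card {\<one>}"] by simp
  then show False using p by simp
qed

section \<open>Commutator identities, powers and centralizers\<close>

lemma cm_mult_right:
  "g \<in> carrier G \<Longrightarrow> x \<in> carrier G \<Longrightarrow> y \<in> carrier G \<Longrightarrow> cm g (x \<otimes> y) = cm g x \<otimes> (x \<otimes> cm g y \<otimes> inv x)"
  by (simp add: cm_def m_assoc inv_mult_group)

lemma cm_mult_left: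
  "g \<in> carrier G \<Longrightarrow> h \<in> carrier G \<Longrightarrow> x \<in> carrier G \<Longrightarrow> cm (g \<otimes> h) x = (g \<otimes> cm h x \<otimes> inv g) \<otimes> cm g x"
  by (simp add: cm_def m_assoc inv_mult_group)

lemma cm_swap: "x \<in> carrier G \<Longrightarrow> y \<in> carrier G \<Longrightarrow> x \<otimes> y = cm x y \<otimes> (y \<otimes> x)"
  by (simp add: cm_def m_assoc)

lemma conj_eq_iff:
  "g \<in> carrier G \<Longrightarrow> x \<in> carrier G \<Longrightarrow> g \<otimes> x \<otimes> inv g = x \<longleftrightarrow> g \<otimes> x = x \<otimes> g"
  using inv_solve_right'[of x "g \<otimes> x" g] by auto

lemma conj_mult:
  "g \<in> carrier G \<Longrightarrow> x \<in> carrier G \<Longrightarrow> y \<in> carrier G \<Longrightarrow>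
    g \<otimes> (x \<otimes> y) \<otimes> inv g = (g \<otimes> x \<otimes> inv g) \<otimes> (g \<otimes> y \<otimes> inv g)"
  by (simp add: m_assoc)

lemma conj_pow:
  "g \<in> carrier G \<Longrightarrow> x \<in> carrier G \<Longrightarrow> g \<otimes> x [^] (n::nat) \<otimes> inv g = (g \<otimes> x \<otimes> inv g) [^] n"
proof (induction n)
  case (Suc n)
  then show ?case using conj_mult[of g "x [^] n" x] by simp
qed simp

lemma commute_inv:
  assumes "x \<in> carrier G" "y \<in> carrier G" "x \<otimes> y = y \<otimes> x"
  shows "inv x \<otimes> y = y \<otimes> inv x"
proof -
  have "inv x \<otimes> y = inv x \<otimes> (y \<otimes> x) \<otimes> inv x" using assms(1,2) by (simp add: m_assoc)
  also have "\<dots> = inv x \<otimes> (x \<otimes> y) \<otimes> inv x" by (simp only: assms(3))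
  also have "\<dots> = y \<otimes> inv x" using assms(1,2) by simp
  finally show ?thesis .
qed

lemma commute_mult:
  assumes "x \<in> carrier G" "y \<in> carrier G" "h \<in> carrier G" "x \<otimes> h = h \<otimes> x" "y \<otimes> h = h \<otimes> y"
  shows "x \<otimes> y \<otimes> h = h \<otimes> (x \<otimes> y)"
proof -
  have "x \<otimes> y \<otimes> h = x \<otimes> h \<otimes> y" using assms(1-3,5) by (simp add: m_assoc)
  then show ?thesis using assms(1-4) by (simp add: m_assoc)
qed

lemma commute_int_pow:
  "x \<in> carrier G \<Longrightarrow> y \<in> carrier G \<Longrightarrow> x \<otimes> y = y \<otimes> x \<Longrightarrow> x [^] (i::int) \<otimes> y = y \<otimes> x [^] i"
proof -
  assume xy: "x \<in> carrier G" "y \<in> carrier G" "x \<otimes> y = y \<otimes> x"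
  have n: "x [^] (n::nat) \<otimes> y = y \<otimes> x [^] n" for n using group_commutes_pow[OF xy(3,1,2)] .
  have A: "inv (x [^] nat (- i)) \<otimes> y = y \<otimes> inv (x [^] nat (- i))"
    by (rule commute_inv) (use n xy in blast)+
  show ?thesis
  proof (cases "i < 0")
    case True
    show ?thesis unfolding int_pow_def2 if_P[OF True] by (rule A)
  next
    case False
    show ?thesis unfolding int_pow_def2 if_not_P[OF False] by (rule n)
  qed
qed

text \<open>Collection with \<open>w = [b,a]\<close> commuting with \<open>a\<close> and
  \<open>b\<close>: each time a \<open>b\<close> is moved past a later \<open>a\<close> one factor
  \<open>w\<close> appears, and there are \<open>n choose 2\<close> such pairs.\<close>

lemma class2_pow:
  assumes c: "a \<in> carrier G" "b \<in> carrier G" "w \<in> carrier G"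
    and ba: "b \<otimes> a = w \<otimes> (a \<otimes> b)" and wa: "w \<otimes> a = a \<otimes> w" and wb: "w \<otimes> b = b \<otimes> w"
  shows "(a \<otimes> b) [^] (n::nat) = a [^] n \<otimes> (b [^] n \<otimes> w [^] (n choose 2))"
proof -
  have W: "w [^] (i::nat) \<otimes> x = x \<otimes> w [^] i" if "x \<in> {a, b}" for i x
    using that c wa wb group_commutes_pow by auto
  have bn: "b [^] (n::nat) \<otimes> a = w [^] n \<otimes> (a \<otimes> b [^] n)" for n
  proof (induction n)
    case (Suc n)
    have "b [^] Suc n \<otimes> a = b [^] n \<otimes> (w \<otimes> (a \<otimes> b))" using c ba by (simp add: m_assoc)
    also have "\<dots> = w \<otimes> (b [^] n \<otimes> a) \<otimes> b"
    proof -
      have "b [^] n \<otimes> w = w \<otimes> b [^] n" using group_commutes_pow[of b w n] c wb by simp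
      then have "b [^] n \<otimes> w \<otimes> (a \<otimes> b) = w \<otimes> b [^] n \<otimes> (a \<otimes> b)" by simp
      then show ?thesis using c by (simp add: m_assoc)
    qed
    also have "\<dots> = (w \<otimes> w [^] n) \<otimes> (a \<otimes> b [^] Suc n)" using Suc c by (simp add: m_assoc)
    also have "w \<otimes> w [^] n = w [^] Suc n" using c by (metis nat_pow_Suc2)
    finally show ?case .
  qed (use c in simp)
  show ?thesis
  proof (induction n)
    case (Suc n)
    have "(a \<otimes> b) [^] Suc n = a [^] n \<otimes> (b [^] n \<otimes> (w [^] (n choose 2) \<otimes> a) \<otimes> b)"
      using Suc c by (simp add: m_assoc)
    also have "w [^] (n choose 2) \<otimes> a = a \<otimes> w [^] (n choose 2)" using W by simp
    also have "b [^] n \<otimes> (a \<otimes> w [^] (n choose 2)) \<otimes> b = (b [^] n \<otimes> a) \<otimes> (w [^] (n choose 2) \<otimes> b)"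
      using c by (simp add: m_assoc)
    also have "\<dots> = w [^] n \<otimes> (a \<otimes> b [^] n) \<otimes> (b \<otimes> w [^] (n choose 2))"
      using W bn by simp
    also have "\<dots> = (w [^] n \<otimes> a) \<otimes> (b [^] Suc n \<otimes> w [^] (n choose 2))" using c by (simp add: m_assoc)
    also have "w [^] n \<otimes> a = a \<otimes> w [^] n" using W by simp
    also have "a \<otimes> w [^] n \<otimes> (b [^] Suc n \<otimes> w [^] (n choose 2)) = a \<otimes> ((w [^] n \<otimes> b [^] Suc n) \<otimes> w [^] (n choose 2))"
      using c by (simp add: m_assoc)
    also have "w [^] n \<otimes> b [^] Suc n = b [^] Suc n \<otimes> w [^] n"
      using group_commutes_pow[of b "w [^] n" "Suc n"] W[of b n] c by simp
    also have "b [^] Suc n \<otimes> w [^] n \<otimes> w [^] (n choose 2) = b [^] Suc n \<otimes> w [^] (Suc n choose 2)"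
      using c by (simp add: m_assoc nat_pow_mult numeral_2_eq_2)
    finally show ?case using c by (simp add: m_assoc)
  qed (use c in \<open>simp add: numeral_2_eq_2\<close>)
qed

lemma center_commute: "c \<in> grp_center G \<Longrightarrow> g \<in> carrier G \<Longrightarrow> c \<otimes> g = g \<otimes> c"
  by (simp add: grp_center_def)

lemma center_closed: "c \<in> grp_center G \<Longrightarrow> c \<in> carrier G"
  by (simp add: grp_center_def)

lemma centralizer_subgroup:
  assumes S: "S \<subseteq> carrier G"
  shows "subgroup (centralizer G S) G"
proof (rule subgroupI)
  show "centralizer G S \<subseteq> carrier G" by (auto simp: centralizer_def)
  have "\<one> \<in> centralizer G S" using S by (auto simp: centralizer_def)
  then show "centralizer G S \<noteq> {}" by blast
  show "inv a \<in> centralizer G S" if "a \<in> centralizer G S" for a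
    using that S commute_inv unfolding centralizer_def by blast
  show "a \<otimes> b \<in> centralizer G S" if "a \<in> centralizer G S" "b \<in> centralizer G S" for a b
    using that S commute_mult unfolding centralizer_def by blast
qed

lemma subgroup_grp_center: "subgroup (grp_center G) G"
  using centralizer_subgroup[of "carrier G"] by (simp add: grp_center_def centralizer_def)

section \<open>Functions that are additive modulo a number\<close>

lemma addmodD: "addmod H m f \<Longrightarrow> x \<in> H \<Longrightarrow> y \<in> H \<Longrightarrow> [f (x \<otimes> y) = f x + f y] (mod m)"
  by (simp add: addmod_def)

lemma addmod_one: assumes "addmod H m f" "subgroup H G" shows "[f \<one> = 0] (mod m)"
  using addmodD[OF assms(1) subgroup.one_closed[OF assms(2)] subgroup.one_closed[OF assms(2)]]
  by (simp add: cong_iff_dvd_diff)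

lemma addmod_inv: assumes "addmod H m f" "subgroup H G" "x \<in> H" shows "[f (inv x) = - f x] (mod m)"
proof -
  have "[f (inv x \<otimes> x) = f (inv x) + f x] (mod m)"
    by (rule addmodD[OF assms(1) subgroup.m_inv_closed[OF assms(2,3)] assms(3)])
  moreover have "inv x \<otimes> x = \<one>" using subgroup.mem_carrier[OF assms(2,3)] by simp
  ultimately have "[f \<one> = f (inv x) + f x] (mod m)" by simp
  from this addmod_one[OF assms(1,2)] show ?thesis
    by (rule cong_lin(2)[where u = "-1" and u' = 1]) simp
qed

lemma addmod_nat_pow:
  assumes "addmod H m f" "subgroup H G" "x \<in> H"
  shows "[f (x [^] (n::nat)) = int n * f x] (mod m) \<and> x [^] n \<in> H"
proof (induction n)
  case 0
  then show ?case using addmod_one[OF assms(1,2)] subgroup.one_closed[OF assms(2)] by simp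
next
  case (Suc n)
  then have "[f (x [^] n \<otimes> x) = f (x [^] n) + f x] (mod m)"
    using addmodD[OF assms(1) _ assms(3)] by blast
  from this Suc[THEN conjunct1] have "[f (x [^] Suc n) = int (Suc n) * f x] (mod m)"
    by (rule cong_lin(2)[where u = 1 and u' = 1]) (simp add: algebra_simps)
  then show ?case using Suc subgroup.m_closed[OF assms(2) _ assms(3)] by simp
qed

lemma addmod_int_pow:
  assumes "addmod H m f" "subgroup H G" "x \<in> H"
  shows "[f (x [^] (i::int)) = i * f x] (mod m)"
proof (cases "i < 0")
  case True
  have n: "[f (x [^] nat (- i)) = int (nat (- i)) * f x] (mod m)" "x [^] nat (- i) \<in> H"
    using addmod_nat_pow[OF assms] by blast+
  from addmod_inv[OF assms(1,2) n(2)] n(1) show ?thesis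
    unfolding int_pow_def2 if_P[OF True]
    by (rule cong_lin(2)[where u = 1 and u' = "-1"]) (use True in simp)
next
  case False
  then have "int (nat i) = i" by simp
  then show ?thesis unfolding int_pow_def2 if_not_P[OF False]
    using addmod_nat_pow[OF assms, of "nat i"] by metis
qed

section \<open>Automorphisms from derivations into an abelian subgroup\<close>

lemma derivation_pow:
  assumes V: "V \<subseteq> carrier G" and d: "\<And>x y. x \<in> V \<Longrightarrow> y \<in> V \<Longrightarrow> d (x \<otimes> y) = d x \<otimes> d y"
    and V1: "\<one> \<in> V" and Xm: "\<And>x y. x \<in> V \<Longrightarrow> y \<in> V \<Longrightarrow> x \<otimes> y \<in> V" and dc: "\<And>x. x \<in> V \<Longrightarrow> d x \<in> carrier G"
    and x: "x \<in> V"
  shows "d (x [^] (n::nat)) = d x [^] n" "x [^] n \<in> V"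
proof -
  have "d \<one> \<otimes> d \<one> = d \<one>" using d[OF V1 V1] by simp
  then have d1: "d \<one> = \<one>" using dc[OF V1] l_cancel_one by blast
  have "d (x [^] n) = d x [^] n \<and> x [^] n \<in> V"
    by (induction n) (use d1 V1 x d Xm in simp_all)
  then show "d (x [^] (n::nat)) = d x [^] n" "x [^] n \<in> V" by simp_all
qed

text \<open>As \<open>V\<close> is abelian, \<open>d\<close> is a homomorphism on \<open>V\<close>,
  so the iterates of \<open>g \<mapsto> d(g)g\<close> expand binomially and stop after
  \<open>d(d g)\<close> by \<open>ddd\<close>. The exponents \<open>p\<close> and
  \<open>p choose 2\<close> are multiples of \<open>p\<close>, the second because \<open>p\<close>
  is odd. Hence the \<open>p\<close>-th iterate is the identity, which also gives
  bijectivity.\<close>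

lemma derivation_automorphism:
  fixes p :: nat
  assumes p: "Factorial_Ring.prime p" "odd p"
    and V: "subgroup V G" and Vcomm: "\<And>x y. x \<in> V \<Longrightarrow> y \<in> V \<Longrightarrow> x \<otimes> y = y \<otimes> x"
    and Vp: "\<And>x. x \<in> V \<Longrightarrow> x [^] p = \<one>"
    and d: "\<And>g. g \<in> carrier G \<Longrightarrow> d g \<in> V"
    and deriv: "\<And>g h. g \<in> carrier G \<Longrightarrow> h \<in> carrier G \<Longrightarrow> d (g \<otimes> h) = d g \<otimes> (g \<otimes> d h \<otimes> inv g)"
    and ddd: "\<And>g. g \<in> carrier G \<Longrightarrow> d (d (d g)) = \<one>"
  defines "\<phi> \<equiv> \<lambda>g \<in> carrier G. d g \<otimes> g"
  shows "\<phi> \<in> auto G" and "group.ord (AutoGroup G) \<phi> = p \<or> (\<forall>g \<in> carrier G. d g = \<one>)"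
proof -
  have VG: "V \<subseteq> carrier G" by (rule subgroup.subset[OF V])
  have VG': "x \<in> carrier G" if "x \<in> V" for x using VG that by blast
  have dG: "d g \<in> carrier G" if "g \<in> carrier G" for g using d[OF that] VG by blast
  have dV: "d (x \<otimes> y) = d x \<otimes> d y" if "x \<in> V" "y \<in> V" for x y
  proof -
    have "x \<otimes> d y \<otimes> inv x = d y"
      using Vcomm[OF that(1) d[OF VG'[OF that(2)]]] VG'[OF that(1)] dG[OF VG'[OF that(2)]]
      by (simp add: m_assoc)
    then show ?thesis using deriv[OF VG'[OF that(1)] VG'[OF that(2)]] by simp
  qed
  have dpow: "d (x [^] n) = d x [^] n" "x [^] n \<in> V" if x: "x \<in> V" for x and n :: nat
    using derivation_pow[where d = d, OF VG dV subgroup.one_closed[OF V] subgroup.m_closed[OF V] _ x]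
      dG VG' by blast+
  define \<psi> where "\<psi> g = d g \<otimes> g" for g
  have \<psi>G: "\<psi> g \<in> carrier G" if "g \<in> carrier G" for g using that dG by (simp add: \<psi>_def)
  have \<psi>m: "\<psi> (g \<otimes> h) = \<psi> g \<otimes> \<psi> h" if "g \<in> carrier G" "h \<in> carrier G" for g h
    using that dG by (simp add: \<psi>_def deriv m_assoc)
  have it: "(\<psi> ^^ k) g = d (d g) [^] (k choose 2) \<otimes> d g [^] k \<otimes> g" if g: "g \<in> carrier G" for k g
  proof (induction k)
    case 0
    then show ?case using g by (simp add: numeral_2_eq_2)
  next
    case (Suc k)
    let ?a = "d (d g)" and ?b = "d g" and ?c = "k choose 2"
    have aV: "?a \<in> V" and bV: "?b \<in> V" using g d dG by auto
    note powV = dpow(2)[OF aV] dpow(2)[OF bV]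
    have aG: "?a \<in> carrier G" and bG: "?b \<in> carrier G" using aV bV VG by auto
    have "d ?a = \<one>" by (rule ddd[OF g])
    then have 1: "\<psi> (?a [^] ?c) = ?a [^] ?c"
      using dpow(1)[OF aV] aG by (simp add: \<psi>_def)
    have comm: "?b [^] i \<otimes> ?a [^] j = ?a [^] j \<otimes> ?b [^] i" for i j :: nat
      using Vcomm powV by blast
    have 2: "\<psi> (?b [^] k) = ?a [^] k \<otimes> ?b [^] k"
      using dpow(1)[OF bV] by (simp add: \<psi>_def)
    have "(\<psi> ^^ Suc k) g = \<psi> (?a [^] ?c \<otimes> ?b [^] k \<otimes> g)" using Suc by simp
    also have "\<dots> = ?a [^] ?c \<otimes> (?a [^] k \<otimes> ?b [^] k) \<otimes> (?b \<otimes> g)"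
      using g aG bG by (simp add: \<psi>m 1 2) (simp add: \<psi>_def)
    also have "\<dots> = (?a [^] ?c \<otimes> ?a [^] k) \<otimes> (?b [^] k \<otimes> ?b) \<otimes> g"
      using g aG bG by (simp add: m_assoc)
    also have "?a [^] ?c \<otimes> ?a [^] k = ?a [^] (Suc k choose 2)"
      using aG by (simp add: nat_pow_mult numeral_2_eq_2 add.commute)
    also have "?b [^] k \<otimes> ?b = ?b [^] Suc k" by simp
    finally show ?case .
  qed
  have p2: "p choose 2 = p * ((p - 1) div 2)"
    using p(2) by (simp add: choose_two div_mult_swap)
  have itp: "(\<psi> ^^ p) g = g" if g: "g \<in> carrier G" for g
  proof -
    have "d (d g) [^] (p choose 2) = \<one>"
      using Vp[of "d (d g)"] d dG g by (simp add: p2 nat_pow_pow[symmetric])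
    then show ?thesis using it[OF g, of p] Vp[of "d g"] d g by simp
  qed
  have itG: "(\<psi> ^^ k) g \<in> carrier G" if "g \<in> carrier G" for k g
    using that \<psi>G by (induction k) simp_all
  have "\<phi> \<in> hom G G" unfolding \<phi>_def hom_def using \<psi>m \<psi>G by (auto simp: \<psi>_def)
  moreover have "\<phi> \<in> Bij (carrier G)"
  proof -
    have "bij_betw \<psi> (carrier G) (carrier G)"
    proof (rule bij_betwI[where g = "\<psi> ^^ (p - 1)"])
      have p': "p = Suc (p - 1)" using p(2) odd_pos by simp
      show "\<psi> \<in> carrier G \<rightarrow> carrier G" "\<psi> ^^ (p - 1) \<in> carrier G \<rightarrow> carrier G" using \<psi>G itG by auto
      show "(\<psi> ^^ (p - 1)) (\<psi> x) = x" if "x \<in> carrier G" for x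
        using itp[OF that] p' by (metis comp_apply funpow_Suc_right)
      show "\<psi> ((\<psi> ^^ (p - 1)) x) = x" if "x \<in> carrier G" for x
        using itp[OF that] p' by (metis comp_apply funpow.simps(2))
    qed
    then have "bij_betw \<phi> (carrier G) (carrier G)"
      by (rule bij_betw_cong[THEN iffD1, rotated]) (simp add: \<phi>_def \<psi>_def)
    then show ?thesis by (simp add: Bij_def \<phi>_def)
  qed
  ultimately show \<phi>: "\<phi> \<in> auto G" by (simp add: auto_def)
  interpret A: group "AutoGroup G" by (rule AutoGroup)
  have \<phi>A: "\<phi> \<in> carrier (AutoGroup G)" using \<phi> by (simp add: AutoGroup_def)
  have Amult: "f \<otimes>\<^bsub>AutoGroup G\<^esub> g = compose (carrier G) f g" if "f \<in> auto G" "g \<in> auto G" for f g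
    using that by (simp add: AutoGroup_def BijGroup_def auto_def)
  have Aone: "\<one>\<^bsub>AutoGroup G\<^esub> = (\<lambda>x\<in>carrier G. x)" by (simp add: AutoGroup_def BijGroup_def)
  have Apow: "\<phi> [^]\<^bsub>AutoGroup G\<^esub> k = (\<lambda>g\<in>carrier G. (\<psi> ^^ k) g)" for k :: nat
  proof (induction k)
    case 0
    then show ?case by (simp add: Aone)
  next
    case (Suc k)
    have "\<phi> [^]\<^bsub>AutoGroup G\<^esub> k \<in> auto G" using A.nat_pow_closed[OF \<phi>A] by (simp add: AutoGroup_def)
    then have "\<phi> [^]\<^bsub>AutoGroup G\<^esub> Suc k = compose (carrier G) (\<phi> [^]\<^bsub>AutoGroup G\<^esub> k) \<phi>"
      using Amult[OF _ \<phi>] by simp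
    also have "\<dots> = compose (carrier G) (\<lambda>g\<in>carrier G. (\<psi> ^^ k) g) \<phi>" by (simp only: Suc)
    also have "\<dots> = (\<lambda>g\<in>carrier G. (\<psi> ^^ k) (\<psi> g))"
      using \<psi>G by (auto simp: compose_def \<phi>_def \<psi>_def fun_eq_iff)
    finally show ?case by (simp add: funpow_swap1)
  qed
  have "\<phi> [^]\<^bsub>AutoGroup G\<^esub> p = \<one>\<^bsub>AutoGroup G\<^esub>"
    unfolding Apow Aone using itp by (auto simp: fun_eq_iff)
  then have "A.ord \<phi> dvd p" using A.pow_eq_id[OF \<phi>A] by blast
  then consider "A.ord \<phi> = 1" | "A.ord \<phi> = p" using p(1) prime_nat_iff by blast
  then show "A.ord \<phi> = p \<or> (\<forall>g \<in> carrier G. d g = \<one>)"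
  proof cases
    case 1
    then have "\<phi> = (\<lambda>x\<in>carrier G. x)" using A.ord_eq_1[OF \<phi>A] Aone by simp
    then have "d g \<otimes> g = g" if "g \<in> carrier G" for g
      using that by (auto simp: \<phi>_def fun_eq_iff dest: spec[of _ g])
    then show ?thesis using dG r_cancel_one by blast
  qed simp
qed

section \<open>Normality of commutator and power subgroups\<close>

lemma conj_cm:
  "g \<in> carrier G \<Longrightarrow> h \<in> carrier G \<Longrightarrow> k \<in> carrier G \<Longrightarrow>
    g \<otimes> cm h k \<otimes> inv g = cm (g \<otimes> h \<otimes> inv g) (g \<otimes> k \<otimes> inv g)"
  by (simp add: cm_def m_assoc inv_mult_group)

lemma commutator_subgroup_cm:
  "commutator_subgroup G H K = generate G {cm h k | h k. h \<in> H \<and> k \<in> K}"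
proof -
  have "(\<Union>h\<in>H. \<Union>k\<in>K. {h \<otimes> k \<otimes> inv h \<otimes> inv k}) = {cm h k | h k. h \<in> H \<and> k \<in> K}"
    unfolding cm_def by blast
  then show ?thesis by (simp add: commutator_subgroup_def)
qed

lemma commutator_subgroup_mem: "h \<in> H \<Longrightarrow> k \<in> K \<Longrightarrow> cm h k \<in> commutator_subgroup G H K"
  unfolding commutator_subgroup_cm by (rule generate.incl) blast

lemma commutator_subgroup_normal:
  assumes H: "H \<lhd> G"
  shows "commutator_subgroup G H (carrier G) \<lhd> G"
  unfolding commutator_subgroup_cm
proof (rule normal_generateI)
  have HG: "h \<in> carrier G" if "h \<in> H" for h
    using subgroup.mem_carrier[OF normal_imp_subgroup[OF H] that] .
  show "{cm h k | h k. h \<in> H \<and> k \<in> carrier G} \<subseteq> carrier G" using HG by auto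
  fix x g assume "x \<in> {cm h k | h k. h \<in> H \<and> k \<in> carrier G}" and g: "g \<in> carrier G"
  then obtain h k where hk: "x = cm h k" "h \<in> H" "k \<in> carrier G" by blast
  have "g \<otimes> x \<otimes> inv g = cm (g \<otimes> h \<otimes> inv g) (g \<otimes> k \<otimes> inv g)"
    unfolding hk(1) by (rule conj_cm[OF g HG[OF hk(2)] hk(3)])
  moreover have "g \<otimes> h \<otimes> inv g \<in> H" by (rule normal_invE(2)[OF H g hk(2)])
  moreover have "g \<otimes> k \<otimes> inv g \<in> carrier G" using g hk(3) by simp
  ultimately show "g \<otimes> x \<otimes> inv g \<in> {cm h k | h k. h \<in> H \<and> k \<in> carrier G}" by blast
qed

lemma power_subgroup_normal: "power_subgroup G n \<lhd> G"
  unfolding power_subgroup_def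
proof (rule normal_generateI)
  fix x g assume "x \<in> (\<lambda>g. g [^] n) ` carrier G" and g: "g \<in> carrier G"
  then obtain y where "x = y [^] n" "y \<in> carrier G" by blast
  then have "g \<otimes> x \<otimes> inv g = (g \<otimes> y \<otimes> inv g) [^] n" "g \<otimes> y \<otimes> inv g \<in> carrier G"
    using conj_pow[OF g] g by simp_all
  then show "g \<otimes> x \<otimes> inv g \<in> (\<lambda>g. g [^] n) ` carrier G" by blast
qed auto

lemma normal_set_mult:
  assumes H: "H \<lhd> G" and K: "K \<lhd> G"
  shows "H <#> K \<lhd> G"
proof (rule normal_invI)
  note sub = normal_imp_subgroup[OF H] normal_imp_subgroup[OF K]
  have HG: "h \<in> carrier G" if "h \<in> H" for h using subgroup.mem_carrier[OF sub(1) that] .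
  have KG: "k \<in> carrier G" if "k \<in> K" for k using subgroup.mem_carrier[OF sub(2) that] .
  show "subgroup (H <#> K) G"
    using mult_norm_subgroup[OF H sub(2)] .
  fix g x assume g: "g \<in> carrier G" and "x \<in> H <#> K"
  then obtain h k where hk: "x = h \<otimes> k" "h \<in> H" "k \<in> K" by (auto simp: set_mult_def)
  have "g \<otimes> x \<otimes> inv g = (g \<otimes> h \<otimes> inv g) \<otimes> (g \<otimes> k \<otimes> inv g)"
    unfolding hk(1) by (rule conj_mult[OF g HG[OF hk(2)] KG[OF hk(3)]])
  then show "g \<otimes> x \<otimes> inv g \<in> H <#> K"
    using normal_invE(2)[OF H g hk(2)] normal_invE(2)[OF K g hk(3)] by (auto simp: set_mult_def)
qed

lemma central_pow: "(\<And>g. g \<in> carrier G \<Longrightarrow> c \<otimes> g = g \<otimes> c) \<Longrightarrow> c \<in> carrier G \<Longrightarrow> g \<in> carrier G \<Longrightarrow>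
    c [^] (n::nat) \<otimes> g = g \<otimes> c [^] n"
  using group_commutes_pow by blast

text \<open>Baer's trick: \<open>x + y = x y [x,y]\<^sup>-\<^sup>q\<close> with \<open>q = 1/2\<close> is an elementary abelian group law, for which \<open>F\<close> is
  additive.\<close>

lemma baer_hom:
  fixes p q :: nat
  assumes fin: "finite (carrier G)" and p: "Factorial_Ring.prime p" and q: "2 * q = p + 1"
    and pw: "\<And>x. x \<in> carrier G \<Longrightarrow> x [^] p = \<one>"
    and cl2: "\<And>x y g. x \<in> carrier G \<Longrightarrow> y \<in> carrier G \<Longrightarrow> g \<in> carrier G \<Longrightarrow> cm x y \<otimes> g = g \<otimes> cm x y"
    and u: "u \<in> carrier G" "u \<noteq> \<one>"
  shows "\<exists>F. (\<forall>x \<in> carrier G. \<forall>y \<in> carrier G. [F (x \<otimes> y) = F x + F y + int q * F (cm x y)] (mod int p))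
    \<and> [F \<one> = 0] (mod int p) \<and> [F u = 1] (mod int p)"
proof -
  define C where "C = {c \<in> carrier G. \<forall>g \<in> carrier G. c \<otimes> g = g \<otimes> c}"
  have CG: "c \<in> carrier G" if "c \<in> C" for c using that by (simp add: C_def)
  have Cc: "c \<otimes> g = g \<otimes> c" if "c \<in> C" "g \<in> carrier G" for c g using that by (simp add: C_def)
  have cmC: "cm x y \<in> C" if "x \<in> carrier G" "y \<in> carrier G" for x y using that cl2 by (simp add: C_def)
  have powC: "c [^] (n::nat) \<in> C" if "c \<in> C" for c n
    using central_pow[OF Cc[OF that] CG[OF that]] CG[OF that] by (simp add: C_def)
  have cmr: "cm x (y \<otimes> w) = cm x y \<otimes> cm x w" if "x \<in> carrier G" "y \<in> carrier G" "w \<in> carrier G" for x y w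
  proof -
    have "y \<otimes> cm x w \<otimes> inv y = cm x w" using conj_eq_iff[of y "cm x w"] cl2[OF that(1,3,2)] that by simp
    then show ?thesis using that by (simp add: cm_mult_right)
  qed
  have cml: "cm (x \<otimes> y) w = cm y w \<otimes> cm x w" if "x \<in> carrier G" "y \<in> carrier G" "w \<in> carrier G" for x y w
  proof -
    have "x \<otimes> cm y w \<otimes> inv x = cm y w" using conj_eq_iff[of x "cm y w"] cl2[OF that(2,3,1)] that by simp
    then show ?thesis using that by (simp add: cm_mult_left)
  qed
  have cmc: "cm c x = \<one>" "cm x c = \<one>" if "c \<in> C" "x \<in> carrier G" for c x
    using cm_eq_one_iff Cc[OF that] CG[OF that(1)] that(2) by metis+
  define pl where "pl x y = x \<otimes> y \<otimes> cm y x [^] q" for x y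
  let ?B = "\<lparr>carrier = carrier G, monoid.mult = pl, one = \<one>\<rparr>"
  have plG: "pl x y \<in> carrier G" if "x \<in> carrier G" "y \<in> carrier G" for x y
    using that by (simp add: pl_def)
  have plC: "pl x c = x \<otimes> c" if "c \<in> C" "x \<in> carrier G" for c x
    using cmc[OF that] that CG by (simp add: pl_def)
  have assoc: "pl (pl x y) w = pl x (pl y w)" if xyw: "x \<in> carrier G" "y \<in> carrier G" "w \<in> carrier G" for x y w
  proof -
    let ?a = "cm y x [^] q" and ?b = "cm w y [^] q" and ?c = "cm w x [^] q"
    have abc: "?a \<in> C" "?b \<in> C" "?c \<in> C" using powC cmC xyw by auto
    note G = xyw abc[THEN CG]
    have 1: "cm w (x \<otimes> y \<otimes> ?a) = cm w x \<otimes> cm w y" using xyw cmc[OF abc(1) xyw(3)] CG[OF abc(1)] by (simp add: cmr)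
    have 2: "cm (y \<otimes> w \<otimes> ?b) x = cm w x \<otimes> cm y x" using xyw cmc[OF abc(2) xyw(1)] CG[OF abc(2)] by (simp add: cml)
    have 3: "(cm w x \<otimes> cm w y) [^] q = ?c \<otimes> ?b" by (intro pow_mult_distrib Cc cmC cm_closed xyw)
    have 4: "(cm w x \<otimes> cm y x) [^] q = ?c \<otimes> ?a" by (intro pow_mult_distrib Cc cmC cm_closed xyw)
    have "pl (pl x y) w = (x \<otimes> y) \<otimes> (?a \<otimes> w) \<otimes> (?c \<otimes> ?b)" unfolding pl_def 1 3 using G by (simp add: m_assoc)
    also have "\<dots> = x \<otimes> y \<otimes> w \<otimes> (?a \<otimes> (?c \<otimes> ?b))" unfolding Cc[OF abc(1) xyw(3)] using G by (simp add: m_assoc)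
    also have "?a \<otimes> (?c \<otimes> ?b) = (?c \<otimes> ?b) \<otimes> ?a" by (rule Cc[OF abc(1)]) (use G in simp)
    also have "(?c \<otimes> ?b) \<otimes> ?a = ?b \<otimes> (?c \<otimes> ?a)" unfolding Cc[OF abc(3) G(5)] using G by (simp add: m_assoc)
    also have "x \<otimes> y \<otimes> w \<otimes> (?b \<otimes> (?c \<otimes> ?a)) = pl x (pl y w)" unfolding pl_def 2 4 using G by (simp add: m_assoc)
    finally show ?thesis .
  qed
  have comm: "pl x y = pl y x" if xy: "x \<in> carrier G" "y \<in> carrier G" for x y
  proof -
    let ?c = "cm x y"
    have c: "?c \<in> carrier G" using xy by simp
    \<comment> \<open>As \<open>2 * q = p + 1\<close>, the \<open>q\<close>-th power is a square
      root of \<open>?c\<close>. This is what makes the twisted product symmetric.\<close>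
    have "?c [^] (2 * q) = ?c" unfolding q using pw[OF c] c by simp
    then have "?c [^] q \<otimes> ?c [^] q = ?c" using c by (simp add: nat_pow_mult flip: mult_2)
    then have 1: "?c \<otimes> inv (?c [^] q) = ?c [^] q" using c by (metis inv_solve_right nat_pow_closed)
    have "pl x y = (?c \<otimes> (y \<otimes> x)) \<otimes> inv ?c [^] q" unfolding pl_def cm_inv[OF xy] by (simp only: cm_swap[OF xy, symmetric])
    also have "\<dots> = (y \<otimes> x) \<otimes> (?c \<otimes> inv (?c [^] q))"
      using cl2[OF xy m_closed[OF xy(2,1)]] c xy by (simp add: m_assoc nat_pow_inv)
    finally show ?thesis unfolding 1 by (simp add: pl_def)
  qed
  have B: "group ?B"
  proof (rule groupI)
    show "\<exists>y \<in> carrier ?B. y \<otimes>\<^bsub>?B\<^esub> x = \<one>\<^bsub>?B\<^esub>" if "x \<in> carrier ?B" for x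
    proof (intro bexI)
      have "cm x (inv x) = \<one>" using that by (simp add: cm_def)
      then show "inv x \<otimes>\<^bsub>?B\<^esub> x = \<one>\<^bsub>?B\<^esub>" using that by (simp add: pl_def)
    qed (use that in simp)
    show "\<one>\<^bsub>?B\<^esub> \<otimes>\<^bsub>?B\<^esub> x = x" if "x \<in> carrier ?B" for x
      using that by (simp add: pl_def cm_def)
  qed (use plG assoc in simp_all)
  then interpret B: group ?B .
  have powB: "x [^]\<^bsub>?B\<^esub> (n::nat) = x [^] n" if x: "x \<in> carrier G" for x n
  proof (induction n)
    case (Suc n)
    have "cm x (x [^] n) = \<one>" using x cm_eq_one_iff[of x "x [^] n"] by (simp flip: nat_pow_Suc2)
    then show ?case using Suc x by (simp add: pl_def)
  qed simp
  \<comment> \<open>Powers in \<open>?B\<close> agree with powers in \<open>G\<close>, so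
    \<open>?B\<close> is elementary abelian and its trivial subgroup already satisfies the closure
    conditions of \<open>exists_hom_mod\<close>.\<close>
  have "\<exists>f. B.addmod (carrier ?B) (int p) f \<and> (\<forall>s \<in> {\<one>}. [f s = 0] (mod int p)) \<and> [f u = 1] (mod int p)"
  proof (rule B.exists_hom_mod[OF _ p])
    show "subgroup {\<one>} ?B" using B.triv_subgroup by simp
    show "B.cm x y \<in> {\<one>}" if xy: "x \<in> carrier ?B" "y \<in> carrier ?B" for x y
      using B.cm_eq_one_iff[OF xy] comm xy by simp
    show "x [^]\<^bsub>?B\<^esub> p \<in> {\<one>}" if "x \<in> carrier ?B" for x using that powB pw by simp
  qed (use fin u in auto)
  then obtain F where F0: "B.addmod (carrier ?B) (int p) F" "[F u = 1] (mod int p)" "[F \<one> = 0] (mod int p)" by blast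
  have F: "[F (pl x y) = F x + F y] (mod int p)" if "x \<in> carrier G" "y \<in> carrier G" for x y
    using B.addmodD[OF F0(1), of x y] that by simp
  have "[F (x \<otimes> y) = F x + F y + int q * F (cm x y)] (mod int p)" if xy: "x \<in> carrier G" "y \<in> carrier G" for x y
  proof -
    let ?c = "cm x y"
    have c: "?c \<in> carrier G" using xy by simp
    have "pl x y \<otimes> ?c [^] q = x \<otimes> y"
      unfolding pl_def cm_inv[OF xy, symmetric] using xy c by (simp add: m_assoc nat_pow_inv)
    then have "x \<otimes> y = pl (pl x y) (?c [^] q)"
      unfolding plC[OF powC[OF cmC[OF xy]] plG[OF xy]] by (rule sym)
    then have 1: "[F (x \<otimes> y) = F (pl x y) + F (?c [^] q)] (mod int p)"
      using F[OF plG[OF xy] nat_pow_closed[OF c]] by simp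
    have "[F (?c [^]\<^bsub>?B\<^esub> q) = int q * F ?c] (mod int p)"
      using B.addmod_nat_pow[OF F0(1) B.subgroup_self] c by simp
    then have "[F (?c [^] q) = int q * F ?c] (mod int p)" unfolding powB[OF c] .
    from 1 this F[OF xy] show ?thesis by (rule cong_lin(3)[where u = 1 and u' = 1 and u'' = 1]) simp
  qed
  then show ?thesis using F0(2,3) by blast
qed

end

section \<open>Groups all of whose automorphisms of order $p$ are inner\<close>

text \<open>The subgroup \<open>N\<close> enters through its properties: the quotient has exponent
  dividing \<open>p\<close> and class at most 2, and \<open>N\<close> lies in every subgroup that
  contains all p-th powers and all commutators. With \<open>inn\<close> the locale is the situation
  to be refuted.\<close>

locale inner_p_group = group G for G (structure) +
  fixes p :: nat and \<zeta> :: 'a and N :: "'a set"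
  assumes p: "Factorial_Ring.prime p" "odd p"
    and fin: "finite (carrier G)"
    and card_G: "\<exists>n. card (carrier G) = p ^ n"
    and nonabelian: "\<not> comm_group G"
    and \<zeta>: "\<zeta> \<in> carrier G" "grp_center G = range (\<lambda>i::int. \<zeta> [^] i)"
    and inn: "f \<in> auto G \<Longrightarrow> group.ord (AutoGroup G) f = p \<Longrightarrow> inner_auto G f"
    and N: "N \<lhd> G"
    and N_pow: "g \<in> carrier G \<Longrightarrow> g [^] p \<in> N"
    and N_cm: "g \<in> carrier G \<Longrightarrow> a \<in> carrier G \<Longrightarrow> b \<in> carrier G \<Longrightarrow> cm g (cm a b) \<in> N"
    and N_least: "subgroup H G \<Longrightarrow> (\<And>g. g \<in> carrier G \<Longrightarrow> g [^] p \<in> H) \<Longrightarrow>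
      (\<And>a b. a \<in> carrier G \<Longrightarrow> b \<in> carrier G \<Longrightarrow> cm a b \<in> H) \<Longrightarrow> N \<subseteq> H"
    and N_centralizer: "\<not> centralizer G (subgroup_center G N) \<subseteq> N"
begin

abbreviation pcong :: "int \<Rightarrow> int \<Rightarrow> bool" (infix \<open>\<doteq>\<close> 50) where
  "a \<doteq> b \<equiv> [a = b] (mod int p)"

abbreviation Z where "Z \<equiv> grp_center G"

definition z where "z = \<zeta> [^] (ord \<zeta> div p)"

lemma p_pos: "p > 0" using p(1) by (simp add: prime_gt_0_nat)

lemma exists_inverse: 
  assumes "\<not> i \<doteq> 0"
  obtains k where "i * k \<doteq> 1"
proof -
  have "coprime i (int p)" 
    using assms p(1) prime_imp_coprime[of "int p" i] by (simp add: cong_0_iff coprime_commute)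
  then show thesis using cong_solve_coprime_int that by blast
qed

definition half :: int where "half = (int p + 1) div 2"

lemma half: "2 * half \<doteq> 1"
proof -
  obtain k where "p = 2 * k + 1" using p(2) by (rule oddE)
  then have "2 * half = int p + 1" unfolding half_def by simp
  then show ?thesis by (simp add: cong_iff_dvd_diff)
qed

lemma Z_mem: "\<zeta> [^] (i::int) \<in> Z" using \<zeta>(2) by blast

lemma N_sub: "subgroup N G" using N by (rule normal_imp_subgroup)

section \<open>The subgroup of order \<open>p\<close> in the cyclic center\<close>

lemma p_dvd_ord: assumes "x \<in> carrier G" "x \<noteq> \<one>" shows "p dvd ord x"
proof -
  obtain n where n: "card (carrier G) = p ^ n" using card_G by blast
  have "ord x dvd p ^ n" using ord_dvd_group_order[OF assms(1)] n by (simp add: order_def)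
  moreover have "ord x \<noteq> 1" using ord_eq_1 assms by blast
  ultimately show ?thesis by (intro prime_power_dvd[OF p(1)])
qed

lemma ord_quotient: assumes "x \<in> carrier G" "x \<noteq> \<one>" shows "ord (x [^] (ord x div p)) = p"
proof -
  have d: "p dvd ord x" by (rule p_dvd_ord[OF assms])
  have pos: "ord x > 0" using ord_ge_1[OF fin assms(1)] by simp
  then have "ord x div p > 0" using d p_pos by (simp add: div_greater_zero_iff dvd_imp_le)
  then have "ord (x [^] (ord x div p)) = ord x div (ord x div p)"
    using d by (intro ord_pow[OF assms(1)]) (auto simp: dvd_div_eq_mult)
  then show ?thesis using d pos p_pos by auto
qed

lemma \<zeta>_ne_one: "\<zeta> \<noteq> \<one>"
proof
  assume "\<zeta> = \<one>"
  then have Z1: "Z = {\<one>}" using \<zeta>(2) by auto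
  obtain n where n: "card (carrier G) = p ^ n" using card_G by blast
  have "carrier G \<noteq> {\<one>}" 
  proof
    assume "carrier G = {\<one>}"
    then have "comm_group G" by (intro group_comm_groupI) auto
    then show False using nonabelian by blast
  qed
  moreover have "carrier G \<lhd> G" using normal_invI[OF subgroup_self] by simp
  ultimately show False using normal_meets_center[OF fin p(1) n] Z1 by blast
qed

lemma z_closed [simp]: "z \<in> carrier G" using \<zeta> by (simp add: z_def)

lemma ord_z: "ord z = p" unfolding z_def by (rule ord_quotient[OF \<zeta>(1) \<zeta>_ne_one])

lemma z_Z: "z \<in> Z" unfolding z_def using Z_mem[of "int (ord \<zeta> div p)"] by (simp add: int_pow_int)

lemma zpow_closed [simp]: "z [^] (i::int) \<in> carrier G" by simp

lemma zpow_Z: "z [^] (i::int) \<in> Z"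
  using subgroup_grp_center z_Z by (metis group.int_pow_closed group_axioms subgroup_int_pow_closed)

lemma zpow_eq: "z [^] (i::int) = z [^] (j::int) \<longleftrightarrow> i \<doteq> j"
  using int_pow_eq[OF z_closed, of i j] ord_z by (simp add: cong_iff_dvd_diff dvd_diff_commute)

lemma zpow_eq_one: "z [^] (i::int) = \<one> \<longleftrightarrow> i \<doteq> 0"
  using zpow_eq[of i 0] by simp

lemma z_commute: "g \<in> carrier G \<Longrightarrow> z [^] (i::int) \<otimes> g = g \<otimes> z [^] i"
  by (rule center_commute[OF zpow_Z])

lemma order_p_center:
  assumes "c \<in> Z" "c [^] p = \<one>"
  obtains i :: int where "c = z [^] i"
proof -
  obtain j :: int where j: "c = \<zeta> [^] j" using assms(1) \<zeta>(2) by blast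
  have "\<zeta> [^] (j * int p) = \<one>" using assms(2) j \<zeta>(1) by (simp add: int_pow_pow[symmetric] int_pow_int)
  then have "int (ord \<zeta>) dvd j * int p" using int_pow_eq_id[OF \<zeta>(1)] by blast
  moreover obtain m where m: "ord \<zeta> = p * m" using p_dvd_ord[OF \<zeta>(1) \<zeta>_ne_one] by blast
  ultimately have "int m dvd j" using p_pos by (simp add: mult.commute)
  then obtain i where "j = int m * i" by blast
  moreover have "ord \<zeta> div p = m" using m p_pos by simp
  ultimately have "c = z [^] i" using \<zeta>(1) by (simp add: z_def j int_pow_pow[symmetric] int_pow_int)
  then show thesis by (rule that)
qed

text \<open>A nontrivial normal subgroup of a \<open>p\<close>-group meets the center nontrivially,
  and a cyclic center has only one subgroup of order \<open>p\<close>. Below this serves as an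
  injectivity test: a normal subgroup that misses \<open>z\<close> is trivial.\<close>

lemma z_mem_normal:
  assumes K: "K \<lhd> G" and ne: "x \<in> K" "x \<noteq> \<one>"
  shows "z \<in> K"
proof -
  obtain n where n: "card (carrier G) = p ^ n" using card_G by blast
  obtain c where c: "c \<in> K" "c \<noteq> \<one>" "c \<in> Z"
    using normal_meets_center[OF fin p(1) n K] ne by blast
  have cG: "c \<in> carrier G" by (rule center_closed[OF c(3)])
  define b where "b = c [^] (ord c div p)"
  have ob: "ord b = p" unfolding b_def by (rule ord_quotient[OF cG c(2)])
  have bG: "b \<in> carrier G" using cG by (simp add: b_def)
  have bZ: "b \<in> Z" unfolding b_def using subgroup_int_pow_closed[OF subgroup_grp_center c(3)]
    by (metis int_pow_int)
  have sK: "subgroup K G" using K by (rule normal_imp_subgroup)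
  have bK: "b \<in> K" unfolding b_def using subgroup_int_pow_closed[OF sK c(1)]
    by (metis int_pow_int)
  obtain i :: int where i: "b = z [^] i"
    using order_p_center[OF bZ] pow_ord_eq_1[OF bG] ob by auto
  have "b \<noteq> \<one>" using ob ord_eq_1[OF bG] p(1) by (metis not_prime_1)
  then have "\<not> i \<doteq> 0" using i zpow_eq_one by blast
  then obtain k where "i * k \<doteq> 1" by (rule exists_inverse)
  then have "b [^] k = z" using i zpow_eq[of "i * k" 1] by (simp add: int_pow_pow)
  then show ?thesis using subgroup_int_pow_closed[OF sK bK] by metis
qed

lemma inner_of_derivation:
  assumes V: "subgroup V G" and Vcomm: "\<And>x y. x \<in> V \<Longrightarrow> y \<in> V \<Longrightarrow> x \<otimes> y = y \<otimes> x"
    and Vp: "\<And>x. x \<in> V \<Longrightarrow> x [^] p = \<one>"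
    and d: "\<And>g. g \<in> carrier G \<Longrightarrow> d g \<in> V"
    and deriv: "\<And>g h. g \<in> carrier G \<Longrightarrow> h \<in> carrier G \<Longrightarrow> d (g \<otimes> h) = d g \<otimes> (g \<otimes> d h \<otimes> inv g)"
    and ddd: "\<And>g. g \<in> carrier G \<Longrightarrow> d (d (d g)) = \<one>"
  shows "\<exists>s \<in> carrier G. \<forall>g \<in> carrier G. cm g s = d g"
proof -
  have VG: "x \<in> carrier G" if "x \<in> V" for x using subgroup.mem_carrier[OF V that] .
  have dG: "d g \<in> carrier G" if "g \<in> carrier G" for g using VG d that by blast
  \<comment> \<open>Conjugation by \<open>s\<close> sends \<open>g\<close> to
    \<open>[g,s]\<^sup>-\<^sup>1 g\<close>, so the automorphism must be built from the inverse of
    \<open>d\<close>.\<close>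
  define e where "e g = inv (d g)" for g
  have eV: "e g \<in> V" if "g \<in> carrier G" for g
    using subgroup.m_inv_closed[OF V d[OF that]] by (simp add: e_def)
  have ederiv: "e (g \<otimes> h) = e g \<otimes> (g \<otimes> e h \<otimes> inv g)" if gh: "g \<in> carrier G" "h \<in> carrier G" for g h
  proof -
    have 1: "g \<otimes> d h \<otimes> inv g = inv (d g) \<otimes> d (g \<otimes> h)" using deriv[OF gh] dG gh by simp
    have "inv (d g) \<otimes> d (g \<otimes> h) \<in> V"
      by (intro subgroup.m_closed[OF V] subgroup.m_inv_closed[OF V] d m_closed gh)
    then have conjV: "g \<otimes> d h \<otimes> inv g \<in> V" by (simp only: 1)
    have "e (g \<otimes> h) = inv (g \<otimes> d h \<otimes> inv g) \<otimes> inv (d g)"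
      using gh dG by (simp add: e_def deriv inv_mult_group)
    also have "\<dots> = inv (d g) \<otimes> inv (g \<otimes> d h \<otimes> inv g)"
      by (intro Vcomm subgroup.m_inv_closed[OF V] conjV d gh)
    also have "inv (g \<otimes> d h \<otimes> inv g) = g \<otimes> e h \<otimes> inv g"
      using gh dG by (simp add: e_def inv_mult_group m_assoc)
    finally show ?thesis by (simp add: e_def)
  qed
  have dmul: "d (x \<otimes> y) = d x \<otimes> d y" if "x \<in> V" "y \<in> V" for x y
  proof -
    have "x \<otimes> d y = d y \<otimes> x" by (intro Vcomm d VG that)
    then have "x \<otimes> d y \<otimes> inv x = d y" using conj_eq_iff[of x "d y"] VG dG that by blast
    then show ?thesis using deriv VG that by metis
  qed
  have d1: "d \<one> = \<one>" using dmul[OF subgroup.one_closed[OF V] subgroup.one_closed[OF V]] dG[OF one_closed]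
    by (metis l_cancel_one l_one one_closed)
  have dinv: "d (inv x) = inv (d x)" if "x \<in> V" for x
  proof -
    have "d (inv x) \<otimes> d x = \<one>"
      using dmul[OF subgroup.m_inv_closed[OF V that] that] d1 VG[OF that] by simp
    then show ?thesis using VG[OF that] dG by (metis inv_closed inv_equality)
  qed
  have eee: "e (e (e g)) = \<one>" if g: "g \<in> carrier G" for g
  proof -
    have "e (e g) = d (d g)" using dinv[OF d[OF g]] dG g by (simp add: e_def)
    then show ?thesis using ddd[OF g] by (simp add: e_def)
  qed
  define \<phi> where "\<phi> = (\<lambda>g\<in>carrier G. e g \<otimes> g)"
  note der = derivation_automorphism[where d = e, OF p V Vcomm Vp eV ederiv eee, folded \<phi>_def]
  have \<phi>: "\<phi> \<in> auto G" "group.ord (AutoGroup G) \<phi> = p \<or> (\<forall>g \<in> carrier G. e g = \<one>)"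
    by (rule der; assumption)+
  show ?thesis
  proof (cases "\<forall>g \<in> carrier G. e g = \<one>")
    case True
    then have "cm g \<one> = d g" if "g \<in> carrier G" for g
      using that dG by (auto simp: e_def cm_def)
    then show ?thesis using one_closed by blast
  next
    case False
    then have "inner_auto G \<phi>" using inn \<phi> by blast
    then obtain s where s: "s \<in> carrier G" "\<And>g. g \<in> carrier G \<Longrightarrow> \<phi> g = s \<otimes> g \<otimes> inv s"
      unfolding inner_auto_def by blast
    have "cm g s = d g" if g: "g \<in> carrier G" for g
    proof -
      have "inv (d g) \<otimes> g = s \<otimes> g \<otimes> inv s" using s(2)[OF g] g by (simp add: \<phi>_def e_def)
      then have "g = d g \<otimes> (s \<otimes> g \<otimes> inv s)" using g dG s(1) by (metis inv_solve_left' m_closed inv_closed)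
      then have "cm g s = d g \<otimes> (s \<otimes> g \<otimes> inv s) \<otimes> s \<otimes> inv g \<otimes> inv s" by (simp only: cm_def)
      also have "\<dots> = d g" using g dG s(1) by (simp add: m_assoc)
      finally show ?thesis .
    qed
    then show ?thesis using s(1) by blast
  qed
qed

lemma addmod_add: "addmod H m f \<Longrightarrow> addmod H m f' \<Longrightarrow> addmod H m (\<lambda>x. f x + f' x)"
  unfolding addmod_def
  by (intro ballI, rule cong_lin(2)[where u = 1 and u' = 1], blast, blast, simp)

lemma addmod_scale: "addmod H m f \<Longrightarrow> addmod H m (\<lambda>x. c * f x)"
  unfolding addmod_def
  by (intro ballI, rule cong_lin(1)[where u = c], blast, simp add: algebra_simps)

text \<open>The commutator map of \<open>d \<in> D\<close> is a homomorphism into \<open>\<langle>z\<rangle>\<close>, with exponents \<open>dex d g\<close> that are determined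
  modulo \<open>p\<close> only.\<close>

definition D where "D = {d \<in> carrier G. \<forall>g \<in> carrier G. \<exists>i::int. cm g d = z [^] i}"

definition dex :: "'a \<Rightarrow> 'a \<Rightarrow> int" where "dex d g = (SOME i. cm g d = z [^] i)"

lemma D_closed: "d \<in> D \<Longrightarrow> d \<in> carrier G" by (simp add: D_def)

lemma cm_D: "d \<in> D \<Longrightarrow> g \<in> carrier G \<Longrightarrow> cm g d = z [^] dex d g"
  unfolding dex_def by (rule someI_ex) (simp add: D_def)

lemma dex_eq: "d \<in> D \<Longrightarrow> g \<in> carrier G \<Longrightarrow> cm g d = z [^] i \<Longrightarrow> dex d g \<doteq> i"
  using cm_D zpow_eq by metis

lemma conj_D: "d \<in> D \<Longrightarrow> g \<in> carrier G \<Longrightarrow> g \<otimes> d \<otimes> inv g = z [^] dex d g \<otimes> d"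
  using conj_eq_cm cm_D D_closed by metis

lemma z_conj: "g \<in> carrier G \<Longrightarrow> g \<otimes> z [^] (i::int) \<otimes> inv g = z [^] i"
  using conj_eq_iff z_commute zpow_closed by metis

lemma dex_addmod: "d \<in> D \<Longrightarrow> addmod (carrier G) (int p) (dex d)"
  unfolding addmod_def
proof (intro ballI)
  fix g h assume d: "d \<in> D" and gh: "g \<in> carrier G" "h \<in> carrier G"
  have "cm (g \<otimes> h) d = z [^] (dex d g + dex d h)"
    by (simp add: cm_mult_left[OF gh D_closed[OF d]] cm_D[OF d gh(1)] cm_D[OF d gh(2)] z_conj[OF gh(1)]
        int_pow_mult[symmetric] add.commute)
  then show "dex d (g \<otimes> h) \<doteq> dex d g + dex d h" using dex_eq d gh by simp
qed

lemma cm_D_mult: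
  assumes "d \<in> D" "e \<in> D" "g \<in> carrier G"
  shows "cm g (d \<otimes> e) = z [^] (dex d g + dex e g)"
  using assms by (simp add: cm_mult_right cm_D D_closed z_conj int_pow_mult)

lemma center_cm: "c \<in> Z \<Longrightarrow> g \<in> carrier G \<Longrightarrow> cm g c = \<one>"
  using cm_eq_one_iff center_commute center_closed by metis

lemma center_D: "c \<in> Z \<Longrightarrow> c \<in> D"
  using center_cm center_closed by (auto simp: D_def intro!: exI[of _ "0::int"])

lemma D_subgroup: "subgroup D G"
proof (rule subgroupI)
  show "D \<subseteq> carrier G" using D_closed by blast
  have "\<one> \<in> D" by (intro center_D subgroup.one_closed[OF subgroup_grp_center])
  then show "D \<noteq> {}" by blast
  show "a \<otimes> b \<in> D" if "a \<in> D" "b \<in> D" for a b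
    using that cm_D_mult D_closed unfolding D_def by blast
  show "inv a \<in> D" if a: "a \<in> D" for a
  proof -
    have "cm g (inv a) = z [^] (- dex a g)" if g: "g \<in> carrier G" for g
    proof -
      have "cm g (inv a) = inv (g \<otimes> a \<otimes> inv g) \<otimes> a"
        using g D_closed[OF a] by (simp add: cm_def inv_mult_group m_assoc)
      also have "\<dots> = inv a \<otimes> (z [^] (- dex a g) \<otimes> a)"
        using g D_closed[OF a] by (simp add: conj_D[OF a g] inv_mult_group m_assoc int_pow_neg)
      also have "\<dots> = z [^] (- dex a g)"
        using g D_closed[OF a] by (simp add: z_commute)
      finally show ?thesis .
    qed
    then show ?thesis using D_closed[OF a] unfolding D_def by blast
  qed
qed

lemma dex_addmod_left: "g \<in> carrier G \<Longrightarrow> addmod D (int p) (\<lambda>d. dex d g)"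
  unfolding addmod_def using dex_eq cm_D_mult subgroup.m_closed[OF D_subgroup] by blast

text \<open>The kernel is normal and contains all commutators, so it is nontrivial because the group
  is not abelian.\<close>

lemma hom_kernel_z:
  assumes "addmod (carrier G) (int p) f"
  shows "f z \<doteq> 0"
proof -
  define K where "K = {g \<in> carrier G. f g \<doteq> 0}"
  note hom = addmodD[OF assms] and hominv = addmod_inv[OF assms subgroup_self]
  have K: "subgroup K G"
  proof (rule subgroupI)
    have "\<one> \<in> K" using addmod_one[OF assms subgroup_self] by (simp add: K_def)
    then show "K \<noteq> {}" by blast
    show "inv a \<in> K" if "a \<in> K" for a
    proof -
      have a: "a \<in> carrier G" "f a \<doteq> 0" using that by (auto simp: K_def)
      from hominv[OF a(1)] a(2) have "f (inv a) \<doteq> 0"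
        by (rule cong_lin(2)[where u = 1 and u' = "-1"]) simp
      then show ?thesis using a(1) by (simp add: K_def)
    qed
    show "a \<otimes> b \<in> K" if "a \<in> K" "b \<in> K" for a b
    proof -
      have ab: "a \<in> carrier G" "f a \<doteq> 0" "b \<in> carrier G" "f b \<doteq> 0" using that by (auto simp: K_def)
      from hom[OF ab(1,3)] ab(2,4) have "f (a \<otimes> b) \<doteq> 0"
        by (rule cong_lin(3)[where u = 1 and u' = 1 and u'' = 1]) simp
      then show ?thesis using ab by (simp add: K_def)
    qed
  qed (simp add: K_def)
  have conj: "f (g \<otimes> h \<otimes> inv g) \<doteq> f h" if "g \<in> carrier G" "h \<in> carrier G" for g h
    using hom[OF m_closed[OF that] inv_closed[OF that(1)]] hom[OF that] hominv[OF that(1)]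
    by (rule cong_lin(3)[where u = 1 and u' = 1 and u'' = 1]) simp
  have nK: "K \<lhd> G"
    using K conj by (intro normal_invI) (auto simp: K_def intro: cong_trans)
  have cmK: "cm g h \<in> K" if "g \<in> carrier G" "h \<in> carrier G" for g h
  proof -
    have "g \<otimes> h \<otimes> inv g \<in> carrier G" using that by simp
    from hom[OF this inv_closed[OF that(2)]] conj[OF that] hominv[OF that(2)]
    have "f (cm g h) \<doteq> 0" unfolding cm_def
      by (rule cong_lin(3)[where u = 1 and u' = 1 and u'' = 1]) simp
    then show ?thesis using that by (simp add: K_def)
  qed
  have "\<exists>x. x \<in> K \<and> x \<noteq> \<one>"
  proof (rule ccontr)
    assume "\<not> ?thesis"
    then have "cm g h = \<one>" if "g \<in> carrier G" "h \<in> carrier G" for g h using cmK that by blast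
    then have "comm_group G" by (intro group_comm_groupI) (simp add: cm_eq_one_iff)
    then show False using nonabelian by blast
  qed
  then have "z \<in> K" using z_mem_normal[OF nK] by blast
  then show ?thesis by (simp add: K_def)
qed

section \<open>Every homomorphism into the integers modulo \<open>p\<close> is realized in
  \<open>D\<close>\<close>

definition zgrp where "zgrp = range (\<lambda>i::int. z [^] i)"

lemma zgrp_subgroup: "subgroup zgrp G"
proof (rule subgroupI)
  show "inv a \<in> zgrp" if "a \<in> zgrp" for a using that by (auto simp: zgrp_def int_pow_neg[symmetric])
  show "a \<otimes> b \<in> zgrp" if "a \<in> zgrp" "b \<in> zgrp" for a b
    using that by (auto simp: zgrp_def int_pow_mult[symmetric])
qed (auto simp: zgrp_def)

lemma zpow_p: "(z [^] (i::int)) [^] p = \<one>"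
  using zpow_eq_one[of "i * int p"] by (simp add: int_pow_pow int_pow_int[symmetric] cong_0_iff)

text \<open>A homomorphism into the central group generated by \<open>z\<close> is a derivation. It
  is trivial on its own values because \<open>f\<close> vanishes at \<open>z\<close>.\<close>

lemma hom_realized:
  assumes f: "addmod (carrier G) (int p) f"
  obtains d where "d \<in> D" "\<And>g. g \<in> carrier G \<Longrightarrow> dex d g \<doteq> f g"
proof -
  define \<delta> where "\<delta> g = z [^] f g" for g
  have d1: "\<delta> (z [^] (i::int)) = \<one>" for i
  proof -
    have "f (z [^] i) \<doteq> 0"
      using addmod_int_pow[OF f subgroup_self z_closed, of i] hom_kernel_z[OF f]
      by (rule cong_lin(2)[where u = 1 and u' = i]) simp
    then show ?thesis by (simp add: \<delta>_def zpow_eq_one)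
  qed
  have "\<exists>s \<in> carrier G. \<forall>g \<in> carrier G. cm g s = \<delta> g"
  proof (rule inner_of_derivation[OF zgrp_subgroup, of \<delta>])
    show "x \<otimes> y = y \<otimes> x" if "x \<in> zgrp" "y \<in> zgrp" for x y
      using that z_commute[OF subgroup.mem_carrier[OF zgrp_subgroup that(2)]] unfolding zgrp_def by blast
    show "x [^] p = \<one>" if "x \<in> zgrp" for x using that zpow_p by (auto simp: zgrp_def)
    show "\<delta> g \<in> zgrp" for g by (auto simp: \<delta>_def zgrp_def)
    show "\<delta> (g \<otimes> h) = \<delta> g \<otimes> (g \<otimes> \<delta> h \<otimes> inv g)" if "g \<in> carrier G" "h \<in> carrier G" for g h
      unfolding \<delta>_def z_conj[OF that(1)] int_pow_mult[OF z_closed, symmetric] zpow_eq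
      by (rule addmodD[OF f that])
    show "\<delta> (\<delta> (\<delta> g)) = \<one>" for g by (unfold \<delta>_def[of "\<delta> g"]) (rule d1)
  qed
  then obtain s where s: "s \<in> carrier G" "\<And>g. g \<in> carrier G \<Longrightarrow> cm g s = \<delta> g" by blast
  have sD: "s \<in> D" using s by (auto simp: D_def \<delta>_def)
  then have "dex s g \<doteq> f g" if "g \<in> carrier G" for g using dex_eq[OF sD that] s(2)[OF that] by (simp add: \<delta>_def)
  then show thesis using that sD by blast
qed

text \<open>\<open>hgt t\<close> is only meaningful if \<open>t\<^sup>p\<close> is central; it vanishes modulo \<open>p\<close> iff some central multiple of
  \<open>t\<close> has order dividing \<open>p\<close>.\<close>

definition hgt :: "'a \<Rightarrow> int" where "hgt t = (SOME i. t [^] p = \<zeta> [^] i)"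

lemma hgt_pow: "t [^] p \<in> Z \<Longrightarrow> t [^] p = \<zeta> [^] hgt t"
  unfolding hgt_def by (rule someI_ex) (use \<zeta>(2) in blast)

lemma hgt_eq: assumes "t [^] p = \<zeta> [^] (i::int)" shows "hgt t \<doteq> i"
proof -
  have "\<zeta> [^] i = \<zeta> [^] hgt t" using hgt_pow[of t] assms Z_mem by metis
  then have "int (ord \<zeta>) dvd hgt t - i" using int_pow_eq[OF \<zeta>(1)] by blast
  moreover have "int p dvd int (ord \<zeta>)" using p_dvd_ord[OF \<zeta>(1) \<zeta>_ne_one] by simp
  ultimately show ?thesis using cong_iff_dvd_diff dvd_trans by blast
qed

text \<open>The factor \<open>w\<close> of the collection formula drops out since \<open>p\<close>
  divides \<open>p choose 2\<close> for odd \<open>p\<close>.\<close>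

lemma hgt_mult:
  assumes "a \<in> carrier G" "b \<in> carrier G" "w \<in> carrier G"
    and "b \<otimes> a = w \<otimes> (a \<otimes> b)" "w \<otimes> a = a \<otimes> w" "w \<otimes> b = b \<otimes> w" "w [^] p = \<one>"
    and aZ: "a [^] p \<in> Z" and bZ: "b [^] p \<in> Z"
  shows "hgt (a \<otimes> b) \<doteq> hgt a + hgt b" "(a \<otimes> b) [^] p \<in> Z"
proof -
  have "p choose 2 = p * ((p - 1) div 2)" using p(2) by (simp add: choose_two div_mult_swap)
  then have "w [^] (p choose 2) = \<one>" using assms(3,7) by (simp add: nat_pow_pow[symmetric])
  then have *: "(a \<otimes> b) [^] p = a [^] p \<otimes> b [^] p"
    using class2_pow[OF assms(1-6), of p] assms(1,2) by simp
  then show "(a \<otimes> b) [^] p \<in> Z" using aZ bZ subgroup.m_closed[OF subgroup_grp_center] by simp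
  have "(a \<otimes> b) [^] p = \<zeta> [^] (hgt a + hgt b)"
    using * hgt_pow[OF aZ] hgt_pow[OF bZ] \<zeta>(1) by (simp add: int_pow_mult)
  then show "hgt (a \<otimes> b) \<doteq> hgt a + hgt b" by (rule hgt_eq)
qed

lemma hgt_center: assumes "c \<in> Z" shows "hgt c \<doteq> 0" "c [^] p \<in> Z"
proof -
  obtain i :: int where i: "c = \<zeta> [^] i" using assms \<zeta>(2) by blast
  have "c [^] p = \<zeta> [^] (i * int p)" using \<zeta>(1) by (simp add: i int_pow_pow[symmetric] int_pow_int)
  then have "hgt c \<doteq> i * int p" "c [^] p \<in> Z" using hgt_eq Z_mem by metis+
  moreover have "i * int p \<doteq> 0" by (simp add: cong_0_iff)
  ultimately show "hgt c \<doteq> 0" "c [^] p \<in> Z" using cong_trans by blast+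
qed

lemma hgt_zero:
  assumes t: "t \<in> carrier G" "t [^] p \<in> Z" "hgt t \<doteq> 0"
  obtains c where "c \<in> Z" "(t \<otimes> c) [^] p = \<one>"
proof -
  obtain k where k: "hgt t = int p * k" using t(3) by (auto simp: cong_0_iff)
  define c where "c = \<zeta> [^] (- k)"
  have cG: "c \<in> carrier G" using \<zeta>(1) by (simp add: c_def)
  have "(t \<otimes> c) [^] p = t [^] p \<otimes> c [^] p"
    using pow_mult_distrib[of t c p] center_commute[OF Z_mem[of "-k"], of t] t(1) cG by (simp add: c_def)
  also have "c [^] p = \<zeta> [^] (- k * int p)"
    unfolding c_def using int_pow_pow[OF \<zeta>(1), of "- k" "int p"] by (simp only: int_pow_int)
  also have "t [^] p \<otimes> \<zeta> [^] (- k * int p) = \<zeta> [^] (hgt t + - k * int p)"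
    by (simp only: hgt_pow[OF t(2)] int_pow_mult[OF \<zeta>(1)])
  also have "hgt t + - k * int p = 0" by (simp add: k)
  finally show thesis using that[of c] Z_mem by (simp add: c_def)
qed

lemma center_pow:
  assumes t: "t \<in> carrier G"
    and w: "\<And>g. g \<in> carrier G \<Longrightarrow> cm g t \<otimes> t = t \<otimes> cm g t" "\<And>g. g \<in> carrier G \<Longrightarrow> cm g t [^] p = \<one>"
  shows "t [^] p \<in> Z"
proof -
  have "t [^] p \<otimes> g = g \<otimes> t [^] p" if g: "g \<in> carrier G" for g
  proof -
    have "g \<otimes> t [^] p \<otimes> inv g = (cm g t \<otimes> t) [^] p" using conj_pow[OF g t] conj_eq_cm[OF g t] by simp
    also have "\<dots> = t [^] p" using pow_mult_distrib[OF w(1)[OF g]] w(2)[OF g] g t by simp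
    finally show ?thesis using conj_eq_iff g t by (metis nat_pow_closed)
  qed
  then show ?thesis using t by (simp add: grp_center_def)
qed

lemma D_pow: "d \<in> D \<Longrightarrow> d [^] p \<in> Z"
  using center_pow[of d] cm_D zpow_p z_commute D_closed by metis

lemma hgt_addmod_D: "addmod D (int p) hgt"
  unfolding addmod_def
proof (intro ballI)
  fix a b assume ab: "a \<in> D" "b \<in> D"
  then have "b \<otimes> a = z [^] dex a b \<otimes> (a \<otimes> b)" using cm_swap cm_D D_closed by metis
  then show "hgt (a \<otimes> b) \<doteq> hgt a + hgt b"
    using ab D_closed D_pow z_commute zpow_p by (intro hgt_mult(1)[of a b "z [^] dex a b"]) auto
qed

lemma mult_cong_zero: "a * b \<doteq> 0 \<Longrightarrow> a \<doteq> 0 \<or> b \<doteq> 0"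
  using p(1) by (simp add: cong_0_iff prime_dvd_mult_iff)

lemma pow_cong: assumes "x \<in> carrier G" "x [^] p = \<one>" "i \<doteq> j" shows "x [^] i = x [^] (j::int)"
proof -
  have "int (ord x) dvd int p" using pow_eq_id assms(1,2) by simp
  then show ?thesis using assms(3) int_pow_eq[OF assms(1)]
    by (meson cong_iff_dvd_diff cong_sym dvd_trans)
qed

lemma commute_dex: "d \<in> D \<Longrightarrow> g \<in> carrier G \<Longrightarrow> g \<otimes> d = d \<otimes> g \<longleftrightarrow> dex d g \<doteq> 0"
  using cm_eq_one_iff cm_D zpow_eq_one D_closed by metis

lemma dex_mult: "d \<in> D \<Longrightarrow> g \<in> carrier G \<Longrightarrow> h \<in> carrier G \<Longrightarrow> dex d (g \<otimes> h) \<doteq> dex d g + dex d h"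
  using addmodD[OF dex_addmod] by blast

lemma dex_pow: "d \<in> D \<Longrightarrow> g \<in> carrier G \<Longrightarrow> dex d (g [^] (i::int)) \<doteq> i * dex d g"
  using addmod_int_pow[OF dex_addmod subgroup_self] by blast

lemma dex_center: "d \<in> D \<Longrightarrow> c \<in> Z \<Longrightarrow> dex d c \<doteq> 0"
  using commute_dex[of d c] center_commute[of c d] D_closed center_closed by metis

lemma dex_cm: assumes d: "d \<in> D" and ab: "a \<in> carrier G" "b \<in> carrier G" shows "dex d (cm a b) \<doteq> 0"
proof -
  have "dex d (a \<otimes> b) \<doteq> dex d (cm a b) + dex d (b \<otimes> a)"
    using dex_mult[OF d, of "cm a b" "b \<otimes> a"] cm_swap[OF ab] ab by simp
  from this dex_mult[OF d ab] dex_mult[OF d ab(2,1)] show ?thesis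
    by (rule cong_lin(3)[where u = "-1" and u' = 1 and u'' = "-1"]) simp
qed

lemma dex_p_pow: assumes d: "d \<in> D" and g: "g \<in> carrier G" shows "dex d (g [^] p) \<doteq> 0"
proof -
  have "dex d (g [^] int p) \<doteq> int p * dex d g" by (rule dex_pow[OF d g])
  moreover have "int p * dex d g \<doteq> 0" by (simp add: cong_0_iff)
  ultimately show ?thesis unfolding int_pow_int by (rule cong_trans)
qed

lemma conj_D_pow:
  assumes "d \<in> D" "g \<in> carrier G"
  shows "g \<otimes> d [^] (i::int) \<otimes> inv g = z [^] (i * dex d g) \<otimes> d [^] i"
proof -
  have "d [^] i \<in> D" using subgroup_int_pow_closed[OF D_subgroup assms(1)] .
  moreover have "dex (d [^] i) g \<doteq> i * dex d g"
    using addmod_int_pow[OF dex_addmod_left[OF assms(2)] D_subgroup assms(1)] .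
  ultimately show ?thesis using conj_D[of "d [^] i" g] zpow_eq assms(2) by metis
qed

text \<open>This derivation is the difference operator of \<open>(dex x)\<^sup>2 / 2\<close>.\<close>

lemma square_derivation:
  assumes x: "x \<in> D" "x [^] p = \<one>"
  shows "\<exists>s \<in> carrier G. \<forall>g \<in> carrier G. cm g s = x [^] dex x g \<otimes> z [^] (half * (dex x g * dex x g))"
proof -
  have xG: "x \<in> carrier G" by (rule D_closed[OF x(1)])
  \<comment> \<open>The group generated by \<open>x\<close> and \<open>z\<close>. Here
    \<open>dex x\<close> vanishes on it, so the derivation is trivial on its own values.\<close>
  define V where "V = {x [^] i \<otimes> z [^] j | (i::int) (j::int). True}"
  define e where "e g = half * (dex x g * dex x g)" for g
  define \<delta> where "\<delta> g = x [^] dex x g \<otimes> z [^] e g" for g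
  have VI: "x [^] (i::int) \<otimes> z [^] (j::int) \<in> V" for i j by (auto simp: V_def)
  have mul: "(x [^] i \<otimes> z [^] j) \<otimes> (x [^] k \<otimes> z [^] l) = x [^] (i + k) \<otimes> z [^] (j + l)" for i j k l :: int
  proof -
    have "(x [^] i \<otimes> z [^] j) \<otimes> (x [^] k \<otimes> z [^] l) = x [^] i \<otimes> (z [^] j \<otimes> x [^] k) \<otimes> z [^] l"
      using xG by (simp add: m_assoc)
    also have "z [^] j \<otimes> x [^] k = x [^] k \<otimes> z [^] j" by (rule z_commute) (simp add: xG)
    finally show ?thesis using xG by (simp add: m_assoc int_pow_mult)
  qed
  have VG: "V \<subseteq> carrier G" using xG by (auto simp: V_def)
  have V: "subgroup V G"
  proof (rule subgroupI[OF VG])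
    show "V \<noteq> {}" using VI by blast
    show "a \<otimes> b \<in> V" if "a \<in> V" "b \<in> V" for a b
    proof -
      obtain i j k l :: int where "a = x [^] i \<otimes> z [^] j" "b = x [^] k \<otimes> z [^] l"
        using \<open>a \<in> V\<close> \<open>b \<in> V\<close> unfolding V_def by blast
      then show ?thesis using VI mul by metis
    qed
    show "inv a \<in> V" if a: "a \<in> V" for a
    proof -
      obtain i j :: int where ij: "a = x [^] i \<otimes> z [^] j" using a by (auto simp: V_def)
      have "(x [^] (- i) \<otimes> z [^] (- j)) \<otimes> a = \<one>" by (simp add: ij mul)
      then have "inv a = x [^] (- i) \<otimes> z [^] (- j)"
        using inv_equality[of "x [^] (- i) \<otimes> z [^] (- j)" a] xG ij by simp
      then show ?thesis using VI by metis
    qed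
  qed
  have dexV: "dex x v \<doteq> 0" if v: "v \<in> V" for v
  proof -
    obtain i j :: int where ij: "v = x [^] i \<otimes> z [^] j" using v by (auto simp: V_def)
    have 1: "dex x x \<doteq> 0" using commute_dex[OF x(1) xG] by simp
    from dex_mult[OF x(1) int_pow_closed[OF xG, of i] zpow_closed[of j]] dex_pow[OF x(1) xG, of i] 1
      dex_center[OF x(1) zpow_Z[of j]]
    show ?thesis unfolding ij
      by (rule cong_lin(4)[where u = 1 and u' = 1 and u'' = i and u''' = 1]) simp
  qed
  have \<delta>V: "\<delta> v = \<one>" if v: "v \<in> V" for v
  proof -
    have "x [^] dex x v = x [^] (0::int)" by (rule pow_cong[OF xG x(2) dexV[OF v]])
    moreover from dexV[OF v] have "e v \<doteq> 0" unfolding e_def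
      by (rule cong_lin(1)[where u = "half * dex x v"]) simp
    ultimately show ?thesis by (simp add: \<delta>_def zpow_eq_one)
  qed
  have "\<exists>s \<in> carrier G. \<forall>g \<in> carrier G. cm g s = \<delta> g"
  proof (rule inner_of_derivation[OF V])
    show "a \<otimes> b = b \<otimes> a" if "a \<in> V" "b \<in> V" for a b
      using that mul by (auto simp: V_def add.commute)
    show "a [^] p = \<one>" if a: "a \<in> V" for a
    proof -
      obtain i j :: int where ij: "a = x [^] i \<otimes> z [^] j" using a by (auto simp: V_def)
      have "(x [^] i) [^] p = (x [^] p) [^] i"
        using xG by (metis int_pow_int int_pow_pow mult.commute)
      then have "(x [^] i) [^] p = \<one>" using x(2) by simp
      moreover have "a [^] p = (x [^] i) [^] p \<otimes> (z [^] j) [^] p" unfolding ij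
        using xG z_commute[of "x [^] i" j] by (intro pow_mult_distrib) auto
      ultimately show ?thesis using zpow_p by simp
    qed
    show "\<delta> g \<in> V" for g using VI by (simp add: \<delta>_def)
    show "\<delta> (\<delta> (\<delta> g)) = \<one>" for g
      using \<delta>V subgroup.one_closed[OF V] VI by (metis \<delta>_def)
    show "\<delta> (g \<otimes> h) = \<delta> g \<otimes> (g \<otimes> \<delta> h \<otimes> inv g)" if gh: "g \<in> carrier G" "h \<in> carrier G" for g h
    proof -
      let ?f = "dex x"
      have "g \<otimes> \<delta> h \<otimes> inv g = (g \<otimes> x [^] ?f h \<otimes> inv g) \<otimes> (g \<otimes> z [^] e h \<otimes> inv g)"
        unfolding \<delta>_def using xG gh by (simp add: conj_mult)
      also have "\<dots> = z [^] (?f h * ?f g) \<otimes> x [^] ?f h \<otimes> z [^] e h"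
        using z_conj[OF gh(1)] conj_D_pow[OF x(1) gh(1)] by simp
      also have "z [^] (?f h * ?f g) \<otimes> x [^] ?f h = x [^] ?f h \<otimes> z [^] (?f h * ?f g)"
        using z_commute xG by simp
      also have "x [^] ?f h \<otimes> z [^] (?f h * ?f g) \<otimes> z [^] e h = x [^] ?f h \<otimes> z [^] (?f h * ?f g + e h)"
        using xG by (simp add: m_assoc int_pow_mult)
      finally have "\<delta> g \<otimes> (g \<otimes> \<delta> h \<otimes> inv g) = x [^] (?f g + ?f h) \<otimes> z [^] (e g + (?f h * ?f g + e h))"
        unfolding \<delta>_def using mul by simp
      moreover have f: "?f (g \<otimes> h) \<doteq> ?f g + ?f h" by (rule dex_mult[OF x(1) gh])
      have "x [^] ?f (g \<otimes> h) = x [^] (?f g + ?f h)" by (rule pow_cong[OF xG x(2) f])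
      moreover from f half have "e (g \<otimes> h) \<doteq> e g + (?f h * ?f g + e h)" unfolding e_def
        by (rule cong_lin(2)[where u = "half * (?f (g \<otimes> h) + ?f g + ?f h)" and u' = "?f g * ?f h"])
          (simp add: algebra_simps)
      then have "z [^] e (g \<otimes> h) = z [^] (e g + (?f h * ?f g + e h))" by (simp only: zpow_eq)
      ultimately show ?thesis by (simp add: \<delta>_def)
    qed
  qed
  then show ?thesis by (simp add: \<delta>_def e_def)
qed

text \<open>\<open>square_derivation\<close> makes \<open>x [^] dex x y\<close>, up to a power of
  \<open>z\<close>, a commutator, and \<open>dex y\<close> vanishes on commutators. So the product
  of \<open>dex x y\<close> and \<open>dex y x\<close> is zero modulo \<open>p\<close>; each factor
  vanishes exactly when \<open>x\<close> and \<open>y\<close> commute.\<close>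

lemma order_p_D_commute:
  assumes x: "x \<in> D" "x [^] p = \<one>" and y: "y \<in> D"
  shows "dex y x \<doteq> 0"
proof -
  have G: "x \<in> carrier G" "y \<in> carrier G" using x y D_closed by auto
  obtain s where s: "s \<in> carrier G" "cm y s = x [^] dex x y \<otimes> z [^] (half * (dex x y * dex x y))"
    using square_derivation[OF x] G by blast
  let ?k = "half * (dex x y * dex x y)"
  have "dex y (x [^] dex x y \<otimes> z [^] ?k) \<doteq> 0" using dex_cm[OF y G(2) s(1)] s(2) by simp
  from this dex_mult[OF y int_pow_closed[OF G(1), of "dex x y"] zpow_closed[of ?k]]
    dex_pow[OF y G(1), of "dex x y"] dex_center[OF y zpow_Z[of ?k]]
  have "dex x y * dex y x \<doteq> 0"
    by (rule cong_lin(4)[where u = 1 and u' = "-1" and u'' = "-1" and u''' = "-1"]) simp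
  then show ?thesis using mult_cong_zero commute_dex[OF x(1) G(2)] commute_dex[OF y G(1)] by metis
qed

text \<open>An element of height zero has order dividing \<open>p\<close> after multiplication by a
  central element, so \<open>order_p_D_commute\<close> applies. If the height of \<open>x\<close> is
  nonzero, a power of \<open>x\<close> brings \<open>y\<close> to height zero without changing
  whether it commutes with \<open>x\<close>.\<close>

lemma D_commute_dex: assumes x: "x \<in> D" and y: "y \<in> D" shows "dex y x \<doteq> 0"
proof -
  have red: "dex b a \<doteq> 0" if a: "a \<in> D" "hgt a \<doteq> 0" and b: "b \<in> D" for a b
  proof -
    obtain c where c: "c \<in> Z" "(a \<otimes> c) [^] p = \<one>"
      using hgt_zero[OF D_closed[OF a(1)] D_pow[OF a(1)] a(2)] by blast
    have "dex b (a \<otimes> c) \<doteq> 0"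
      using order_p_D_commute[of "a \<otimes> c" b] subgroup.m_closed[OF D_subgroup a(1) center_D[OF c(1)]] c(2) b by blast
    from this dex_mult[OF b D_closed[OF a(1)] center_closed[OF c(1)]] dex_center[OF b c(1)]
    show ?thesis by (rule cong_lin(3)[where u = 1 and u' = "-1" and u'' = "-1"]) simp
  qed
  show ?thesis
  proof (cases "hgt x \<doteq> 0")
    case True
    then show ?thesis using red x y by blast
  next
    case False
    then obtain k where k: "hgt x * k \<doteq> 1" by (rule exists_inverse)
    define m where "m = - k * hgt y"
    have xm: "x [^] m \<in> D" using subgroup_int_pow_closed[OF D_subgroup x] .
    have y'D: "y \<otimes> x [^] m \<in> D" by (intro subgroup.m_closed[OF D_subgroup] y xm)
    from addmodD[OF hgt_addmod_D y xm] addmod_int_pow[OF hgt_addmod_D D_subgroup x, of m] k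
    have "hgt (y \<otimes> x [^] m) \<doteq> 0"
      by (rule cong_lin(3)[where u = 1 and u' = 1 and u'' = "- hgt y"]) (simp add: m_def algebra_simps)
    then have 1: "dex x (y \<otimes> x [^] m) \<doteq> 0" using red y'D x by blast
    have 2: "dex x x \<doteq> 0" using commute_dex[OF x D_closed[OF x]] by simp
    from 1 dex_mult[OF x D_closed[OF y] D_closed[OF xm]] dex_pow[OF x D_closed[OF x], of m] 2
    have "dex x y \<doteq> 0"
      by (rule cong_lin(4)[where u = 1 and u' = "-1" and u'' = "-1" and u''' = "-m"]) simp
    then show ?thesis using commute_dex x y D_closed by metis
  qed
qed

lemma D_commute: "x \<in> D \<Longrightarrow> y \<in> D \<Longrightarrow> x \<otimes> y = y \<otimes> x"
  using D_commute_dex commute_dex D_closed by metis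

text \<open>By \<open>hom_realized\<close> this is the common kernel of all homomorphisms into the
  integers modulo \<open>p\<close>, that is, the Frattini subgroup.\<close>

definition \<Phi> where "\<Phi> = {u \<in> carrier G. \<forall>d \<in> D. dex d u \<doteq> 0}"

lemma \<Phi>_eq: "\<Phi> = centralizer G D"
  unfolding \<Phi>_def centralizer_def using commute_dex by blast

lemma \<Phi>_subgroup: "subgroup \<Phi> G"
  unfolding \<Phi>_eq by (rule centralizer_subgroup) (use D_closed in blast)

lemma \<Phi>_closed: "u \<in> \<Phi> \<Longrightarrow> u \<in> carrier G" by (simp add: \<Phi>_def)

lemma D_\<Phi>: "D \<subseteq> \<Phi>" using D_closed D_commute_dex by (auto simp: \<Phi>_def)

lemma cm_\<Phi>: "a \<in> carrier G \<Longrightarrow> b \<in> carrier G \<Longrightarrow> cm a b \<in> \<Phi>"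
  by (simp add: \<Phi>_def dex_cm)

lemma N_\<Phi>: "N \<subseteq> \<Phi>"
  using N_least[OF \<Phi>_subgroup] cm_\<Phi> dex_p_pow by (simp add: \<Phi>_def)

lemma N_closed: "n \<in> N \<Longrightarrow> n \<in> carrier G" using subgroup.mem_carrier[OF N_sub] .

lemma N_conj: "g \<in> carrier G \<Longrightarrow> n \<in> N \<Longrightarrow> g \<otimes> n \<otimes> inv g \<in> N"
  using normal_invE(2)[OF N] .

lemma N_cm_mem: "g \<in> carrier G \<Longrightarrow> n \<in> N \<Longrightarrow> cm g n \<in> N"
  unfolding cm_def by (intro subgroup.m_closed[OF N_sub] N_conj subgroup.m_inv_closed[OF N_sub])

text \<open>The elements \<open>u\<close> with \<open>[G,u] \<le> N\<close> form a subgroup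
  \<open>S\<close> that contains all p-th powers and commutators. A homomorphism separating
  \<open>u\<close> from \<open>S\<close> would be realized in \<open>D\<close>, but those vanish on
  \<open>\<Phi>\<close>.\<close>

lemma cm_\<Phi>_N: assumes u: "u \<in> \<Phi>" and g: "g \<in> carrier G" shows "cm g u \<in> N"
proof (rule ccontr)
  assume neg: "cm g u \<notin> N"
  define S where "S = {u \<in> carrier G. \<forall>g \<in> carrier G. cm g u \<in> N}"
  have S: "subgroup S G"
  proof (rule subgroupI)
    show "S \<subseteq> carrier G" by (auto simp: S_def)
    have "\<one> \<in> S" using subgroup.one_closed[OF N_sub] by (simp add: S_def cm_def)
    then show "S \<noteq> {}" by blast
    fix a assume a: "a \<in> S"
    show "inv a \<in> S"
    proof -
      have aG: "a \<in> carrier G" using a by (simp add: S_def)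
      have "cm h (inv a) \<in> N" if h: "h \<in> carrier G" for h
      proof -
        have "cm h (inv a) = inv a \<otimes> inv (cm h a) \<otimes> inv (inv a)"
          using aG h by (simp add: cm_def inv_mult_group m_assoc)
        then show ?thesis using a h aG N_conj[of "inv a" "inv (cm h a)"] subgroup.m_inv_closed[OF N_sub]
          by (simp add: S_def)
      qed
      then show ?thesis using aG by (simp add: S_def)
    qed
    fix b assume b: "b \<in> S"
    show "a \<otimes> b \<in> S"
      using a b N_conj subgroup.m_closed[OF N_sub] by (simp add: S_def cm_mult_right)
  qed
  have uS: "u \<notin> S" using neg g by (auto simp: S_def)
  have pS: "x [^] p \<in> S" if "x \<in> carrier G" for x
    using that N_cm_mem N_pow by (simp add: S_def)
  have cS: "cm x y \<in> S" if "x \<in> carrier G" "y \<in> carrier G" for x y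
    using that N_cm by (simp add: S_def)
  obtain f where f: "addmod (carrier G) (int p) f" "f u \<doteq> 1"
    using exists_hom_mod[OF fin p(1) S pS cS \<Phi>_closed[OF u] uS] by blast
  obtain d where d: "d \<in> D" "\<And>g. g \<in> carrier G \<Longrightarrow> dex d g \<doteq> f g"
    using hom_realized[OF f(1)] by metis
  have "dex d u \<doteq> 0" using u d(1) by (simp add: \<Phi>_def)
  from this d(2)[OF \<Phi>_closed[OF u]] f(2) have "1 \<doteq> 0"
    by (rule cong_lin(3)[where u = 1 and u' = "-1" and u'' = "-1"]) simp
  then show False using p(1) by (auto simp: cong_0_iff)
qed

section \<open>The part of \<open>D\<close> of exponent \<open>p\<close>\<close>

definition W where "W = {w \<in> D. w [^] p = \<one>}"

lemma W_D: "w \<in> W \<Longrightarrow> w \<in> D" by (simp add: W_def)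

lemma W_closed: "w \<in> W \<Longrightarrow> w \<in> carrier G" using W_D D_closed by blast

lemma W_pow_p: "w \<in> W \<Longrightarrow> w [^] p = \<one>" by (simp add: W_def)

lemma W_subgroup: "subgroup W G"
proof (rule subgroupI)
  show "W \<subseteq> carrier G" using W_closed by blast
  show "W \<noteq> {}" using subgroup.one_closed[OF D_subgroup] by (auto simp: W_def)
  show "inv a \<in> W" if "a \<in> W" for a
    using that subgroup.m_inv_closed[OF D_subgroup W_D[OF that]] W_closed[OF that]
    by (simp add: W_def nat_pow_inv)
  show "a \<otimes> b \<in> W" if "a \<in> W" "b \<in> W" for a b
    using that subgroup.m_closed[OF D_subgroup W_D W_D] W_closed D_commute[OF W_D W_D]
    by (simp add: W_def pow_mult_distrib)
qed

lemma zpow_W: "z [^] (i::int) \<in> W"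
  using center_D[OF zpow_Z] zpow_p by (simp add: W_def)

lemma hom_separating:
  assumes S: "subgroup S G" "\<And>x. x \<in> carrier G \<Longrightarrow> x [^] p \<in> S"
      "\<And>x y. x \<in> carrier G \<Longrightarrow> y \<in> carrier G \<Longrightarrow> cm x y \<in> S"
    and u: "u \<in> carrier G" "u \<notin> S"
  obtains d where "d \<in> D" "dex d u \<doteq> 1"
proof -
  obtain f where f: "addmod (carrier G) (int p) f" "f u \<doteq> 1"
    using exists_hom_mod[OF fin p(1) S u] by blast
  obtain d where "d \<in> D" "\<And>g. g \<in> carrier G \<Longrightarrow> dex d g \<doteq> f g"
    using hom_realized[OF f(1)] by metis
  then show thesis using that u(1) f(2) cong_trans by blast
qed

lemma not_one_cong: "\<not> 1 \<doteq> 0" using p(1) by (auto simp: cong_0_iff)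

lemma cm_one_center: "u \<in> carrier G \<Longrightarrow> (\<And>g. g \<in> carrier G \<Longrightarrow> cm g u = \<one>) \<Longrightarrow> u \<in> Z"
  using cm_eq_one_iff by (auto simp: grp_center_def)

lemma noncentral_exists: "\<exists>u \<in> carrier G. u \<notin> Z"
proof (rule ccontr)
  assume "\<not> ?thesis"
  then have "comm_group G" by (intro group_comm_groupI) (simp add: grp_center_def)
  then show False using nonabelian by blast
qed

text \<open>Otherwise \<open>N\<close> is trivial, so \<open>\<Phi>\<close> is central by
  \<open>cm_\<Phi>_N\<close>. Then the center contains \<open>D\<close>, all p-th powers and all
  commutators. A homomorphism nonzero at a noncentral element would be realized by a central element
  of \<open>D\<close>, whose commutators are trivial.\<close>

lemma z_N: "z \<in> N"
proof (rule ccontr)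
  assume "z \<notin> N"
  then have N1: "n = \<one>" if "n \<in> N" for n using z_mem_normal[OF N that] by blast
  have \<Phi>Z: "u \<in> Z" if "u \<in> \<Phi>" for u
    using cm_one_center[OF \<Phi>_closed[OF that]] N1 cm_\<Phi>_N[OF that] by blast
  obtain u where u: "u \<in> carrier G" "u \<notin> Z" using noncentral_exists by blast
  have "x [^] p \<in> Z" if "x \<in> carrier G" for x
    using that \<Phi>Z dex_p_pow by (simp add: \<Phi>_def)
  then obtain d where d: "d \<in> D" "dex d u \<doteq> 1"
    using hom_separating[OF subgroup_grp_center _ _ u] \<Phi>Z cm_\<Phi> by blast
  have "d \<in> Z" using \<Phi>Z D_\<Phi> d(1) by blast
  then have "dex d u \<doteq> 0" using commute_dex[OF d(1) u(1)] center_commute[OF _ u(1)] by metis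
  then show False using d(2) not_one_cong cong_trans cong_sym by blast
qed

lemma zpow_N: "z [^] (i::int) \<in> N" using subgroup_int_pow_closed[OF N_sub z_N] .

lemma W_central: assumes "w \<in> W" "w \<in> Z" obtains i :: int where "w = z [^] i"
  using order_p_center[OF assms(2) W_pow_p[OF assms(1)]] by metis

text \<open>Since \<open>D\<close> lies in \<open>\<Phi>\<close>, centralizing \<open>\<Phi>\<close>
  implies centralizing \<open>D\<close>, and the centralizer of \<open>D\<close> is
  \<open>\<Phi>\<close>.\<close>

lemma centralizer_\<Phi>:
  assumes s: "s \<in> carrier G" "\<And>u. u \<in> \<Phi> \<Longrightarrow> cm u s = \<one>"
  shows "s \<in> \<Phi>"
proof -
  have "dex d s \<doteq> 0" if d: "d \<in> D" for d
  proof -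
    have "d \<otimes> s = s \<otimes> d" using s(2)[of d] D_\<Phi> d cm_eq_one_iff[OF D_closed[OF d] s(1)] by blast
    then show ?thesis using commute_dex[OF d s(1)] by simp
  qed
  then show ?thesis using s(1) by (simp add: \<Phi>_def)
qed

text \<open>For noncentral \<open>x\<close> the element \<open>s\<close> of
  \<open>square_derivation\<close> centralizes \<open>\<Phi>\<close>, hence lies in
  \<open>\<Phi>\<close>, so \<open>[g,s] \<in> N\<close>. If \<open>x\<close> and \<open>g\<close>
  do not commute, \<open>x\<close> is recovered from \<open>[g,s]\<close> up to powers of
  \<open>z\<close>.\<close>

lemma W_N: "W \<subseteq> N"
proof
  fix x assume x: "x \<in> W"
  have xG: "x \<in> carrier G" and xD: "x \<in> D" using x W_closed W_D by auto
  show "x \<in> N"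
  proof (cases "x \<in> Z")
    case True
    then show ?thesis using W_central[OF x] zpow_N by metis
  next
    case False
    then obtain g where g: "g \<in> carrier G" "x \<otimes> g \<noteq> g \<otimes> x" using xG by (auto simp: grp_center_def)
    then have "\<not> dex x g \<doteq> 0" using commute_dex[OF xD] by metis
    then obtain k where k: "dex x g * k \<doteq> 1" by (rule exists_inverse)
    obtain s where s: "s \<in> carrier G"
      "\<And>g. g \<in> carrier G \<Longrightarrow> cm g s = x [^] dex x g \<otimes> z [^] (half * (dex x g * dex x g))"
      using square_derivation[OF xD W_pow_p[OF x]] by blast
    have "cm u s = \<one>" if u: "u \<in> \<Phi>" for u
    proof -
      have d0: "dex x u \<doteq> 0" using u xD by (simp add: \<Phi>_def)
      then have "x [^] dex x u = x [^] (0::int)" by (rule pow_cong[OF xG W_pow_p[OF x]])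
      moreover from d0 have "half * (dex x u * dex x u) \<doteq> 0"
        by (rule cong_lin(1)[where u = "half * dex x u"]) simp
      then have "z [^] (half * (dex x u * dex x u)) = \<one>" using zpow_eq_one by blast
      ultimately show ?thesis using s(2)[OF \<Phi>_closed[OF u]] by simp
    qed
    then have "s \<in> \<Phi>" by (rule centralizer_\<Phi>[OF s(1)])
    then have "cm g s \<in> N" by (rule cm_\<Phi>_N) (rule g)
    then have 1: "x [^] dex x g \<otimes> z [^] (half * (dex x g * dex x g)) \<in> N" using s(2)[OF g(1)] by simp
    define y where "y = x [^] dex x g"
    have yG: "y \<in> carrier G" using xG by (simp add: y_def)
    have "y = (y \<otimes> z [^] (half * (dex x g * dex x g))) \<otimes> inv (z [^] (half * (dex x g * dex x g)))"
      using yG by (simp add: m_assoc)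
    then have "y \<in> N"
      using subgroup.m_closed[OF N_sub 1 subgroup.m_inv_closed[OF N_sub zpow_N]] unfolding y_def by metis
    then have "y [^] k \<in> N" by (rule subgroup_int_pow_closed[OF N_sub])
    moreover have "y [^] k = x" using pow_cong[OF xG W_pow_p[OF x] k] xG by (simp add: y_def int_pow_pow)
    ultimately show ?thesis by simp
  qed
qed

text \<open>Centralizing \<open>N\<close> makes the function of \<open>t\<close> a function on
  \<open>G/N\<close>. Commutators in \<open>W\<close> make its differences linear, so it is at most
  quadratic.\<close>

definition T where "T = {t \<in> carrier G. (\<forall>n \<in> N. t \<otimes> n = n \<otimes> t) \<and> (\<forall>g \<in> carrier G. cm g t \<in> W)}"

lemma T_closed: "t \<in> T \<Longrightarrow> t \<in> carrier G" by (simp add: T_def)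

lemma T_N: "t \<in> T \<Longrightarrow> n \<in> N \<Longrightarrow> t \<otimes> n = n \<otimes> t" by (simp add: T_def)

lemma T_W: "t \<in> T \<Longrightarrow> w \<in> W \<Longrightarrow> t \<otimes> w = w \<otimes> t" using T_N W_N by blast

lemma cm_T: "t \<in> T \<Longrightarrow> g \<in> carrier G \<Longrightarrow> cm g t \<in> W" by (simp add: T_def)

lemma conj_T_W: "t \<in> T \<Longrightarrow> w \<in> W \<Longrightarrow> t \<otimes> w \<otimes> inv t = w"
  using T_W conj_eq_iff T_closed W_closed by metis

lemma cm_T_mult:
  assumes "t \<in> T" "t' \<in> T" "g \<in> carrier G"
  shows "cm g (t \<otimes> t') = cm g t \<otimes> cm g t'"
  using assms by (simp add: cm_mult_right T_closed conj_T_W cm_T)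

lemma D_T: "D \<subseteq> T"
proof
  fix d assume d: "d \<in> D"
  have "d \<otimes> n = n \<otimes> d" if "n \<in> N" for n
    using that N_\<Phi> commute_dex[OF d N_closed[OF that]] d by (auto simp: \<Phi>_def)
  then show "d \<in> T" using d cm_D[OF d] zpow_W D_closed[OF d] by (simp add: T_def)
qed

lemma T_subgroup: "subgroup T G"
proof (rule subgroupI)
  show "T \<subseteq> carrier G" using T_closed by blast
  show "T \<noteq> {}" using D_T subgroup.one_closed[OF D_subgroup] by blast
  show "a \<otimes> b \<in> T" if ab: "a \<in> T" "b \<in> T" for a b
  proof -
    have "a \<otimes> b \<otimes> n = n \<otimes> (a \<otimes> b)" if "n \<in> N" for n
      using commute_mult[OF T_closed[OF ab(1)] T_closed[OF ab(2)] N_closed[OF that]] T_N ab that by blast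
    moreover have "cm g (a \<otimes> b) \<in> W" if g: "g \<in> carrier G" for g
      unfolding cm_T_mult[OF ab g] by (intro subgroup.m_closed[OF W_subgroup] cm_T ab g)
    ultimately show ?thesis using T_closed[OF ab(1)] T_closed[OF ab(2)] unfolding T_def by blast
  qed
  show "inv a \<in> T" if a: "a \<in> T" for a
  proof -
    have aG: "a \<in> carrier G" by (rule T_closed[OF a])
    have "inv a \<otimes> n = n \<otimes> inv a" if "n \<in> N" for n
      using commute_inv[OF aG N_closed[OF that]] T_N[OF a that] by blast
    moreover have "cm g (inv a) \<in> W" if g: "g \<in> carrier G" for g
    proof -
      have iW: "inv (cm g a) \<in> W" by (intro subgroup.m_inv_closed[OF W_subgroup] cm_T a g)
      have "cm g (inv a) = inv a \<otimes> inv (cm g a) \<otimes> a"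
        using g aG by (simp add: cm_def inv_mult_group m_assoc)
      also have "\<dots> = inv (cm g a)"
      proof -
        have "inv a \<otimes> inv (cm g a) \<otimes> a = inv a \<otimes> (inv (cm g a) \<otimes> a)"
          by (rule m_assoc) (use aG W_closed[OF iW] in auto)
        then show ?thesis unfolding T_W[OF a iW, symmetric] using aG W_closed[OF iW] by simp
      qed
      finally show ?thesis using iW by simp
    qed
    ultimately show ?thesis using aG by (simp add: T_def)
  qed
qed

lemma W_T: "W \<subseteq> T" using W_D D_T by blast

lemma T_pow: assumes "t \<in> T" shows "t [^] p \<in> Z"
  using T_W[OF assms cm_T[OF assms]] W_pow_p[OF cm_T[OF assms]] by (intro center_pow T_closed assms) auto

text \<open>Commutators of elements of \<open>T\<close> lie in \<open>W\<close>, so they have order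
  dividing \<open>p\<close> and commute with \<open>T\<close>; this is the situation of
  \<open>hgt_mult\<close>.\<close>

lemma hgt_addmod_T: "addmod T (int p) hgt"
  unfolding addmod_def
proof (intro ballI)
  fix a b assume ab: "a \<in> T" "b \<in> T"
  have w: "cm b a \<in> W" by (intro cm_T T_closed ab)
  show "hgt (a \<otimes> b) \<doteq> hgt a + hgt b"
    by (rule hgt_mult(1)[OF T_closed[OF ab(1)] T_closed[OF ab(2)] W_closed[OF w] cm_swap[OF T_closed[OF ab(2)] T_closed[OF ab(1)]]
        T_W[OF ab(1) w, symmetric] T_W[OF ab(2) w, symmetric] W_pow_p[OF w] T_pow[OF ab(1)] T_pow[OF ab(2)]])
qed

subsection \<open>Realizing functions by group elements\<close>

lemma abelian_hom:
  assumes V: "subgroup V G" and comm: "\<And>x y. x \<in> V \<Longrightarrow> y \<in> V \<Longrightarrow> x \<otimes> y = y \<otimes> x"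
    and Vp: "\<And>x. x \<in> V \<Longrightarrow> x [^] p = \<one>"
    and S: "subgroup S G" "S \<subseteq> V" and u: "u \<in> V" "u \<notin> S"
  shows "\<exists>f. addmod V (int p) f \<and> (\<forall>s \<in> S. f s \<doteq> 0) \<and> f u \<doteq> 1"
proof -
  let ?V = "G\<lparr>carrier := V\<rparr>"
  interpret V: group ?V by (rule subgroup_imp_group[OF V])
  have VG: "x \<in> carrier G" if "x \<in> V" for x using subgroup.mem_carrier[OF V that] .
  have fV: "finite (carrier ?V)" using fin subgroup.subset[OF V] finite_subset by auto
  have sV: "subgroup S ?V" using subgroup_incl[OF S(1) V S(2)] .
  have 1: "x [^]\<^bsub>?V\<^esub> p \<in> S" if "x \<in> carrier ?V" for x
    using that Vp subgroup.one_closed[OF S(1)] nat_pow_consistent[of x p V] by simp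
  have 2: "V.cm x y \<in> S" if "x \<in> carrier ?V" "y \<in> carrier ?V" for x y
  proof -
    have xy: "x \<in> V" "y \<in> V" using that by auto
    have "V.cm x y = \<one>"
      using V.cm_eq_one_iff[OF that] comm[OF xy] by simp
    then show ?thesis using subgroup.one_closed[OF S(1)] by simp
  qed
  have "\<exists>f. V.addmod (carrier ?V) (int p) f \<and> (\<forall>s \<in> S. f s \<doteq> 0) \<and> f u \<doteq> 1"
    by (rule V.exists_hom_mod[OF fV p(1) sV 1 2]) (use u in auto)
  then show ?thesis by (simp add: V.addmod_def addmod_def)
qed

text \<open>A coordinate on the elementary abelian group \<open>W\<close> along \<open>z\<close>.
  The choice does not matter: by \<open>\<chi>_zero_center\<close> the function
  \<open>h \<mapsto> ev [h,t]\<close> determines \<open>t\<close> modulo the center for any such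
  coordinate.\<close>

definition ev :: "'a \<Rightarrow> int" where "ev = (SOME f. addmod W (int p) f \<and> f z \<doteq> 1)"

lemma z_W: "z \<in> W" using zpow_W[of 1] by simp

lemma z_ne_one: "z \<noteq> \<one>" using zpow_eq_one[of 1] not_one_cong by simp

lemma W_commute: "x \<in> W \<Longrightarrow> y \<in> W \<Longrightarrow> x \<otimes> y = y \<otimes> x"
  using D_commute W_D by blast

lemma ev: "addmod W (int p) ev" "ev z \<doteq> 1"
proof -
  have "\<exists>f. addmod W (int p) f \<and> (\<forall>s \<in> {\<one>}. f s \<doteq> 0) \<and> f z \<doteq> 1"
    using z_ne_one subgroup.one_closed[OF W_subgroup]
    by (intro abelian_hom[OF W_subgroup W_commute W_pow_p triv_subgroup _ z_W]) auto
  then have "\<exists>f. addmod W (int p) f \<and> f z \<doteq> 1" by blast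
  then have "addmod W (int p) ev \<and> ev z \<doteq> 1" unfolding ev_def by (rule someI_ex)
  then show "addmod W (int p) ev" "ev z \<doteq> 1" by auto
qed

lemma ev_mult: "x \<in> W \<Longrightarrow> y \<in> W \<Longrightarrow> ev (x \<otimes> y) \<doteq> ev x + ev y"
  by (rule addmodD[OF ev(1)])

lemma ev_zpow: "ev (z [^] i) \<doteq> i"
  using addmod_int_pow[OF ev(1) W_subgroup z_W, of i] ev(2)
  by (rule cong_lin(2)[where u = 1 and u' = i]) (simp add: algebra_simps)

definition \<chi> :: "'a \<Rightarrow> 'a \<Rightarrow> int" where "\<chi> t h = ev (cm h t)"

lemma \<chi>_D: "d \<in> D \<Longrightarrow> h \<in> carrier G \<Longrightarrow> \<chi> d h \<doteq> dex d h"
  using cm_D ev_zpow by (simp add: \<chi>_def)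

lemma \<chi>_mult: "t \<in> T \<Longrightarrow> t' \<in> T \<Longrightarrow> h \<in> carrier G \<Longrightarrow> \<chi> (t \<otimes> t') h \<doteq> \<chi> t h + \<chi> t' h"
  using cm_T_mult ev_mult cm_T by (simp add: \<chi>_def)

lemma \<chi>_addmod: "h \<in> carrier G \<Longrightarrow> addmod T (int p) (\<lambda>t. \<chi> t h)"
  using \<chi>_mult by (simp add: addmod_def)

lemma \<chi>_pow: "t \<in> T \<Longrightarrow> h \<in> carrier G \<Longrightarrow> \<chi> (t [^] (i::int)) h \<doteq> i * \<chi> t h"
  using addmod_int_pow[OF \<chi>_addmod T_subgroup] by blast

lemma \<chi>_one: "t \<in> T \<Longrightarrow> \<chi> t \<one> \<doteq> 0"
  using addmod_one[OF ev(1) W_subgroup] T_closed[of t] by (simp add: \<chi>_def cm_def)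

lemma \<chi>_commute: "t \<in> T \<Longrightarrow> h \<in> carrier G \<Longrightarrow> h \<otimes> t = t \<otimes> h \<Longrightarrow> \<chi> t h \<doteq> 0"
  using addmod_one[OF ev(1) W_subgroup] T_closed[of t] cm_eq_one_iff[of h t] by (simp add: \<chi>_def)

text \<open>The difference rule behind all later computations: the difference in direction
  \<open>g\<close> is the constant \<open>\<chi> t g\<close> plus the linear function of
  \<open>[g,t] \<in> W\<close>. It comes from
  \<open>[hg,t] = h[g,t]h\<^sup>-\<^sup>1 [h,t]\<close>.\<close>

lemma \<chi>_cocycle:
  assumes t: "t \<in> T" and hg: "h \<in> carrier G" "g \<in> carrier G"
  shows "\<chi> t (h \<otimes> g) \<doteq> \<chi> t g + \<chi> t h + \<chi> (cm g t) h"
proof -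
  have w: "cm g t \<in> W" by (rule cm_T[OF t hg(2)])
  have w': "cm h (cm g t) \<in> W" using cm_T W_T w hg(1) by blast
  have "cm (h \<otimes> g) t = (cm h (cm g t) \<otimes> cm g t) \<otimes> cm h t"
    using hg T_closed[OF t] W_closed[OF w] by (simp add: cm_mult_left conj_eq_cm)
  then have "\<chi> t (h \<otimes> g) \<doteq> ev (cm h (cm g t) \<otimes> cm g t) + ev (cm h t)"
    unfolding \<chi>_def using ev_mult[OF subgroup.m_closed[OF W_subgroup w' w] cm_T[OF t hg(1)]] by simp
  from this ev_mult[OF w' w] show ?thesis unfolding \<chi>_def
    by (rule cong_lin(2)[where u = 1 and u' = 1]) simp
qed

lemma \<chi>_N: "t \<in> T \<Longrightarrow> n \<in> N \<Longrightarrow> \<chi> t n \<doteq> 0"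
  using \<chi>_commute T_N N_closed by metis

lemma \<chi>_shift_N: assumes t: "t \<in> T" and h: "h \<in> carrier G" and n: "n \<in> N"
  shows "\<chi> t (h \<otimes> n) \<doteq> \<chi> t h"
proof -
  have "cm n t = \<one>" using T_N[OF t n] cm_eq_one_iff N_closed[OF n] T_closed[OF t] by metis
  then have "\<chi> (cm n t) h \<doteq> 0"
    using \<chi>_commute[OF subgroup.one_closed[OF T_subgroup] h] h by simp
  from \<chi>_cocycle[OF t h N_closed[OF n]] \<chi>_N[OF t n] this show ?thesis
    by (rule cong_lin(3)[where u = 1 and u' = 1 and u'' = 1]) simp
qed

text \<open>If the function vanishes, so do its differences, which puts \<open>[g,t]\<close> in the
  center. Being in \<open>W\<close> it is then a power of \<open>z\<close>, and its exponent is the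
  value \<open>\<chi> t g\<close>.\<close>

lemma \<chi>_zero_center:
  assumes t: "t \<in> T" and 0: "\<And>h. h \<in> carrier G \<Longrightarrow> \<chi> t h \<doteq> 0"
  shows "t \<in> Z"
proof (rule cm_one_center[OF T_closed[OF t]])
  fix g assume g: "g \<in> carrier G"
  have w: "cm g t \<in> W" by (rule cm_T[OF t g])
  have "cm g t \<in> Z"
  proof (rule cm_one_center[OF W_closed[OF w]])
    fix h assume h: "h \<in> carrier G"
    from \<chi>_cocycle[OF t h g] 0[OF m_closed[OF h g]] 0[OF h] 0[OF g]
    have "\<chi> (cm g t) h \<doteq> 0"
      by (rule cong_lin(4)[where u = "-1" and u' = 1 and u'' = "-1" and u''' = "-1"]) simp
    then have "dex (cm g t) h \<doteq> 0" using \<chi>_D[OF W_D[OF w] h] cong_trans cong_sym by blast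
    then show "cm h (cm g t) = \<one>" using cm_D[OF W_D[OF w] h] zpow_eq_one by simp
  qed
  then obtain i :: int where i: "cm g t = z [^] i" using W_central[OF w] by metis
  then have "\<chi> t g \<doteq> i" using ev_zpow by (simp add: \<chi>_def)
  then have "i \<doteq> 0" using 0[OF g] cong_trans cong_sym by blast
  then show "cm g t = \<one>" using i zpow_eq_one by simp
qed

lemma center_T: "c \<in> Z \<Longrightarrow> c \<in> T" using center_D D_T by blast

lemma \<chi>_eq_center:
  assumes t: "t \<in> T" and t': "t' \<in> T" and eq: "\<And>h. h \<in> carrier G \<Longrightarrow> \<chi> t h \<doteq> \<chi> t' h"
  obtains c where "c \<in> Z" "t = t' \<otimes> c"
proof
  have i: "inv t' \<in> T" by (rule subgroup.m_inv_closed[OF T_subgroup t'])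
  show "inv t' \<otimes> t \<in> Z"
  proof (rule \<chi>_zero_center[OF subgroup.m_closed[OF T_subgroup i t]])
    fix h assume h: "h \<in> carrier G"
    from \<chi>_mult[OF i t h] addmod_inv[OF \<chi>_addmod[OF h] T_subgroup t'] eq[OF h]
    show "\<chi> (inv t' \<otimes> t) h \<doteq> 0" by (rule cong_lin(3)[where u = 1 and u' = 1 and u'' = 1]) simp
  qed
  show "t = t' \<otimes> (inv t' \<otimes> t)" using T_closed t t' by simp
qed

lemma hgt_\<chi>:
  assumes t: "t \<in> T" and t': "t' \<in> T" and eq: "\<And>h. h \<in> carrier G \<Longrightarrow> \<chi> t h \<doteq> \<chi> t' h"
  shows "hgt t \<doteq> hgt t'"
proof -
  obtain c where c: "c \<in> Z" "t = t' \<otimes> c" using \<chi>_eq_center[OF assms] by blast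
  from addmodD[OF hgt_addmod_T t' center_T[OF c(1)]] hgt_center(1)[OF c(1)] show ?thesis
    unfolding c(2) by (rule cong_lin(2)[where u = 1 and u' = 1]) simp
qed

text \<open>The hypothesis \<open>cond\<close> makes the derivation \<open>y\<close> defined by \<open>F\<close> satisfy \<open>y (y (y g)) = \<one>\<close>, because \<open>y\<close>
  is trivial on \<open>N\<close>. Uniqueness of \<open>y g\<close> holds because a nontrivial normal subgroup contains \<open>z\<close>.\<close>

lemma realize:
  assumes V: "subgroup V G" and WV: "W \<subseteq> V" and VT: "V \<subseteq> T"
    and comm: "\<And>x y. x \<in> V \<Longrightarrow> y \<in> V \<Longrightarrow> x \<otimes> y = y \<otimes> x"
    and Vp: "\<And>x. x \<in> V \<Longrightarrow> x [^] p = \<one>"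
    and FN: "\<And>h n. h \<in> carrier G \<Longrightarrow> n \<in> N \<Longrightarrow> F (h \<otimes> n) \<doteq> F h"
    and Fx: "\<And>g. g \<in> carrier G \<Longrightarrow> \<exists>x \<in> V. \<exists>c. \<forall>h \<in> carrier G. F (h \<otimes> g) - F h \<doteq> c + \<chi> x h"
    and cond: "\<And>x y c. x \<in> V \<Longrightarrow> y \<in> V \<Longrightarrow> \<forall>h \<in> carrier G. F (h \<otimes> x) - F h \<doteq> c + \<chi> y h \<Longrightarrow> y \<in> N"
  obtains s where "s \<in> carrier G" "\<And>n. n \<in> N \<Longrightarrow> s \<otimes> n = n \<otimes> s"
    "\<And>g. g \<in> carrier G \<Longrightarrow> cm g s \<in> V"
    "\<And>g. g \<in> carrier G \<Longrightarrow> \<exists>c. \<forall>h \<in> carrier G. F (h \<otimes> g) - F h \<doteq> c + \<chi> (cm g s) h"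
    "\<And>g. g \<in> carrier G \<Longrightarrow> cm g s \<in> W \<Longrightarrow> ev (cm g s) \<doteq> F g - F \<one>"
proof -
  have VG: "x \<in> carrier G" if "x \<in> V" for x using subgroup.mem_carrier[OF V that] .
  note Vmult = subgroup.m_closed[OF V] and Vinv = subgroup.m_inv_closed[OF V]
  define S where "S = {w \<in> W. ev w \<doteq> 0}"
  have S: "subgroup S G"
  proof (rule subgroupI)
    show "S \<subseteq> carrier G" using W_closed by (auto simp: S_def)
    show "S \<noteq> {}" using subgroup.one_closed[OF W_subgroup] addmod_one[OF ev(1) W_subgroup]
      by (auto simp: S_def)
    show "inv a \<in> S" if a: "a \<in> S" for a
    proof -
      have aW: "a \<in> W" "ev a \<doteq> 0" using a by (auto simp: S_def)
      from addmod_inv[OF ev(1) W_subgroup aW(1)] aW(2) have "ev (inv a) \<doteq> 0"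
        by (rule cong_lin(2)[where u = 1 and u' = "-1"]) simp
      then show ?thesis using subgroup.m_inv_closed[OF W_subgroup aW(1)] by (simp add: S_def)
    qed
    show "a \<otimes> b \<in> S" if ab: "a \<in> S" "b \<in> S" for a b
    proof -
      have W: "a \<in> W" "ev a \<doteq> 0" "b \<in> W" "ev b \<doteq> 0" using ab by (auto simp: S_def)
      from ev_mult[OF W(1,3)] W(2,4) have "ev (a \<otimes> b) \<doteq> 0"
        by (rule cong_lin(3)[where u = 1 and u' = 1 and u'' = 1]) simp
      then show ?thesis using subgroup.m_closed[OF W_subgroup W(1,3)] by (simp add: S_def)
    qed
  qed
  have zS: "z \<notin> S" using ev(2) not_one_cong cong_trans cong_sym by (auto simp: S_def) blast
  have zV: "z [^] (i::int) \<in> V" for i using zpow_W WV by blast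
  \<comment> \<open>An extension of \<open>ev\<close> from \<open>W\<close> to \<open>V\<close>: it
    vanishes on the kernel \<open>S\<close> of \<open>ev\<close> and agrees with \<open>ev\<close>
    at \<open>z\<close>.\<close>
  obtain e where e: "addmod V (int p) e" "\<And>s. s \<in> S \<Longrightarrow> e s \<doteq> 0" "e z \<doteq> 1"
    using abelian_hom[OF V comm Vp S, of z] zS WV z_W by (auto simp: S_def)
  note em = addmodD[OF e(1)]
  have ez: "e (z [^] i) \<doteq> i" for i :: int
    using addmod_int_pow[OF e(1) V subsetD[OF WV z_W], of i] e(3)
    by (rule cong_lin(2)[where u = 1 and u' = i]) (simp add: algebra_simps)
  have eW: "e w \<doteq> ev w" if w: "w \<in> W" for w
  proof -
    let ?k = "- ev w"
    have "ev (w \<otimes> z [^] ?k) \<doteq> 0"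
      using ev_mult[OF w zpow_W[of ?k]] ev_zpow[of ?k] by (rule cong_lin(2)[where u = 1 and u' = 1]) simp
    then have "w \<otimes> z [^] ?k \<in> S" using subgroup.m_closed[OF W_subgroup w zpow_W] by (simp add: S_def)
    from e(2)[OF this] em[OF subsetD[OF WV w] zV[of ?k]] ez[of ?k] show ?thesis
      by (rule cong_lin(3)[where u = 1 and u' = "-1" and u'' = "-1"]) simp
  qed
  have cjV: "g \<otimes> x \<otimes> inv g \<in> V" if "g \<in> carrier G" "x \<in> V" for g x
    unfolding conj_eq_cm[OF that(1) VG[OF that(2)]] using cm_T VT WV that Vmult by blast
  have ecj: "e (h \<otimes> x \<otimes> inv h) \<doteq> e x + \<chi> x h" if h: "h \<in> carrier G" and x: "x \<in> V" for h x
  proof -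
    have w: "cm h x \<in> W" using cm_T VT h x by blast
    from em[OF subsetD[OF WV w] x] eW[OF w] show ?thesis
      unfolding conj_eq_cm[OF h VG[OF x]] \<chi>_def by (rule cong_lin(2)[where u = 1 and u' = 1]) simp
  qed
  \<comment> \<open>The kernel of \<open>x \<mapsto> (h \<mapsto> e(h x h\<^sup>-\<^sup>1))\<close>.
    It is normal and misses \<open>z\<close>, hence is trivial, so \<open>V\<close> embeds into the
    functions on \<open>G\<close>.\<close>
  define K where "K = {x \<in> V. \<forall>h \<in> carrier G. e (h \<otimes> x \<otimes> inv h) \<doteq> 0}"
  have cj1: "h \<otimes> \<one> \<otimes> inv h = \<one>" if "h \<in> carrier G" for h using that by simp
  have Ksub: "subgroup K G"
  proof (rule subgroupI)
    show "K \<subseteq> carrier G" using VG by (auto simp: K_def)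
    have "\<one> \<in> K" using subgroup.one_closed[OF V] addmod_one[OF e(1) V] by (auto simp: K_def cj1)
    then show "K \<noteq> {}" by blast
    show "inv a \<in> K" if a: "a \<in> K" for a
    proof -
      have aV: "a \<in> V" using a by (simp add: K_def)
      have "e (h \<otimes> inv a \<otimes> inv h) \<doteq> 0" if h: "h \<in> carrier G" for h
      proof -
        have "h \<otimes> inv a \<otimes> inv h = inv (h \<otimes> a \<otimes> inv h)"
          using h VG[OF aV] by (simp add: inv_mult_group m_assoc)
        moreover have "e (h \<otimes> a \<otimes> inv h) \<doteq> 0" using a h by (simp add: K_def)
        from addmod_inv[OF e(1) V cjV[OF h aV]] this have "e (inv (h \<otimes> a \<otimes> inv h)) \<doteq> 0"
          by (rule cong_lin(2)[where u = 1 and u' = "-1"]) simp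
        ultimately show ?thesis by simp
      qed
      then show ?thesis using Vinv[OF aV] by (simp add: K_def)
    qed
    show "a \<otimes> b \<in> K" if ab: "a \<in> K" "b \<in> K" for a b
    proof -
      have aV: "a \<in> V" "b \<in> V" using ab by (auto simp: K_def)
      have "e (h \<otimes> (a \<otimes> b) \<otimes> inv h) \<doteq> 0" if h: "h \<in> carrier G" for h
      proof -
        have "e (h \<otimes> a \<otimes> inv h) \<doteq> 0" "e (h \<otimes> b \<otimes> inv h) \<doteq> 0" using ab h by (auto simp: K_def)
        from em[OF cjV[OF h aV(1)] cjV[OF h aV(2)]] this show ?thesis
          unfolding conj_mult[OF h VG[OF aV(1)] VG[OF aV(2)]]
          by (rule cong_lin(3)[where u = 1 and u' = 1 and u'' = 1]) simp
      qed
      then show ?thesis using Vmult[OF aV] by (simp add: K_def)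
    qed
  qed
  have cjcj: "h \<otimes> (g \<otimes> x \<otimes> inv g) \<otimes> inv h = (h \<otimes> g) \<otimes> x \<otimes> inv (h \<otimes> g)"
    if "h \<in> carrier G" "g \<in> carrier G" "x \<in> carrier G" for h g x
    using that by (simp add: m_assoc inv_mult_group)
  have Knorm: "K \<lhd> G"
    using Ksub by (rule normal_invI) (use cjV cjcj VG in \<open>auto simp: K_def\<close>)
  have zK: "z \<notin> K"
  proof
    assume "z \<in> K"
    then have "e (\<one> \<otimes> z \<otimes> inv \<one>) \<doteq> 0" unfolding K_def by blast
    then have "e z \<doteq> 0" by simp
    then show False using e(3) not_one_cong cong_trans cong_sym by blast
  qed
  have K1: "x = \<one>" if "x \<in> K" for x using z_mem_normal[OF Knorm that] zK by blast
  \<comment> \<open>\<open>x\<close> accounts for the whole difference in direction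
    \<open>g\<close>, constant included; this is what makes \<open>x\<close> unique.\<close>
  define P where "P g x \<longleftrightarrow> x \<in> V \<and> (\<forall>h \<in> carrier G. F (h \<otimes> g) - F h \<doteq> e (h \<otimes> x \<otimes> inv h))" for g x
  have uniq: "x = y" if x: "P g x" and y: "P g y" for g x y
  proof -
    have V2: "x \<in> V" "y \<in> V" using x y by (auto simp: P_def)
    have iy: "inv y \<in> V" by (rule Vinv[OF V2(2)])
    have "x \<otimes> inv y \<in> K" unfolding K_def
    proof (intro CollectI conjI ballI)
      show "x \<otimes> inv y \<in> V" by (rule Vmult[OF V2(1) iy])
      fix h assume h: "h \<in> carrier G"
      have i: "h \<otimes> inv y \<otimes> inv h = inv (h \<otimes> y \<otimes> inv h)"
        using h VG[OF V2(2)] by (simp add: inv_mult_group m_assoc)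
      have "F (h \<otimes> g) - F h \<doteq> e (h \<otimes> x \<otimes> inv h)" "F (h \<otimes> g) - F h \<doteq> e (h \<otimes> y \<otimes> inv h)"
        using x y h by (auto simp: P_def)
      with em[OF cjV[OF h V2(1)] cjV[OF h iy]] addmod_inv[OF e(1) V cjV[OF h V2(2)]]
      show "e (h \<otimes> (x \<otimes> inv y) \<otimes> inv h) \<doteq> 0"
        unfolding conj_mult[OF h VG[OF V2(1)] VG[OF iy]] i
        by (rule cong_lin(4)[where u = 1 and u' = 1 and u'' = "-1" and u''' = 1]) simp
    qed
    then have "x \<otimes> inv y = \<one>" by (rule K1)
    then show ?thesis using VG V2 by (metis inv_closed inv_equality inv_inv)
  qed
  have exP: "\<exists>x. P g x" if g: "g \<in> carrier G" for g
  proof -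
    obtain x c where x: "x \<in> V" "\<And>h. h \<in> carrier G \<Longrightarrow> F (h \<otimes> g) - F h \<doteq> c + \<chi> x h"
      using Fx[OF g] by blast
    \<comment> \<open>A power of \<open>z\<close> shifts the function of an element by a constant.
      The function of \<open>x\<close> is \<open>e x + \<chi> x h\<close>, so this exponent turns
      its constant into \<open>c\<close>.\<close>
    let ?k = "c - e x"
    have xk: "x \<otimes> z [^] ?k \<in> V" by (rule Vmult[OF x(1) zV])
    have "P g (x \<otimes> z [^] ?k)" unfolding P_def
    proof (intro conjI ballI xk)
      fix h assume h: "h \<in> carrier G"
      have "h \<otimes> (x \<otimes> z [^] ?k) \<otimes> inv h = (h \<otimes> x \<otimes> inv h) \<otimes> z [^] ?k"
        unfolding conj_mult[OF h VG[OF x(1)] zpow_closed] by (simp only: z_conj[OF h])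
      with em[OF cjV[OF h x(1)] zV[of ?k]]
      have "e (h \<otimes> (x \<otimes> z [^] ?k) \<otimes> inv h) \<doteq> e (h \<otimes> x \<otimes> inv h) + e (z [^] ?k)" by simp
      from x(2)[OF h] this ez[of ?k] ecj[OF h x(1)]
      show "F (h \<otimes> g) - F h \<doteq> e (h \<otimes> (x \<otimes> z [^] ?k) \<otimes> inv h)"
        by (rule cong_lin(4)[where u = 1 and u' = "-1" and u'' = "-1" and u''' = "-1"]) simp
    qed
    then show ?thesis by blast
  qed
  define y where "y g = (SOME x. P g x)" for g
  have y: "P g (y g)" if "g \<in> carrier G" for g unfolding y_def by (rule someI_ex[OF exP[OF that]])
  have yV: "y g \<in> V" if "g \<in> carrier G" for g using y[OF that] by (simp add: P_def)
  have yF: "F (h \<otimes> g) - F h \<doteq> e (h \<otimes> y g \<otimes> inv h)" if "g \<in> carrier G" "h \<in> carrier G" for g h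
    using y[OF that(1)] that(2) by (simp add: P_def)
  have yN: "y n = \<one>" if n: "n \<in> N" for n
  proof (rule uniq[OF y[OF N_closed[OF n]]])
    show "P n \<one>" unfolding P_def
    proof (intro conjI ballI subgroup.one_closed[OF V])
      fix h assume h: "h \<in> carrier G"
      from FN[OF h n] addmod_one[OF e(1) V] show "F (h \<otimes> n) - F h \<doteq> e (h \<otimes> \<one> \<otimes> inv h)"
        unfolding cj1[OF h] by (rule cong_lin(2)[where u = 1 and u' = "-1"]) simp
    qed
  qed
  have yc: "F (h \<otimes> g) - F h \<doteq> e (y g) + \<chi> (y g) h" if "g \<in> carrier G" "h \<in> carrier G" for g h
    using yF[OF that] ecj[OF that(2) yV[OF that(1)]] cong_trans by blast
  have "\<exists>s \<in> carrier G. \<forall>g \<in> carrier G. cm g s = y g"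
  proof (rule inner_of_derivation[OF V comm Vp yV])
    show "y (g \<otimes> h) = y g \<otimes> (g \<otimes> y h \<otimes> inv g)" if gh: "g \<in> carrier G" "h \<in> carrier G" for g h
    proof (rule uniq[OF y[OF m_closed[OF gh]]])
      note V1 = yV[OF gh(1)] and V2 = cjV[OF gh(1) yV[OF gh(2)]]
      show "P (g \<otimes> h) (y g \<otimes> (g \<otimes> y h \<otimes> inv g))" unfolding P_def
      proof (intro conjI ballI Vmult[OF V1 V2])
        fix k assume k: "k \<in> carrier G"
        have eq: "k \<otimes> (y g \<otimes> (g \<otimes> y h \<otimes> inv g)) \<otimes> inv k
            = (k \<otimes> y g \<otimes> inv k) \<otimes> ((k \<otimes> g) \<otimes> y h \<otimes> inv (k \<otimes> g))"
          unfolding conj_mult[OF k VG[OF V1] VG[OF V2]] cjcj[OF k gh(1) VG[OF yV[OF gh(2)]]] ..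
        have kgh: "k \<otimes> (g \<otimes> h) = k \<otimes> g \<otimes> h" using k gh by (simp add: m_assoc)
        \<comment> \<open>The difference telescopes through \<open>k \<otimes> g\<close>; by
          uniqueness this becomes the derivation rule for \<open>y\<close>.\<close>
        from yF[OF gh(1) k] yF[OF gh(2) m_closed[OF k gh(1)]]
          em[OF cjV[OF k V1] cjV[OF m_closed[OF k gh(1)] yV[OF gh(2)]]]
        show "F (k \<otimes> (g \<otimes> h)) - F k \<doteq> e (k \<otimes> (y g \<otimes> (g \<otimes> y h \<otimes> inv g)) \<otimes> inv k)"
          unfolding eq kgh by (rule cong_lin(3)[where u = 1 and u' = 1 and u'' = "-1"]) simp
      qed
    qed
    show "y (y (y g)) = \<one>" if g: "g \<in> carrier G" for g
    proof (rule yN)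
      have G: "y g \<in> carrier G" using VG yV[OF g] by blast
      show "y (y g) \<in> N"
        by (rule cond[OF yV[OF g] yV[OF G], of "e (y (y g))"]) (use yc[OF G] in blast)
    qed
  qed
  then obtain s where s: "s \<in> carrier G" "\<And>g. g \<in> carrier G \<Longrightarrow> cm g s = y g" by blast
  show thesis
  proof (rule that[OF s(1)])
    show "s \<otimes> n = n \<otimes> s" if n: "n \<in> N" for n
      using s(2)[OF N_closed[OF n]] yN[OF n] cm_eq_one_iff[OF N_closed[OF n] s(1)] by metis
    show "cm g s \<in> V" if "g \<in> carrier G" for g using s(2) yV that by simp
    show "\<exists>c. \<forall>h \<in> carrier G. F (h \<otimes> g) - F h \<doteq> c + \<chi> (cm g s) h" if "g \<in> carrier G" for g
      using s(2)[OF that] yc[OF that] by auto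
    show "ev (cm g s) \<doteq> F g - F \<one>" if g: "g \<in> carrier G" and w: "cm g s \<in> W" for g
    proof -
      have "F (\<one> \<otimes> g) - F \<one> \<doteq> e (\<one> \<otimes> y g \<otimes> inv \<one>)" by (rule yF[OF g one_closed])
      then have "F g - F \<one> \<doteq> e (cm g s)" using g s(2)[OF g] VG[OF yV[OF g]] by simp
      then show ?thesis using eW[OF w] cong_trans cong_sym by blast
    qed
  qed
qed

section \<open>Baer functions and the centralizer of \<open>T\<close>\<close>

lemma baer_function:
  assumes u: "u \<in> carrier G" "u \<notin> N"
  shows "\<exists>F. (\<forall>g \<in> carrier G. \<forall>h \<in> carrier G. F (g \<otimes> h) \<doteq> F g + F h + half * F (cm g h))
    \<and> (\<forall>n \<in> N. F n \<doteq> 0) \<and> F u \<doteq> 1"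
proof -
  interpret N: normal N G by (rule N)
  interpret Q: group "G Mod N" by (rule N.factorgroup_is_group)
  define q where "q = (\<lambda>x. N #> x)"
  have qhom: "q \<in> hom G (G Mod N)" unfolding q_def by (rule N.r_coset_hom_Mod)
  interpret q: group_hom G "G Mod N" q
    by (intro group_hom.intro group_hom_axioms.intro qhom is_group N.factorgroup_is_group)
  have Qone: "\<one>\<^bsub>G Mod N\<^esub> = N" by (simp add: FactGroup_def)
  have qone: "q x = \<one>\<^bsub>G Mod N\<^esub> \<longleftrightarrow> x \<in> N" if "x \<in> carrier G" for x
    unfolding Qone q_def using coset_join1[OF _ that N_sub] coset_join2[OF that N_sub] by blast
  have qsurj: "\<exists>g \<in> carrier G. x = q g" if "x \<in> carrier (G Mod N)" for x
    using that by (auto simp: FactGroup_def RCOSETS_def q_def)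
  have qcm: "q (cm a b) = Q.cm (q a) (q b)" if "a \<in> carrier G" "b \<in> carrier G" for a b
    using that by (simp add: cm_def Q.cm_def)
  obtain r :: nat where r: "2 * r = p + 1" using p(2) by (metis even_plus_one_iff evenE)
  have "\<exists>F. (\<forall>x \<in> carrier (G Mod N). \<forall>y \<in> carrier (G Mod N).
      [F (x \<otimes>\<^bsub>G Mod N\<^esub> y) = F x + F y + int r * F (Q.cm x y)] (mod int p))
      \<and> [F \<one>\<^bsub>G Mod N\<^esub> = 0] (mod int p) \<and> [F (q u) = 1] (mod int p)"
  proof (rule Q.baer_hom[OF _ p(1) r])
    show "finite (carrier (G Mod N))" using fin unfolding FactGroup_def RCOSETS_def by simp
    show "x [^]\<^bsub>G Mod N\<^esub> p = \<one>\<^bsub>G Mod N\<^esub>" if x: "x \<in> carrier (G Mod N)" for x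
    proof -
      obtain g where g: "g \<in> carrier G" "x = q g" using qsurj[OF x] by blast
      then show ?thesis using qone[of "g [^] p"] N_pow[OF g(1)] q.hom_nat_pow[OF g(1), of p] g
        by (metis nat_pow_closed)
    qed
    show "Q.cm x y \<otimes>\<^bsub>G Mod N\<^esub> g = g \<otimes>\<^bsub>G Mod N\<^esub> Q.cm x y"
      if xyg: "x \<in> carrier (G Mod N)" "y \<in> carrier (G Mod N)" "g \<in> carrier (G Mod N)" for x y g
    proof -
      obtain a b c where abc: "a \<in> carrier G" "x = q a" "b \<in> carrier G" "y = q b" "c \<in> carrier G" "g = q c"
        using qsurj[OF xyg(1)] qsurj[OF xyg(2)] qsurj[OF xyg(3)] by metis
      have "q (cm c (cm a b)) = \<one>\<^bsub>G Mod N\<^esub>" using qone N_cm abc by simp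
      then have "Q.cm g (Q.cm x y) = \<one>\<^bsub>G Mod N\<^esub>" using abc qcm by simp
      then show ?thesis using Q.cm_eq_one_iff[OF xyg(3) Q.cm_closed[OF xyg(1,2)]] by simp
    qed
    show "q u \<in> carrier (G Mod N)" using u by simp
    show "q u \<noteq> \<one>\<^bsub>G Mod N\<^esub>" using qone u by blast
  qed
  then obtain F where F: "\<And>x y. x \<in> carrier (G Mod N) \<Longrightarrow> y \<in> carrier (G Mod N) \<Longrightarrow>
      F (x \<otimes>\<^bsub>G Mod N\<^esub> y) \<doteq> F x + F y + int r * F (Q.cm x y)"
      "F (q u) \<doteq> 1" "F \<one>\<^bsub>G Mod N\<^esub> \<doteq> 0" by blast
  have rh: "int r = half" using r by (simp add: half_def)
  have 1: "F (q (g \<otimes> h)) \<doteq> F (q g) + F (q h) + half * F (q (cm g h))"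
    if "g \<in> carrier G" "h \<in> carrier G" for g h
    using F(1)[of "q g" "q h"] that qcm rh by simp
  have 2: "F (q n) \<doteq> 0" if "n \<in> N" for n
    using qone[OF N_closed[OF that]] that F(3) by simp
  show ?thesis using 1 2 F(2) by (intro exI[of _ "\<lambda>g. F (q g)"]) blast
qed

text \<open>The case \<open>V = W\<close> of \<open>realize\<close>, where the condition on second
  values is automatic because \<open>W\<close> lies in \<open>N\<close>.\<close>

lemma realize_W:
  assumes FN: "\<And>h n. h \<in> carrier G \<Longrightarrow> n \<in> N \<Longrightarrow> F (h \<otimes> n) \<doteq> F h"
    and Fx: "\<And>g. g \<in> carrier G \<Longrightarrow> \<exists>x \<in> W. \<exists>c. \<forall>h \<in> carrier G. F (h \<otimes> g) - F h \<doteq> c + \<chi> x h"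
  shows "\<exists>s \<in> T. \<forall>g \<in> carrier G. \<chi> s g \<doteq> F g - F \<one>"
proof -
  obtain s where s: "s \<in> carrier G" "\<And>n. n \<in> N \<Longrightarrow> s \<otimes> n = n \<otimes> s"
    "\<And>g. g \<in> carrier G \<Longrightarrow> cm g s \<in> W"
    "\<And>g. g \<in> carrier G \<Longrightarrow> \<exists>c. \<forall>h \<in> carrier G. F (h \<otimes> g) - F h \<doteq> c + \<chi> (cm g s) h"
    "\<And>g. g \<in> carrier G \<Longrightarrow> cm g s \<in> W \<Longrightarrow> ev (cm g s) \<doteq> F g - F \<one>"
    by (rule realize[OF W_subgroup subset_refl W_T W_commute W_pow_p FN Fx]) (use W_N in blast)+
  show ?thesis
  proof (intro bexI ballI)
    show "s \<in> T" using s(1,2,3) by (simp add: T_def)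
    show "\<chi> s g \<doteq> F g - F \<one>" if "g \<in> carrier G" for g
      using s(5)[OF that s(3)[OF that]] by (simp add: \<chi>_def)
  qed
qed

lemma \<chi>_\<Phi>: assumes d: "d \<in> D" and u: "u \<in> \<Phi>" shows "\<chi> d u \<doteq> 0"
proof (rule cong_trans[OF \<chi>_D[OF d \<Phi>_closed[OF u]]])
  show "dex d u \<doteq> 0" using d u unfolding \<Phi>_def by blast
qed

lemma \<chi>_D_add:
  assumes d: "d \<in> D" and gh: "g \<in> carrier G" "h \<in> carrier G"
  shows "\<chi> d (g \<otimes> h) \<doteq> \<chi> d g + \<chi> d h"
  using \<chi>_D[OF d m_closed[OF gh]] dex_mult[OF d gh] \<chi>_D[OF d gh(1)] \<chi>_D[OF d gh(2)]
  by (rule cong_lin(4)[where u = 1 and u' = 1 and u'' = "-1" and u''' = "-1"]) simp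

lemma \<chi>_D_addmod: "d \<in> D \<Longrightarrow> addmod (carrier G) (int p) (\<chi> d)"
  by (simp add: addmod_def \<chi>_D_add)

lemma hom_\<chi>:
  assumes "addmod (carrier G) (int p) f"
  shows "\<exists>d \<in> D. \<forall>g \<in> carrier G. \<chi> d g \<doteq> f g"
  using hom_realized[OF assms] \<chi>_D cong_trans by metis

lemma hgt_T_mult: "a \<in> T \<Longrightarrow> b \<in> T \<Longrightarrow> hgt (a \<otimes> b) \<doteq> hgt a + hgt b"
  by (rule addmodD[OF hgt_addmod_T])

lemma hgt_T_pow: "a \<in> T \<Longrightarrow> hgt (a [^] (i::int)) \<doteq> i * hgt a"
  by (rule addmod_int_pow[OF hgt_addmod_T T_subgroup])

lemma hgt_zero_W:
  assumes d: "d \<in> D" "hgt d \<doteq> 0"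
  obtains w where "w \<in> W" "\<And>h. h \<in> carrier G \<Longrightarrow> \<chi> w h \<doteq> \<chi> d h"
proof -
  obtain c where c: "c \<in> Z" "(d \<otimes> c) [^] p = \<one>"
    using hgt_zero[OF D_closed[OF d(1)] D_pow[OF d(1)] d(2)] by blast
  have "d \<otimes> c \<in> W"
    using subgroup.m_closed[OF D_subgroup d(1) center_D[OF c(1)]] c(2) by (simp add: W_def)
  moreover have "\<chi> (d \<otimes> c) h \<doteq> \<chi> d h" if h: "h \<in> carrier G" for h
  proof -
    have "\<chi> c h \<doteq> 0" using \<chi>_commute[OF center_T[OF c(1)] h] center_commute[OF c(1) h] by simp
    from \<chi>_mult[OF subsetD[OF D_T d(1)] center_T[OF c(1)] h] this show ?thesis
      by (rule cong_lin(2)[where u = 1 and u' = 1]) simp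
  qed
  ultimately show thesis by (rule that)
qed

lemma normalized_height:
  assumes x: "x \<in> D" "\<not> hgt x \<doteq> 0"
  obtains x' where "x' \<in> D" "hgt x' \<doteq> 1"
proof -
  obtain k where k: "hgt x * k \<doteq> 1" using exists_inverse[OF x(2)] by blast
  from hgt_T_pow[OF subsetD[OF D_T x(1)], of k] k have "hgt (x [^] k) \<doteq> 1"
    by (rule cong_lin(2)[where u = 1 and u' = 1]) (simp add: algebra_simps)
  then show thesis using that subgroup_int_pow_closed[OF D_subgroup x(1)] by blast
qed

text \<open>The function \<open>Q\<close> is the product of the homomorphisms of \<open>x\<close> and \<open>r'\<close>, where \<open>x\<close> has height 1.\<close>

lemma hgt_correction:
  assumes \<rho>: "addmod (carrier G) (int p) \<rho>"
    and alt: "(\<forall>g \<in> carrier G. \<rho> g \<doteq> 0) \<or> (\<exists>x \<in> D. \<not> hgt x \<doteq> 0)"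
  shows "\<exists>Q. (\<forall>h \<in> carrier G. \<forall>u \<in> \<Phi>. Q (h \<otimes> u) \<doteq> Q h) \<and> (\<forall>u \<in> \<Phi>. Q u \<doteq> 0) \<and>
    (\<forall>g \<in> carrier G. \<exists>e \<in> D. hgt e \<doteq> \<rho> g \<and> (\<exists>c. \<forall>h \<in> carrier G. Q (h \<otimes> g) - Q h \<doteq> c + \<chi> e h))"
proof (cases "\<exists>x \<in> D. \<not> hgt x \<doteq> 0")
  case False
  then have "\<rho> g \<doteq> 0" if "g \<in> carrier G" for g using alt that by blast
  then have *: "hgt \<one> \<doteq> \<rho> g" if "g \<in> carrier G" for g
    using that addmod_one[OF hgt_addmod_T T_subgroup] cong_trans cong_sym by blast
  have "\<chi> \<one> h \<doteq> 0" if "h \<in> carrier G" for h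
    using \<chi>_commute[OF subgroup.one_closed[OF T_subgroup] that] that by simp
  then have "\<forall>h \<in> carrier G. (0::int) - 0 \<doteq> 0 + \<chi> \<one> h" using cong_sym by (simp add: cong_sym_eq)
  then show ?thesis using * subgroup.one_closed[OF D_subgroup]
    by (intro exI[of _ "\<lambda>_. 0"]) (metis cong_refl)
next
  case True
  then obtain x where x: "x \<in> D" "hgt x \<doteq> 1" using normalized_height by metis
  obtain r where r: "r \<in> D" "\<And>g. g \<in> carrier G \<Longrightarrow> \<chi> r g \<doteq> \<rho> g" using hom_\<chi>[OF \<rho>] by blast
  \<comment> \<open>The difference of \<open>Q\<close> in direction \<open>g\<close> is realized by
    \<open>r' [^] \<chi> x g\<close> times \<open>x [^] \<chi> r' g\<close>. Its height is
    \<open>\<rho> g + \<chi> x g * (hgt r + 2 * e)\<close>, so \<open>2 * e\<close> must cancel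
    \<open>hgt r\<close>.\<close>
  define e where "e = - half * hgt r"
  define r' where "r' = r \<otimes> x [^] e"
  have xe: "x [^] e \<in> D" by (rule subgroup_int_pow_closed[OF D_subgroup x(1)])
  have r'D: "r' \<in> D" unfolding r'_def by (rule subgroup.m_closed[OF D_subgroup r(1) xe])
  note T = D_T[THEN subsetD]
  define Q where "Q h = \<chi> x h * \<chi> r' h" for h
  have hr': "hgt r' \<doteq> hgt r + e"
    unfolding r'_def using hgt_T_mult[OF T[OF r(1)] T[OF xe]] hgt_T_pow[OF T[OF x(1)], of e] x(2)
    by (rule cong_lin(3)[where u = 1 and u' = 1 and u'' = e]) (simp add: algebra_simps)
  show ?thesis
  proof (intro exI[of _ Q] conjI ballI)
    fix h u assume h: "h \<in> carrier G" and u: "u \<in> \<Phi>"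
    have 1: "\<chi> d (h \<otimes> u) \<doteq> \<chi> d h" if d: "d \<in> D" for d
      using \<chi>_D_add[OF d h \<Phi>_closed[OF u]] \<chi>_\<Phi>[OF d u] by (rule cong_lin(2)[where u = 1 and u' = 1]) simp
    show "Q (h \<otimes> u) \<doteq> Q h" unfolding Q_def by (intro cong_mult 1 x(1) r'D)
  next
    fix u assume u: "u \<in> \<Phi>"
    from \<chi>_\<Phi>[OF x(1) u] show "Q u \<doteq> 0" unfolding Q_def by (rule cong_lin(1)[where u = "\<chi> r' u"]) simp
  next
    fix g assume g: "g \<in> carrier G"
    define y where "y = r' [^] \<chi> x g \<otimes> x [^] \<chi> r' g"
    have yD: "r' [^] \<chi> x g \<in> D" "x [^] \<chi> r' g \<in> D"
      using subgroup_int_pow_closed[OF D_subgroup] r'D x(1) by auto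
    from hgt_T_mult[OF T[OF yD(1)] T[OF yD(2)]] hgt_T_pow[OF T[OF r'D], of "\<chi> x g"]
      hgt_T_pow[OF T[OF x(1)], of "\<chi> r' g"] hr'
    have 1: "hgt y \<doteq> \<chi> x g * (hgt r + e) + \<chi> r' g * hgt x"
      unfolding y_def by (rule cong_lin(4)[where u = 1 and u' = 1 and u'' = 1 and u''' = "\<chi> x g"])
        (simp add: algebra_simps)
    from \<chi>_mult[OF T[OF r(1)] T[OF xe] g] \<chi>_pow[OF T[OF x(1)] g, of e] r(2)[OF g]
    have 2: "\<chi> r' g \<doteq> \<rho> g + e * \<chi> x g"
      unfolding r'_def by (rule cong_lin(3)[where u = 1 and u' = 1 and u'' = 1]) simp
    from 1 2 x(2) half have hy: "hgt y \<doteq> \<rho> g"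
      by (rule cong_lin(4)[where u = 1 and u' = 1 and u'' = "\<chi> r' g" and u''' = "- \<chi> x g * hgt r"])
        (simp add: e_def algebra_simps)
    have "Q (h \<otimes> g) - Q h \<doteq> \<chi> x g * \<chi> r' g + \<chi> y h" if h: "h \<in> carrier G" for h
    proof -
      have 3: "Q (h \<otimes> g) \<doteq> (\<chi> x h + \<chi> x g) * (\<chi> r' h + \<chi> r' g)"
        unfolding Q_def by (intro cong_mult \<chi>_D_add x(1) r'D h g)
      from 3 \<chi>_mult[OF T[OF yD(1)] T[OF yD(2)] h] \<chi>_pow[OF T[OF r'D] h, of "\<chi> x g"]
        \<chi>_pow[OF T[OF x(1)] h, of "\<chi> r' g"]
      show ?thesis unfolding Q_def y_def
        by (rule cong_lin(4)[where u = 1 and u' = "-1" and u'' = "-1" and u''' = "-1"])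
          (simp add: algebra_simps)
    qed
    then show "\<exists>e \<in> D. hgt e \<doteq> \<rho> g \<and> (\<exists>c. \<forall>h \<in> carrier G. Q (h \<otimes> g) - Q h \<doteq> c + \<chi> e h)"
      using hy subgroup.m_closed[OF D_subgroup yD] unfolding y_def[symmetric] by blast
  qed
qed

text \<open>The Baer function with value 1 at \<open>u\<close> has differences
  \<open>F g + half * F [h,g]\<close>, linear in \<open>h\<close> and hence realized by some
  \<open>d g \<in> D\<close>. The height of \<open>d g\<close> is additive in \<open>g\<close> but
  may be nonzero; the function \<open>Q\<close> of \<open>hgt_correction\<close> brings the
  realizing elements into \<open>W\<close>.\<close>

lemma separating_T:
  assumes u: "u \<in> \<Phi>" "u \<notin> N"
  obtains t where "t \<in> T" "u \<otimes> t \<noteq> t \<otimes> u"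
proof -
  obtain F where F: "\<And>g h. g \<in> carrier G \<Longrightarrow> h \<in> carrier G \<Longrightarrow> F (g \<otimes> h) \<doteq> F g + F h + half * F (cm g h)"
      "\<And>n. n \<in> N \<Longrightarrow> F n \<doteq> 0" "F u \<doteq> 1"
    using baer_function[OF \<Phi>_closed[OF u(1)] u(2)] by blast
  have FN: "F (h \<otimes> n) \<doteq> F h" if "h \<in> carrier G" "n \<in> N" for h n
    using F(1)[OF that(1) N_closed[OF that(2)]] F(2)[OF that(2)] F(2)[OF N_cm_mem[OF that]]
    by (rule cong_lin(3)[where u = 1 and u' = 1 and u'' = half]) (simp add: algebra_simps)
  have FN': "F (n \<otimes> h) \<doteq> F h" if "h \<in> carrier G" "n \<in> N" for h n
  proof -
    have "cm n h \<in> N" using subgroup.m_inv_closed[OF N_sub N_cm_mem[OF that]] that N_closed by (simp add: cm_inv)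
    from F(1)[OF N_closed[OF that(2)] that(1)] F(2)[OF that(2)] F(2)[OF this] show ?thesis
      by (rule cong_lin(3)[where u = 1 and u' = 1 and u'' = half]) (simp add: algebra_simps)
  qed
  have Fcm: "F (cm a b \<otimes> y) \<doteq> F (cm a b) + F y" if "a \<in> carrier G" "b \<in> carrier G" "y \<in> carrier G" for a b y
  proof -
    have "cm (cm a b) y \<in> N"
      using subgroup.m_inv_closed[OF N_sub N_cm[OF that(3,1,2)]] that by (simp add: cm_inv)
    from F(1)[OF cm_closed[OF that(1,2)] that(3)] F(2)[OF this] show ?thesis
      by (rule cong_lin(2)[where u = 1 and u' = half]) (simp add: algebra_simps)
  qed
  have cmc: "F (g \<otimes> cm a b \<otimes> inv g) \<doteq> F (cm a b)" if "a \<in> carrier G" "b \<in> carrier G" "g \<in> carrier G" for a b g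
    using FN'[OF cm_closed[OF that(1,2)] N_cm[OF that(3,1,2)]] that by (simp add: conj_eq_cm)
  have addl: "F (cm (h \<otimes> h') g) \<doteq> F (cm h g) + F (cm h' g)"
    if "h \<in> carrier G" "h' \<in> carrier G" "g \<in> carrier G" for h h' g
  proof -
    have "h \<otimes> cm h' g \<otimes> inv h \<otimes> cm h g = cm h (cm h' g) \<otimes> (cm h' g \<otimes> cm h g)"
      unfolding conj_eq_cm[OF that(1) cm_closed[OF that(2,3)]] using that by (simp add: m_assoc)
    then have "F (cm (h \<otimes> h') g) \<doteq> F (cm h' g \<otimes> cm h g)"
      using FN'[OF m_closed[OF cm_closed[OF that(2,3)] cm_closed[OF that(1,3)]] N_cm[OF that]] that
      by (simp add: cm_mult_left)
    from this Fcm[OF that(2,3) cm_closed[OF that(1,3)]] show ?thesis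
      by (rule cong_lin(2)[where u = 1 and u' = 1]) simp
  qed
  have addr: "F (cm h (g \<otimes> g')) \<doteq> F (cm h g) + F (cm h g')"
    if "h \<in> carrier G" "g \<in> carrier G" "g' \<in> carrier G" for h g g'
  proof -
    have "g \<otimes> cm h g' \<otimes> inv g \<in> carrier G" using that by simp
    from Fcm[OF that(1,2) this] cmc[OF that(1,3,2)] show ?thesis
      unfolding cm_mult_right[OF that] by (rule cong_lin(2)[where u = 1 and u' = 1]) simp
  qed
  have "\<exists>d \<in> D. \<forall>h \<in> carrier G. \<chi> d h \<doteq> half * F (cm h g)" if g: "g \<in> carrier G" for g
    using addl g by (intro hom_\<chi> addmod_scale) (simp add: addmod_def)
  then obtain d where d: "\<And>g. g \<in> carrier G \<Longrightarrow> d g \<in> D"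
      "\<And>g h. g \<in> carrier G \<Longrightarrow> h \<in> carrier G \<Longrightarrow> \<chi> (d g) h \<doteq> half * F (cm h g)" by metis
  note T = D_T[THEN subsetD]
  have \<rho>: "addmod (carrier G) (int p) (\<lambda>g. hgt (d g))"
    unfolding addmod_def
  proof (intro ballI)
    fix g g' assume gg: "g \<in> carrier G" "g' \<in> carrier G"
    have "hgt (d (g \<otimes> g')) \<doteq> hgt (d g \<otimes> d g')"
    proof (rule hgt_\<chi>)
      show "d (g \<otimes> g') \<in> T" "d g \<otimes> d g' \<in> T"
        using gg d(1) T subgroup.m_closed[OF T_subgroup] by auto
      fix h assume h: "h \<in> carrier G"
      from d(2)[OF m_closed[OF gg] h] addr[OF h gg] d(2)[OF gg(1) h] d(2)[OF gg(2) h]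
      have "\<chi> (d (g \<otimes> g')) h \<doteq> \<chi> (d g) h + \<chi> (d g') h"
        by (rule cong_lin(4)[where u = 1 and u' = half and u'' = "-1" and u''' = "-1"]) (simp add: algebra_simps)
      then show "\<chi> (d (g \<otimes> g')) h \<doteq> \<chi> (d g \<otimes> d g') h"
        using \<chi>_mult[OF T[OF d(1)[OF gg(1)]] T[OF d(1)[OF gg(2)]] h] cong_trans cong_sym by blast
    qed
    then show "hgt (d (g \<otimes> g')) \<doteq> hgt (d g) + hgt (d g')"
      using hgt_T_mult[OF T[OF d(1)[OF gg(1)]] T[OF d(1)[OF gg(2)]]] cong_trans by blast
  qed
  have "\<exists>Q. (\<forall>h \<in> carrier G. \<forall>u \<in> \<Phi>. Q (h \<otimes> u) \<doteq> Q h) \<and> (\<forall>u \<in> \<Phi>. Q u \<doteq> 0) \<and>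
    (\<forall>g \<in> carrier G. \<exists>e \<in> D. hgt e \<doteq> -1 * hgt (d g) \<and> (\<exists>c. \<forall>h \<in> carrier G. Q (h \<otimes> g) - Q h \<doteq> c + \<chi> e h))"
  proof (rule hgt_correction[OF addmod_scale[OF \<rho>]])
    show "(\<forall>g \<in> carrier G. -1 * hgt (d g) \<doteq> 0) \<or> (\<exists>x \<in> D. \<not> hgt x \<doteq> 0)"
      using d(1) by (auto simp: cong_0_iff)
  qed
  then obtain Q where Q: "\<And>h u. h \<in> carrier G \<Longrightarrow> u \<in> \<Phi> \<Longrightarrow> Q (h \<otimes> u) \<doteq> Q h"
      "\<And>u. u \<in> \<Phi> \<Longrightarrow> Q u \<doteq> 0"
      "\<And>g. g \<in> carrier G \<Longrightarrow> \<exists>e \<in> D. hgt e \<doteq> -1 * hgt (d g) \<and> (\<exists>c. \<forall>h \<in> carrier G. Q (h \<otimes> g) - Q h \<doteq> c + \<chi> e h)"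
    by blast
  define E where "E h = F h + Q h" for h
  have "\<exists>s \<in> T. \<forall>g \<in> carrier G. \<chi> s g \<doteq> E g - E \<one>"
  proof (rule realize_W)
    fix h n assume h: "h \<in> carrier G" and n: "n \<in> N"
    show "E (h \<otimes> n) \<doteq> E h" unfolding E_def using FN[OF h n] Q(1)[OF h] N_\<Phi> n by (intro cong_add) auto
  next
    fix g assume g: "g \<in> carrier G"
    obtain e c where e: "e \<in> D" "hgt e \<doteq> -1 * hgt (d g)"
        "\<And>h. h \<in> carrier G \<Longrightarrow> Q (h \<otimes> g) - Q h \<doteq> c + \<chi> e h" using Q(3)[OF g] by blast
    have de: "d g \<otimes> e \<in> D" by (rule subgroup.m_closed[OF D_subgroup d(1)[OF g] e(1)])
    have "hgt (d g \<otimes> e) \<doteq> 0"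
      using hgt_T_mult[OF T[OF d(1)[OF g]] T[OF e(1)]] e(2) by (rule cong_lin(2)[where u = 1 and u' = 1]) simp
    then obtain w where w: "w \<in> W" "\<And>h. h \<in> carrier G \<Longrightarrow> \<chi> w h \<doteq> \<chi> (d g \<otimes> e) h"
      using hgt_zero_W[OF de] by blast
    have "E (h \<otimes> g) - E h \<doteq> (F g + c) + \<chi> w h" if h: "h \<in> carrier G" for h
    proof -
      from F(1)[OF h g] d(2)[OF g h] have 1: "F (h \<otimes> g) - F h \<doteq> F g + \<chi> (d g) h"
        by (rule cong_lin(2)[where u = 1 and u' = "-1"]) simp
      from 1 e(3)[OF h] w(2)[OF h] \<chi>_mult[OF T[OF d(1)[OF g]] T[OF e(1)] h] show ?thesis unfolding E_def
        by (rule cong_lin(4)[where u = 1 and u' = 1 and u'' = "-1" and u''' = "-1"]) simp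
    qed
    then show "\<exists>x \<in> W. \<exists>c. \<forall>h \<in> carrier G. E (h \<otimes> g) - E h \<doteq> c + \<chi> x h" using w(1) by blast
  qed
  then obtain s where s: "s \<in> T" "\<And>g. g \<in> carrier G \<Longrightarrow> \<chi> s g \<doteq> E g - E \<one>" by blast
  have uG: "u \<in> carrier G" by (rule \<Phi>_closed[OF u(1)])
  have one\<Phi>: "\<one> \<in> \<Phi>" by (rule subgroup.one_closed[OF \<Phi>_subgroup])
  have E1: "E \<one> \<doteq> 0" unfolding E_def
    using F(2)[OF subgroup.one_closed[OF N_sub]] Q(2)[OF one\<Phi>] by (rule cong_lin(2)[where u = 1 and u' = 1]) simp
  \<comment> \<open>The correction \<open>Q\<close> vanishes on \<open>\<Phi>\<close>, so the value
    1 at \<open>u\<close> survives.\<close>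
  from s(2)[OF uG] E1 F(3) Q(2)[OF u(1)] have "\<chi> s u \<doteq> 1" unfolding E_def
    by (rule cong_lin(4)[where u = 1 and u' = "-1" and u'' = 1 and u''' = 1]) simp
  then have "\<not> \<chi> s u \<doteq> 0" using not_one_cong cong_trans cong_sym by blast
  then have "u \<otimes> s \<noteq> s \<otimes> u" using \<chi>_commute[OF s(1) uG] by blast
  then show thesis using that s(1) by blast
qed

text \<open>As \<open>D \<le> T\<close>, such a \<open>u\<close> lies in \<open>\<Phi>\<close>,
  where \<open>separating_T\<close> detects elements outside \<open>N\<close>.\<close>

lemma centralizer_T:
  assumes u: "u \<in> carrier G" "\<And>t. t \<in> T \<Longrightarrow> u \<otimes> t = t \<otimes> u"
  shows "u \<in> N"
proof (rule ccontr)
  assume "u \<notin> N"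
  moreover have "u \<in> \<Phi>" using u D_T commute_dex[OF _ u(1)] by (auto simp: \<Phi>_def)
  ultimately show False using separating_T u(2) by metis
qed

lemma Z_N: "Z \<subseteq> N"
  using centralizer_T center_closed center_commute T_closed by (metis subsetI)

text \<open>The hypothesis on \<open>C(Z(N))\<close> enters here: if \<open>T \<le> N\<close>, then
  \<open>T \<le> Z(N)\<close>, and so \<open>C(Z(N)) \<le> C(T) \<le> N\<close>.\<close>

lemma T_not_N: "\<not> T \<subseteq> N"
proof
  assume TN: "T \<subseteq> N"
  have "centralizer G (subgroup_center G N) \<subseteq> N"
  proof
    fix u assume u: "u \<in> centralizer G (subgroup_center G N)"
    have "t \<in> subgroup_center G N" if "t \<in> T" for t
      using that TN T_N unfolding subgroup_center_def by blast
    then show "u \<in> N" using u by (intro centralizer_T) (auto simp: centralizer_def)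
  qed
  then show False using N_centralizer by blast
qed

text \<open>In direction \<open>g\<close> the product has the difference \<open>\<chi> a g\<close>
  times the function of \<open>w\<close> plus \<open>\<chi> w g\<close> times that of
  \<open>a\<close>, up to a constant. This is realized by an element of \<open>W\<close>.\<close>

lemma product_element:
  assumes a: "a \<in> W" and w: "w \<in> W"
  shows "\<exists>s \<in> T \<inter> N. \<forall>h \<in> carrier G. \<chi> s h \<doteq> \<chi> a h * \<chi> w h"
proof -
  note D = W_D[OF a] W_D[OF w]
  note T = D_T[THEN subsetD]
  define F where "F h = \<chi> a h * \<chi> w h" for h
  have "\<exists>s \<in> T. \<forall>g \<in> carrier G. \<chi> s g \<doteq> F g - F \<one>"
  proof (rule realize_W)
    fix h n assume h: "h \<in> carrier G" and n: "n \<in> N"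
    show "F (h \<otimes> n) \<doteq> F h" unfolding F_def by (intro cong_mult \<chi>_shift_N T D h n)
  next
    fix g assume g: "g \<in> carrier G"
    let ?y = "w [^] \<chi> a g \<otimes> a [^] \<chi> w g"
    have y: "w [^] \<chi> a g \<in> W" "a [^] \<chi> w g \<in> W" using subgroup_int_pow_closed[OF W_subgroup] a w by auto
    have "F (h \<otimes> g) - F h \<doteq> \<chi> a g * \<chi> w g + \<chi> ?y h" if h: "h \<in> carrier G" for h
    proof -
      have 3: "F (h \<otimes> g) \<doteq> (\<chi> a h + \<chi> a g) * (\<chi> w h + \<chi> w g)"
        unfolding F_def by (intro cong_mult \<chi>_D_add D h g)
      from 3 \<chi>_mult[OF subsetD[OF W_T y(1)] subsetD[OF W_T y(2)] h] \<chi>_pow[OF T[OF D(2)] h, of "\<chi> a g"]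
        \<chi>_pow[OF T[OF D(1)] h, of "\<chi> w g"]
      show ?thesis unfolding F_def
        by (rule cong_lin(4)[where u = 1 and u' = "-1" and u'' = "-1" and u''' = "-1"])
          (simp add: algebra_simps)
    qed
    then show "\<exists>x \<in> W. \<exists>c. \<forall>h \<in> carrier G. F (h \<otimes> g) - F h \<doteq> c + \<chi> x h"
      using subgroup.m_closed[OF W_subgroup y] by blast
  qed
  then obtain s where s: "s \<in> T" "\<And>g. g \<in> carrier G \<Longrightarrow> \<chi> s g \<doteq> F g - F \<one>" by blast
  from \<chi>_one[OF T[OF D(1)]] have F1: "F \<one> \<doteq> 0"
    unfolding F_def by (rule cong_lin(1)[where u = "\<chi> w \<one>"]) simp
  have \<chi>s: "\<chi> s h \<doteq> \<chi> a h * \<chi> w h" if h: "h \<in> carrier G" for h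
    using s(2)[OF h] F1 unfolding F_def by (rule cong_lin(2)[where u = 1 and u' = "-1"]) simp
  \<comment> \<open>It suffices that \<open>s\<close> commutes with every \<open>t \<in> T\<close>.
    The linear functions of \<open>a\<close> and \<open>w\<close> vanish at \<open>t\<close>, so
    translation by \<open>t\<close> leaves the function of \<open>s\<close> unchanged. Hence
    \<open>[t,s]\<close> is central, thus a power of \<open>z\<close>, with exponent
    \<open>\<chi> s t\<close>, which is zero.\<close>
  have "s \<in> N"
  proof (rule centralizer_T[OF T_closed[OF s(1)]])
    fix t assume t: "t \<in> T"
    have tG: "t \<in> carrier G" by (rule T_closed[OF t])
    have t0: "\<chi> x t \<doteq> 0" if "x \<in> W" for x
      using \<chi>_commute[OF subsetD[OF W_T that] tG] T_W[OF t that] by blast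
    from \<chi>s[OF tG] t0[OF a] have st: "\<chi> s t \<doteq> 0"
      by (rule cong_lin(2)[where u = 1 and u' = "\<chi> w t"]) simp
    have c: "cm t s \<in> W" by (rule cm_T[OF s(1) tG])
    have "cm t s \<in> Z"
    proof (rule \<chi>_zero_center[OF subsetD[OF W_T c]])
      fix h assume h: "h \<in> carrier G"
      have 1: "\<chi> s (h \<otimes> t) \<doteq> \<chi> s h"
      proof -
        have eq: "\<chi> x (h \<otimes> t) \<doteq> \<chi> x h" if "x \<in> W" for x
          using \<chi>_D_add[OF W_D[OF that] h tG] t0[OF that] by (rule cong_lin(2)[where u = 1 and u' = 1]) simp
        have "\<chi> a (h \<otimes> t) * \<chi> w (h \<otimes> t) \<doteq> \<chi> a h * \<chi> w h" by (intro cong_mult eq a w)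
        then show ?thesis using \<chi>s[OF m_closed[OF h tG]] \<chi>s[OF h] cong_trans cong_sym by meson
      qed
      from \<chi>_cocycle[OF s(1) h tG] 1 st show "\<chi> (cm t s) h \<doteq> 0"
        by (rule cong_lin(3)[where u = "-1" and u' = 1 and u'' = "-1"]) simp
    qed
    then obtain i :: int where i: "cm t s = z [^] i" using W_central[OF c] by metis
    have "i \<doteq> 0" using st ev_zpow[of i] cong_trans cong_sym unfolding \<chi>_def i by blast
    then have "cm t s = \<one>" using i zpow_eq_one by simp
    then show "s \<otimes> t = t \<otimes> s" using cm_eq_one_iff[OF tG T_closed[OF s(1)]] by simp
  qed
  then show ?thesis using s(1) \<chi>s by blast
qed

subsection \<open>The cubic function\<close>

definition product_elt where "product_elt a w = (SOME s. s \<in> T \<inter> N \<and> (\<forall>h \<in> carrier G. \<chi> s h \<doteq> \<chi> a h * \<chi> w h))"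

text \<open>A symmetric bilinear form on \<open>W\<close> modulo \<open>p\<close>, measuring whether products of two homomorphisms are realized
  by elements of order \<open>p\<close>.\<close>

definition \<beta> :: "'a \<Rightarrow> 'a \<Rightarrow> int" where "\<beta> a w = hgt (product_elt a w)"

lemma product_elt:
  assumes "a \<in> W" "w \<in> W"
  shows "product_elt a w \<in> T" "product_elt a w \<in> N" "\<And>h. h \<in> carrier G \<Longrightarrow> \<chi> (product_elt a w) h \<doteq> \<chi> a h * \<chi> w h"
proof -
  have "\<exists>s. s \<in> T \<inter> N \<and> (\<forall>h \<in> carrier G. \<chi> s h \<doteq> \<chi> a h * \<chi> w h)" using product_element[OF assms] by blast
  then have "product_elt a w \<in> T \<inter> N \<and> (\<forall>h \<in> carrier G. \<chi> (product_elt a w) h \<doteq> \<chi> a h * \<chi> w h)"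
    unfolding product_elt_def by (rule someI_ex)
  then show "product_elt a w \<in> T" "product_elt a w \<in> N" "\<And>h. h \<in> carrier G \<Longrightarrow> \<chi> (product_elt a w) h \<doteq> \<chi> a h * \<chi> w h" by auto
qed

lemma W_in_T: "w \<in> W \<Longrightarrow> w \<in> T" using W_T by blast

lemma hgt_W: "w \<in> W \<Longrightarrow> hgt w \<doteq> 0"
  using hgt_eq[of w 0] W_pow_p[of w] by simp

lemma \<beta>_eq:
  assumes "a \<in> W" "w \<in> W" "t \<in> T" "\<And>h. h \<in> carrier G \<Longrightarrow> \<chi> t h \<doteq> \<chi> a h * \<chi> w h"
  shows "hgt t \<doteq> \<beta> a w"
  unfolding \<beta>_def
proof (rule hgt_\<chi>[OF assms(3) product_elt(1)[OF assms(1,2)]])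
  fix h assume h: "h \<in> carrier G"
  from assms(4)[OF h] product_elt(3)[OF assms(1,2) h] show "\<chi> t h \<doteq> \<chi> (product_elt a w) h"
    by (rule cong_lin(2)[where u = 1 and u' = "-1"]) simp
qed

lemma \<beta>_cong:
  assumes a: "a \<in> W" and w: "w \<in> W" "w' \<in> W" and eq: "\<And>h. h \<in> carrier G \<Longrightarrow> \<chi> w h \<doteq> \<chi> w' h"
  shows "\<beta> a w \<doteq> \<beta> a w'"
  unfolding \<beta>_def[of a w]
proof (rule \<beta>_eq[OF a w(2) product_elt(1)[OF a w(1)]])
  fix h assume h: "h \<in> carrier G"
  from product_elt(3)[OF a w(1) h] eq[OF h] show "\<chi> (product_elt a w) h \<doteq> \<chi> a h * \<chi> w' h"
    by (rule cong_lin(2)[where u = 1 and u' = "\<chi> a h"]) (simp add: algebra_simps)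
qed

lemma \<beta>_addmod: assumes a: "a \<in> W" shows "addmod W (int p) (\<beta> a)"
  unfolding addmod_def
proof (intro ballI)
  fix x y assume xy: "x \<in> W" "y \<in> W"
  note t = product_elt(1)[OF a xy(1)] product_elt(1)[OF a xy(2)]
  have "hgt (product_elt a x \<otimes> product_elt a y) \<doteq> \<beta> a (x \<otimes> y)"
  proof (rule \<beta>_eq[OF a subgroup.m_closed[OF W_subgroup xy] subgroup.m_closed[OF T_subgroup t]])
    fix h assume h: "h \<in> carrier G"
    from \<chi>_mult[OF t h] product_elt(3)[OF a xy(1) h] product_elt(3)[OF a xy(2) h] \<chi>_mult[OF W_in_T[OF xy(1)] W_in_T[OF xy(2)] h]
    show "\<chi> (product_elt a x \<otimes> product_elt a y) h \<doteq> \<chi> a h * \<chi> (x \<otimes> y) h"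
      by (rule cong_lin(4)[where u = 1 and u' = 1 and u'' = 1 and u''' = "- \<chi> a h"]) (simp add: algebra_simps)
  qed
  from this hgt_T_mult[OF t] show "\<beta> a (x \<otimes> y) \<doteq> \<beta> a x + \<beta> a y" unfolding \<beta>_def
    by (rule cong_lin(2)[where u = "-1" and u' = 1]) simp
qed

lemma \<beta>_mult: "a \<in> W \<Longrightarrow> x \<in> W \<Longrightarrow> y \<in> W \<Longrightarrow> \<beta> a (x \<otimes> y) \<doteq> \<beta> a x + \<beta> a y"
  by (rule addmodD[OF \<beta>_addmod])

lemma \<beta>_pow: "a \<in> W \<Longrightarrow> x \<in> W \<Longrightarrow> \<beta> a (x [^] (i::int)) \<doteq> i * \<beta> a x"
  by (rule addmod_int_pow[OF \<beta>_addmod W_subgroup])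

lemma \<chi>_W_T: "a \<in> W \<Longrightarrow> t \<in> T \<Longrightarrow> \<chi> a t \<doteq> 0"
  using \<chi>_commute[OF W_in_T T_closed] T_W by blast

lemma noncentral_\<chi>:
  assumes a: "a \<in> W" "a \<notin> Z"
  obtains g where "g \<in> carrier G" "\<chi> a g \<doteq> 1"
proof -
  obtain g where g: "g \<in> carrier G" "\<not> \<chi> a g \<doteq> 0" using \<chi>_zero_center[OF W_in_T[OF a(1)]] a(2) by blast
  obtain k where k: "\<chi> a g * k \<doteq> 1" using exists_inverse[OF g(2)] by blast
  have "\<chi> a (g [^] k) \<doteq> k * \<chi> a g"
    by (rule addmod_int_pow[OF \<chi>_D_addmod[OF W_D[OF a(1)]] subgroup_self g(1)])
  from this k have "\<chi> a (g [^] k) \<doteq> 1" by (rule cong_lin(2)[where u = 1 and u' = 1]) (simp add: algebra_simps)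
  then show thesis using that[of "g [^] k"] g(1) by simp
qed

text \<open>The product of the functions of \<open>a\<close> and \<open>t\<close> is realized by some \<open>s\<close> centralizing \<open>N\<close>, with \<open>[g,s] \<in> tN\<close>
  for some \<open>g\<close>. If \<open>D \<subseteq> N\<close> then \<open>s \<in> \<Phi>\<close> and \<open>[g,s] \<in> N\<close>; otherwise \<open>[g,s] \<in> \<Phi>\<close> contradicts \<open>t \<notin> \<Phi>\<close>.\<close>

lemma cubic_obstruction_order_p:
  assumes t: "t \<in> T" "t \<notin> N" "t [^] p = \<one>"
    and alt: "D \<subseteq> N \<or> t \<notin> \<Phi>"
    and a: "a \<in> W" "a \<notin> Z"
    and \<beta>0: "\<And>g. g \<in> carrier G \<Longrightarrow> \<beta> a (cm g t) \<doteq> 0"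
  shows False
proof -
  have tG: "t \<in> carrier G" by (rule T_closed[OF t(1)])
  have tp: "t [^] (i::int) \<in> T" for i by (rule subgroup_int_pow_closed[OF T_subgroup t(1)])
  have tpG: "t [^] (i::int) \<in> carrier G" for i using tG by simp
  \<comment> \<open>The elements of \<open>T\<close> of order dividing \<open>p\<close> that lie in
    a coset of \<open>N\<close> by a power of \<open>t\<close>. They commute because
    \<open>T\<close> centralizes \<open>N\<close>.\<close>
  define V where "V = {x \<in> T. x [^] p = \<one> \<and> (\<exists>i::int. x \<otimes> t [^] i \<in> N)}"
  have VT: "V \<subseteq> T" by (auto simp: V_def)
  have VG: "x \<in> carrier G" if "x \<in> V" for x using that T_closed by (simp add: V_def)
  have Vt: "x \<otimes> t [^] (j::int) = t [^] j \<otimes> x" if x: "x \<in> V" for x j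
  proof -
    obtain i :: int where i: "x \<otimes> t [^] i \<in> N" using x by (auto simp: V_def)
    have xG: "x \<in> carrier G" by (rule VG[OF x])
    have tt: "t [^] i \<otimes> t [^] j = t [^] j \<otimes> t [^] i"
      using tG by (simp add: int_pow_mult[symmetric] add.commute)
    have "t [^] j \<otimes> (x \<otimes> t [^] i) = x \<otimes> t [^] i \<otimes> t [^] j" by (rule T_N[OF tp i])
    then have "(t [^] j \<otimes> x) \<otimes> t [^] i = (x \<otimes> t [^] j) \<otimes> t [^] i"
      using xG tpG tt by (simp add: m_assoc)
    then show ?thesis using right_cancel xG tpG by (metis m_closed)
  qed
  have Vcomm: "x \<otimes> y = y \<otimes> x" if x: "x \<in> V" and y: "y \<in> V" for x y
  proof -
    obtain i :: int where i: "x \<otimes> t [^] i \<in> N" using x by (auto simp: V_def)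
    have G: "x \<in> carrier G" "y \<in> carrier G" using VG x y by auto
    have "y \<otimes> (x \<otimes> t [^] i) = x \<otimes> t [^] i \<otimes> y" using T_N i VT y by blast
    also have "\<dots> = x \<otimes> (y \<otimes> t [^] i)" unfolding Vt[OF y] using G tpG by (simp add: m_assoc)
    finally have "(y \<otimes> x) \<otimes> t [^] i = (x \<otimes> y) \<otimes> t [^] i" using G tpG by (simp add: m_assoc)
    then show ?thesis using right_cancel G tpG by (metis m_closed)
  qed
  have V: "subgroup V G"
  proof (rule subgroupI)
    show "V \<subseteq> carrier G" using VG by blast
    have "\<one> \<otimes> t [^] (0::int) \<in> N" using subgroup.one_closed[OF N_sub] by simp
    then have "\<one> \<in> V" using subgroup.one_closed[OF T_subgroup] unfolding V_def by (auto intro: exI[of _ "0::int"])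
    then show "V \<noteq> {}" by blast
    show "inv x \<in> V" if x: "x \<in> V" for x
    proof -
      obtain i :: int where i: "x \<otimes> t [^] i \<in> N" using x by (auto simp: V_def)
      have "inv x \<otimes> t [^] (- i) = inv (x \<otimes> t [^] i)"
        unfolding Vt[OF x] using VG[OF x] tG by (simp add: inv_mult_group int_pow_neg)
      then have "inv x \<otimes> t [^] (- i) \<in> N" using subgroup.m_inv_closed[OF N_sub i] by simp
      moreover have "inv x [^] p = \<one>" using x VG[OF x] by (simp add: V_def nat_pow_inv)
      moreover have "inv x \<in> T" using subgroup.m_inv_closed[OF T_subgroup] VT x by blast
      ultimately show ?thesis unfolding V_def by blast
    qed
    show "x \<otimes> y \<in> V" if xy: "x \<in> V" "y \<in> V" for x y
    proof -
      obtain i j :: int where ij: "x \<otimes> t [^] i \<in> N" "y \<otimes> t [^] j \<in> N" using xy by (auto simp: V_def)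
      have G: "x \<in> carrier G" "y \<in> carrier G" using VG xy by auto
      have "(x \<otimes> t [^] i) \<otimes> (y \<otimes> t [^] j) = x \<otimes> (t [^] i \<otimes> y) \<otimes> t [^] j" using G tpG by (simp add: m_assoc)
      also have "\<dots> = (x \<otimes> y) \<otimes> t [^] (i + j)" unfolding Vt[OF xy(2), symmetric]
        using G tG by (simp add: m_assoc int_pow_mult)
      finally have "(x \<otimes> y) \<otimes> t [^] (i + j) \<in> N" using subgroup.m_closed[OF N_sub ij] by simp
      moreover have "(x \<otimes> y) [^] p = \<one>"
        using pow_mult_distrib[OF Vcomm[OF xy] G, of p] xy by (simp add: V_def)
      moreover have "x \<otimes> y \<in> T" using subgroup.m_closed[OF T_subgroup] VT xy by blast
      ultimately show ?thesis unfolding V_def by blast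
    qed
  qed
  have WV: "W \<subseteq> V"
  proof
    fix w assume w: "w \<in> W"
    have "w \<otimes> t [^] (0::int) \<in> N" using W_N w W_closed[OF w] by auto
    then show "w \<in> V" unfolding V_def using W_in_T[OF w] W_pow_p[OF w] by blast
  qed
  define F where "F h = \<chi> a h * \<chi> t h" for h
  note aT = W_in_T[OF a(1)] and aD = W_D[OF a(1)]
  have key: "\<exists>n \<in> T \<inter> N. hgt n \<doteq> 0 \<and>
      (\<forall>h \<in> carrier G. F (h \<otimes> g) - F h \<doteq> \<chi> a g * \<chi> t g + \<chi> (n \<otimes> t [^] \<chi> a g) h)"
    if g: "g \<in> carrier G" for g
  proof -
    define w where "w = cm g t"
    have w: "w \<in> W" unfolding w_def by (rule cm_T[OF t(1) g])
    define x where "x = a [^] \<chi> t g"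
    define y where "y = w [^] \<chi> a g"
    have xW: "x \<in> W" and yW: "y \<in> W" unfolding x_def y_def
      using subgroup_int_pow_closed[OF W_subgroup] a(1) w by auto
    note s = product_elt[OF a(1) w]
    have xT: "x \<in> T" and yT: "y \<in> T" and xN: "x \<in> N" and yN: "y \<in> N"
      using W_in_T xW yW W_N by auto
    have xs: "x \<otimes> product_elt a w \<in> T" by (rule subgroup.m_closed[OF T_subgroup xT s(1)])
    \<comment> \<open>With \<open>w = [g,t]\<close>, the difference of \<open>F\<close> expands to a
      constant plus \<open>\<chi> t g * \<chi> a h\<close>, \<open>\<chi> a h * \<chi> w h\<close>,
      \<open>\<chi> a g * \<chi> w h\<close> and \<open>\<chi> a g * \<chi> t h\<close>. The first
      three terms come from the factors of \<open>n\<close>, the last from a power of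
      \<open>t\<close>. Only the product term can have nonzero height, and \<open>\<beta>0\<close>
      excludes this.\<close>
    define n where "n = x \<otimes> product_elt a w \<otimes> y"
    have nT: "n \<in> T" unfolding n_def by (rule subgroup.m_closed[OF T_subgroup xs yT])
    have nN: "n \<in> N" unfolding n_def by (intro subgroup.m_closed[OF N_sub] xN yN s(2))
    have "hgt (product_elt a w) \<doteq> 0" using \<beta>0[OF g] unfolding \<beta>_def w_def .
    from hgt_T_mult[OF xT s(1)] this hgt_W[OF xW] have 1: "hgt (x \<otimes> product_elt a w) \<doteq> 0"
      by (rule cong_lin(3)[where u = 1 and u' = 1 and u'' = 1]) simp
    from hgt_T_mult[OF xs yT] 1 hgt_W[OF yW] have hn: "hgt n \<doteq> 0" unfolding n_def
      by (rule cong_lin(3)[where u = 1 and u' = 1 and u'' = 1]) simp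
    have "F (h \<otimes> g) - F h \<doteq> \<chi> a g * \<chi> t g + \<chi> (n \<otimes> t [^] \<chi> a g) h" if h: "h \<in> carrier G" for h
    proof -
      from \<chi>_mult[OF xs yT h] \<chi>_mult[OF xT s(1) h] have 1: "\<chi> n h \<doteq> \<chi> x h + \<chi> (product_elt a w) h + \<chi> y h"
        unfolding n_def by (rule cong_lin(2)[where u = 1 and u' = 1]) simp
      from 1 \<chi>_pow[OF aT h, of "\<chi> t g"] s(3)[OF h] \<chi>_pow[OF W_in_T[OF w] h, of "\<chi> a g"]
      have 2: "\<chi> n h \<doteq> \<chi> t g * \<chi> a h + \<chi> a h * \<chi> w h + \<chi> a g * \<chi> w h" unfolding x_def y_def
        by (rule cong_lin(4)[where u = 1 and u' = 1 and u'' = 1 and u''' = 1]) simp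
      from \<chi>_mult[OF nT tp[of "\<chi> a g"] h] 2 \<chi>_pow[OF t(1) h, of "\<chi> a g"]
      have 3: "\<chi> (n \<otimes> t [^] \<chi> a g) h \<doteq> \<chi> t g * \<chi> a h + \<chi> a h * \<chi> w h + \<chi> a g * \<chi> w h + \<chi> a g * \<chi> t h"
        by (rule cong_lin(3)[where u = 1 and u' = 1 and u'' = 1]) simp
      have 4: "F (h \<otimes> g) \<doteq> (\<chi> a h + \<chi> a g) * (\<chi> t g + \<chi> t h + \<chi> w h)"
        unfolding F_def w_def by (intro cong_mult \<chi>_D_add aD h g \<chi>_cocycle t(1))
      from 4 3 show ?thesis unfolding F_def
        by (rule cong_lin(2)[where u = 1 and u' = "-1"]) (simp add: algebra_simps)
    qed
    then show ?thesis using nT nN hn by blast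
  qed
  have shift: "\<exists>c' \<in> Z. y = x \<otimes> c'"
    if y: "y \<in> T" and x: "x \<in> T" and eq: "\<And>h. h \<in> carrier G \<Longrightarrow> c + \<chi> y h \<doteq> d + \<chi> x h" for x y c d
  proof -
    \<comment> \<open>Functions of elements of \<open>T\<close> vanish at the identity, so the
      constants agree.\<close>
    from eq[OF one_closed] \<chi>_one[OF y] \<chi>_one[OF x] have cd: "c \<doteq> d"
      by (rule cong_lin(3)[where u = 1 and u' = "-1" and u'' = 1]) simp
    have "\<chi> y h \<doteq> \<chi> x h" if h: "h \<in> carrier G" for h
      using eq[OF h] cd by (rule cong_lin(2)[where u = 1 and u' = "-1"]) simp
    then show ?thesis using \<chi>_eq_center[OF y x] by metis
  qed
  have FN: "F (h \<otimes> n) \<doteq> F h" if "h \<in> carrier G" "n \<in> N" for h n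
    unfolding F_def by (intro cong_mult \<chi>_shift_N aT t(1) that)
  have Fx: "\<exists>x \<in> V. \<exists>c. \<forall>h \<in> carrier G. F (h \<otimes> g) - F h \<doteq> c + \<chi> x h" if g: "g \<in> carrier G" for g
  proof -
    let ?k = "\<chi> a g"
    obtain n where n: "n \<in> T" "n \<in> N" "hgt n \<doteq> 0"
      "\<And>h. h \<in> carrier G \<Longrightarrow> F (h \<otimes> g) - F h \<doteq> \<chi> a g * \<chi> t g + \<chi> (n \<otimes> t [^] ?k) h" using key[OF g] by blast
    define y where "y = n \<otimes> t [^] ?k"
    have yT: "y \<in> T" unfolding y_def by (rule subgroup.m_closed[OF T_subgroup n(1) tp])
    have "hgt t \<doteq> 0" using hgt_eq[of t 0] t(3) by simp
    from hgt_T_mult[OF n(1) tp[of ?k]] n(3) hgt_T_pow[OF t(1), of ?k] this have "hgt y \<doteq> 0"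
      unfolding y_def by (rule cong_lin(4)[where u = 1 and u' = 1 and u'' = 1 and u''' = "?k"]) simp
    then obtain c where c: "c \<in> Z" "(y \<otimes> c) [^] p = \<one>"
      using hgt_zero[OF T_closed[OF yT] T_pow[OF yT]] by blast
    have cG: "c \<in> carrier G" by (rule center_closed[OF c(1)])
    have ycT: "y \<otimes> c \<in> T" by (rule subgroup.m_closed[OF T_subgroup yT center_T[OF c(1)]])
    have "y \<otimes> c \<otimes> t [^] (- ?k) = n \<otimes> (t [^] ?k \<otimes> (c \<otimes> t [^] (- ?k)))"
      unfolding y_def using T_closed[OF n(1)] tpG cG by (simp add: m_assoc)
    also have "\<dots> = n \<otimes> c" unfolding center_commute[OF c(1) tpG]
      using T_closed[OF n(1)] tG cG by (simp add: int_pow_neg)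
    finally have "y \<otimes> c \<otimes> t [^] (- ?k) \<in> N" using subgroup.m_closed[OF N_sub n(2)] Z_N c(1) by auto
    then have yV: "y \<otimes> c \<in> V" unfolding V_def using ycT c(2) by blast
    have "F (h \<otimes> g) - F h \<doteq> \<chi> a g * \<chi> t g + \<chi> (y \<otimes> c) h" if h: "h \<in> carrier G" for h
    proof -
      have "\<chi> c h \<doteq> 0" using \<chi>_commute[OF center_T[OF c(1)] h] center_commute[OF c(1) h] by simp
      from n(4)[OF h] \<chi>_mult[OF yT center_T[OF c(1)] h] this show ?thesis unfolding y_def[symmetric]
        by (rule cong_lin(3)[where u = 1 and u' = "-1" and u'' = "-1"]) simp
    qed
    then show ?thesis using yV by blast
  qed
  \<comment> \<open>The function of \<open>a \<in> W\<close> vanishes on \<open>T\<close>, so in a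
    direction \<open>x \<in> V\<close> the power of \<open>t\<close> disappears and only the factor
    from \<open>N\<close> remains.\<close>
  have cond: "y \<in> N" if x: "x \<in> V" and y: "y \<in> V" and eq: "\<forall>h \<in> carrier G. F (h \<otimes> x) - F h \<doteq> c + \<chi> y h" for x y c
  proof -
    let ?k = "\<chi> a x"
    obtain n where n: "n \<in> T" "n \<in> N"
      "\<And>h. h \<in> carrier G \<Longrightarrow> F (h \<otimes> x) - F h \<doteq> \<chi> a x * \<chi> t x + \<chi> (n \<otimes> t [^] ?k) h"
      using key[OF VG[OF x]] by blast
    have "?k \<doteq> 0" using \<chi>_W_T[OF a(1)] VT x by blast
    then have "t [^] ?k = t [^] (0::int)" by (rule pow_cong[OF tG t(3)])
    then have nt: "n \<otimes> t [^] ?k = n" using T_closed[OF n(1)] by simp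
    have "c + \<chi> y h \<doteq> \<chi> a x * \<chi> t x + \<chi> n h" if h: "h \<in> carrier G" for h
      using eq n(3)[OF h] h cong_trans cong_sym unfolding nt by blast
    then obtain c' where "c' \<in> Z" "y = n \<otimes> c'" using shift[of y n] VT y n(1) by blast
    then show ?thesis using subgroup.m_closed[OF N_sub n(2)] Z_N by blast
  qed
  obtain s where s: "s \<in> carrier G" "\<And>n. n \<in> N \<Longrightarrow> s \<otimes> n = n \<otimes> s" "\<And>g. g \<in> carrier G \<Longrightarrow> cm g s \<in> V"
    "\<And>g. g \<in> carrier G \<Longrightarrow> \<exists>c. \<forall>h \<in> carrier G. F (h \<otimes> g) - F h \<doteq> c + \<chi> (cm g s) h"
    "\<And>g. g \<in> carrier G \<Longrightarrow> cm g s \<in> W \<Longrightarrow> ev (cm g s) \<doteq> F g - F \<one>"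
    by (rule realize[OF V WV VT Vcomm _ FN Fx cond]) (auto simp: V_def)
  \<comment> \<open>In a direction with \<open>\<chi> a g\<close> equal to 1 the power of
    \<open>t\<close> is \<open>t\<close> itself, so \<open>[g,s]\<close> is \<open>t\<close> up to
    factors in \<open>N\<close>.\<close>
  obtain g where g: "g \<in> carrier G" "\<chi> a g \<doteq> 1" using noncentral_\<chi>[OF a] by blast
  obtain n where n: "n \<in> T" "n \<in> N"
    "\<And>h. h \<in> carrier G \<Longrightarrow> F (h \<otimes> g) - F h \<doteq> \<chi> a g * \<chi> t g + \<chi> (n \<otimes> t [^] \<chi> a g) h"
    using key[OF g(1)] by blast
  have "t [^] \<chi> a g = t" using pow_cong[OF tG t(3) g(2)] tG by simp
  note n = n(1,2) n(3)[unfolded this]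
  obtain c where c: "\<And>h. h \<in> carrier G \<Longrightarrow> F (h \<otimes> g) - F h \<doteq> c + \<chi> (cm g s) h" using s(4)[OF g(1)] by blast
  have "c + \<chi> (cm g s) h \<doteq> \<chi> a g * \<chi> t g + \<chi> (n \<otimes> t) h" if h: "h \<in> carrier G" for h
    using c[OF h] n(3)[OF h] cong_trans cong_sym by blast
  then obtain c' where c': "c' \<in> Z" "cm g s = n \<otimes> t \<otimes> c'"
    using shift[of "cm g s" "n \<otimes> t"] VT s(3)[OF g(1)] subgroup.m_closed[OF T_subgroup n(1) t(1)] by blast
  have cG: "c' \<in> carrier G" by (rule center_closed[OF c'(1)])
  have te: "t = inv n \<otimes> cm g s \<otimes> inv c'"
    unfolding c'(2) using T_closed[OF n(1)] tG cG by (simp add: m_assoc)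
  have tH: "t \<in> H" if H: "subgroup H G" "n \<in> H" "cm g s \<in> H" "c' \<in> H" for H
    by (subst te) (intro subgroup.m_closed[OF H(1)] subgroup.m_inv_closed[OF H(1)] H(2-4))
  have c'N: "c' \<in> N" using Z_N c'(1) by blast
  from alt show False
  proof
    assume DN: "D \<subseteq> N"
    have "dex d s \<doteq> 0" if d: "d \<in> D" for d using s(2)[of d] DN d commute_dex[OF d s(1)] by blast
    then have "s \<in> \<Phi>" using s(1) by (simp add: \<Phi>_def)
    then show False using tH[OF N_sub n(2) cm_\<Phi>_N[OF _ g(1)] c'N] t(2) by blast
  next
    assume "t \<notin> \<Phi>"
    then show False using tH[OF \<Phi>_subgroup _ cm_\<Phi>[OF g(1) s(1)]] n(2) c'N N_\<Phi> by blast
  qed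
qed

text \<open>Height zero becomes order dividing \<open>p\<close> after multiplying by a central
  \<open>c\<close>, which lies in \<open>N\<close> and in \<open>\<Phi>\<close> and does not change
  commutators.\<close>

lemma cubic_obstruction:
  assumes t: "t \<in> T" "t \<notin> N" "hgt t \<doteq> 0"
    and alt: "D \<subseteq> N \<or> t \<notin> \<Phi>"
    and a: "a \<in> W" "a \<notin> Z"
    and \<beta>0: "\<And>g. g \<in> carrier G \<Longrightarrow> \<beta> a (cm g t) \<doteq> 0"
  shows False
proof -
  obtain c where c: "c \<in> Z" "(t \<otimes> c) [^] p = \<one>"
    using hgt_zero[OF T_closed[OF t(1)] T_pow[OF t(1)] t(3)] by blast
  have G: "t \<in> carrier G" "c \<in> carrier G" using T_closed[OF t(1)] center_closed[OF c(1)] by auto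
  have H: "t \<in> H" if "subgroup H G" "c \<in> H" "t \<otimes> c \<in> H" for H
  proof -
    have "t \<otimes> c \<otimes> inv c \<in> H" by (intro subgroup.m_closed[OF that(1)] subgroup.m_inv_closed[OF that(1)] that(2,3))
    then show ?thesis using G by (simp add: m_assoc)
  qed
  have cN: "c \<in> N" "c \<in> \<Phi>" using Z_N N_\<Phi> c(1) by auto
  show False
  proof (rule cubic_obstruction_order_p[OF _ _ c(2) _ a])
    show "t \<otimes> c \<in> T" by (rule subgroup.m_closed[OF T_subgroup t(1) center_T[OF c(1)]])
    show "t \<otimes> c \<notin> N" using H[OF N_sub cN(1)] t(2) by blast
    show "D \<subseteq> N \<or> t \<otimes> c \<notin> \<Phi>" using alt H[OF \<Phi>_subgroup cN(2)] by blast
    show "\<beta> a (cm g (t \<otimes> c)) \<doteq> 0" if g: "g \<in> carrier G" for g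
      using \<beta>0[OF g] cm_T_mult[OF t(1) center_T[OF c(1)] g] center_cm[OF c(1) g] g G by simp
  qed
qed

text \<open>Otherwise \<open>T\<close> modulo its center \<open>T \<inter> N\<close> would be cyclic.\<close>

lemma kernel_not_N:
  assumes \<psi>: "addmod T (int p) \<psi>"
  obtains t where "t \<in> T" "t \<notin> N" "\<psi> t \<doteq> 0"
proof (rule ccontr)
  note found = that
  assume neg: "\<not> thesis"
  have ker: "t \<in> N" if "t \<in> T" "\<psi> t \<doteq> 0" for t using that found neg by blast
  obtain t0 where t0: "t0 \<in> T" "t0 \<notin> N" using T_not_N by blast
  have t0G: "t0 \<in> carrier G" by (rule T_closed[OF t0(1)])
  obtain k where k: "\<psi> t0 * k \<doteq> 1" using exists_inverse ker t0 by metis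
  have "t0 \<in> N"
  proof (rule centralizer_T[OF t0G])
    fix t assume t: "t \<in> T"
    have tG: "t \<in> carrier G" by (rule T_closed[OF t])
    define m where "m = - k * \<psi> t"
    have m: "t0 [^] m \<in> T" by (rule subgroup_int_pow_closed[OF T_subgroup t0(1)])
    from addmodD[OF \<psi> t m] addmod_int_pow[OF \<psi> T_subgroup t0(1), of m] k have "\<psi> (t \<otimes> t0 [^] m) \<doteq> 0"
      by (rule cong_lin(3)[where u = 1 and u' = 1 and u'' = "- \<psi> t"]) (simp add: m_def algebra_simps)
    then have "t \<otimes> t0 [^] m \<in> N" using ker subgroup.m_closed[OF T_subgroup t m] by blast
    then have "t0 \<otimes> (t \<otimes> t0 [^] m) = t \<otimes> t0 [^] m \<otimes> t0" by (rule T_N[OF t0(1)])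
    also have "\<dots> = t \<otimes> (t0 [^] m \<otimes> t0)" using tG t0G by (simp add: m_assoc)
    also have "t0 [^] m \<otimes> t0 = t0 \<otimes> t0 [^] m" by (rule commute_int_pow) (use t0G in auto)
    finally have "(t0 \<otimes> t) \<otimes> t0 [^] m = (t \<otimes> t0) \<otimes> t0 [^] m" using tG t0G by (simp add: m_assoc)
    then show "t0 \<otimes> t = t \<otimes> t0" using right_cancel tG t0G by (metis int_pow_closed m_closed)
  qed
  then show False using t0(2) by blast
qed

text \<open>If \<open>W\<close> were central, it would be generated by \<open>z\<close>, so
  \<open>T\<close> would be contained in the abelian group \<open>D\<close>, and then
  \<open>T \<le> C(T) \<le> N\<close>.\<close>

lemma W_noncentral: "\<exists>a \<in> W. a \<notin> Z"
proof (rule ccontr)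
  assume "\<not> ?thesis"
  then have central: "w \<in> Z" if "w \<in> W" for w using that by blast
  have TD: "t \<in> D" if t: "t \<in> T" for t
  proof -
    have "\<exists>i::int. cm g t = z [^] i" if g: "g \<in> carrier G" for g
      using W_central[OF cm_T[OF t g] central[OF cm_T[OF t g]]] by metis
    then show ?thesis using T_closed[OF t] by (simp add: D_def)
  qed
  have "t \<in> N" if t: "t \<in> T" for t
    by (rule centralizer_T[OF T_closed[OF t]]) (rule D_commute[OF TD[OF t] TD])
  then show False using T_not_N by blast
qed

section \<open>The obstruction homomorphisms attached to \<open>a\<close> and
  \<open>t\<close>\<close>

lemma \<chi>_zpow: "h \<in> carrier G \<Longrightarrow> \<chi> (z [^] (i::int)) h \<doteq> 0"
  using \<chi>_commute[OF W_in_T[OF zpow_W]] z_commute by metis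

lemma \<beta>_zpow_mult:
  assumes a: "a \<in> W" and w: "w \<in> W"
  shows "\<beta> a (z [^] (i::int) \<otimes> w) \<doteq> \<beta> a w"
proof (rule \<beta>_cong[OF a subgroup.m_closed[OF W_subgroup zpow_W w] w])
  fix h assume h: "h \<in> carrier G"
  from \<chi>_mult[OF W_in_T[OF zpow_W[of i]] W_in_T[OF w] h] \<chi>_zpow[OF h, of i] show "\<chi> (z [^] i \<otimes> w) h \<doteq> \<chi> w h"
    by (rule cong_lin(2)[where u = 1 and u' = 1]) simp
qed

lemma \<beta>_zpow: assumes a: "a \<in> W" shows "\<beta> a (z [^] (i::int)) \<doteq> 0"
proof -
  have 1: "\<one> \<in> W" by (rule subgroup.one_closed[OF W_subgroup])
  have "\<beta> a (z [^] i) \<doteq> \<beta> a \<one>" using \<beta>_zpow_mult[OF a 1, of i] by simp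
  then show ?thesis using addmod_one[OF \<beta>_addmod[OF a] W_subgroup] cong_trans by blast
qed

text \<open>The obstruction to realizing the product of the functions of \<open>a\<close> and
  \<open>t\<close>: \<open>cubic_obstruction\<close> applies once it vanishes for all
  \<open>g\<close>. By \<open>\<kappa>_addmod\<close> it is a homomorphism in \<open>g\<close>, so
  it is itself realized in \<open>D\<close>.\<close>

definition \<kappa> where "\<kappa> a t g = \<beta> a (cm g t)"

lemma \<kappa>_addmod: assumes a: "a \<in> W" and t: "t \<in> T" shows "addmod (carrier G) (int p) (\<kappa> a t)"
  unfolding addmod_def \<kappa>_def
proof (intro ballI)
  fix g h assume gh: "g \<in> carrier G" "h \<in> carrier G"
  note w = cm_T[OF t gh(1)] cm_T[OF t gh(2)]
  have eq: "cm (g \<otimes> h) t = z [^] dex (cm h t) g \<otimes> cm h t \<otimes> cm g t"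
    unfolding cm_mult_left[OF gh T_closed[OF t]] conj_D[OF W_D[OF w(2)] gh(1)] ..
  from \<beta>_mult[OF a subgroup.m_closed[OF W_subgroup zpow_W[of "dex (cm h t) g"] w(2)] w(1)]
    \<beta>_zpow_mult[OF a w(2), of "dex (cm h t) g"]
  show "\<beta> a (cm (g \<otimes> h) t) \<doteq> \<beta> a (cm g t) + \<beta> a (cm h t)" unfolding eq
    by (rule cong_lin(2)[where u = 1 and u' = 1]) simp
qed

lemma \<kappa>_mult:
  assumes a: "a \<in> W" and t: "t \<in> T" "t' \<in> T" and g: "g \<in> carrier G"
  shows "\<kappa> a (t \<otimes> t') g \<doteq> \<kappa> a t g + \<kappa> a t' g"
  unfolding \<kappa>_def cm_T_mult[OF t g] by (rule \<beta>_mult[OF a cm_T[OF t(1) g] cm_T[OF t(2) g]])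

lemma \<kappa>_pow:
  assumes a: "a \<in> W" and t: "t \<in> T" and g: "g \<in> carrier G"
  shows "\<kappa> a (t [^] (i::int)) g \<doteq> i * \<kappa> a t g"
proof -
  have "addmod T (int p) (\<lambda>t. \<kappa> a t g)" using \<kappa>_mult[OF a _ _ g] by (simp add: addmod_def)
  then show ?thesis by (rule addmod_int_pow[OF _ T_subgroup t])
qed

lemma \<kappa>_D: "a \<in> W \<Longrightarrow> d \<in> D \<Longrightarrow> g \<in> carrier G \<Longrightarrow> \<kappa> a d g \<doteq> 0"
  unfolding \<kappa>_def using cm_D \<beta>_zpow by metis

text \<open>The function of \<open>[g, product_elt b c]\<close> is the linear part of the difference
  of a product, namely \<open>\<chi> c g\<close> times the function of \<open>b\<close> plus
  \<open>\<chi> b g\<close> times that of \<open>c\<close>. Now apply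
  \<open>\<beta> a\<close>.\<close>

lemma \<kappa>_pe:
  assumes a: "a \<in> W" and bc: "b \<in> W" "c \<in> W" and g: "g \<in> carrier G"
  shows "\<kappa> a (product_elt b c) g \<doteq> \<chi> c g * \<beta> a b + \<chi> b g * \<beta> a c"
proof -
  note s = product_elt[OF bc]
  let ?x = "b [^] \<chi> c g" and ?y = "c [^] \<chi> b g"
  have xy: "?x \<in> W" "?y \<in> W" using subgroup_int_pow_closed[OF W_subgroup] bc by auto
  have "\<kappa> a (product_elt b c) g \<doteq> \<beta> a (?x \<otimes> ?y)" unfolding \<kappa>_def
  proof (rule \<beta>_cong[OF a cm_T[OF s(1) g] subgroup.m_closed[OF W_subgroup xy]])
    fix h assume h: "h \<in> carrier G"
    have 1: "\<chi> (product_elt b c) (h \<otimes> g) \<doteq> (\<chi> b h + \<chi> b g) * (\<chi> c h + \<chi> c g)"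
      by (rule cong_trans[OF s(3)[OF m_closed[OF h g]]]) (intro cong_mult \<chi>_D_add W_D bc h g)
    from \<chi>_cocycle[OF s(1) h g] 1 s(3)[OF h] s(3)[OF g]
    have 2: "\<chi> (cm g (product_elt b c)) h \<doteq> \<chi> c g * \<chi> b h + \<chi> b g * \<chi> c h"
      by (rule cong_lin(4)[where u = "-1" and u' = 1 and u'' = "-1" and u''' = "-1"]) (simp add: algebra_simps)
    from 2 \<chi>_mult[OF W_in_T[OF xy(1)] W_in_T[OF xy(2)] h] \<chi>_pow[OF W_in_T[OF bc(1)] h, of "\<chi> c g"]
      \<chi>_pow[OF W_in_T[OF bc(2)] h, of "\<chi> b g"]
    show "\<chi> (cm g (product_elt b c)) h \<doteq> \<chi> (?x \<otimes> ?y) h"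
      by (rule cong_lin(4)[where u = 1 and u' = "-1" and u'' = "-1" and u''' = "-1"]) simp
  qed
  from this \<beta>_mult[OF a xy] \<beta>_pow[OF a bc(1), of "\<chi> c g"] \<beta>_pow[OF a bc(2), of "\<chi> b g"] show ?thesis
    by (rule cong_lin(4)[where u = 1 and u' = 1 and u'' = 1 and u''' = 1]) simp
qed

text \<open>As a function, \<open>\<sigma>\<close> is \<open>-(k \<theta> - \<beta>(a,k) \<theta>\<^sup>2 / 2)\<close>.\<close>

lemma \<kappa>_correction:
  assumes a: "a \<in> W" and \<theta>: "\<theta> \<in> W" "\<beta> a \<theta> \<doteq> 1" and k: "k \<in> W"
  obtains \<sigma> where "\<sigma> \<in> T" "\<sigma> \<in> N" "\<And>g. g \<in> carrier G \<Longrightarrow> \<kappa> a \<sigma> g \<doteq> - \<chi> k g"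
    "hgt \<sigma> \<doteq> half * \<beta> a k * \<beta> \<theta> \<theta> - \<beta> \<theta> k"
proof
  \<comment> \<open>By \<open>\<kappa>_pe\<close> and \<open>\<beta> a \<theta>\<close> equal to 1,
    the product of \<open>\<theta>\<close> and \<open>k\<close> yields \<open>\<chi> k g\<close>
    plus the unwanted \<open>\<beta> a k * \<chi> \<theta> g\<close>, while the square of
    \<open>\<theta>\<close> yields \<open>2 * \<chi> \<theta> g\<close>. The exponent
    \<open>?m\<close> cancels the unwanted term.\<close>
  let ?m = "half * \<beta> a k"
  let ?x = "product_elt \<theta> k [^] (-1::int)" and ?y = "product_elt \<theta> \<theta> [^] ?m"
  note s = product_elt[OF \<theta>(1) k] and r = product_elt[OF \<theta>(1) \<theta>(1)]
  have xT: "?x \<in> T" and yT: "?y \<in> T"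
    using subgroup_int_pow_closed[OF T_subgroup s(1), of "-1"] subgroup_int_pow_closed[OF T_subgroup r(1), of ?m] by simp_all
  have xN: "?x \<in> N" and yN: "?y \<in> N"
    using subgroup_int_pow_closed[OF N_sub s(2), of "-1"] subgroup_int_pow_closed[OF N_sub r(2), of ?m] by simp_all
  show "?x \<otimes> ?y \<in> T" by (rule subgroup.m_closed[OF T_subgroup xT yT])
  show "?x \<otimes> ?y \<in> N" by (rule subgroup.m_closed[OF N_sub xN yN])
  show "\<kappa> a (?x \<otimes> ?y) g \<doteq> - \<chi> k g" if g: "g \<in> carrier G" for g
  proof -
    from \<kappa>_pow[OF a s(1) g, of "-1"] \<kappa>_pe[OF a \<theta>(1) k g] \<theta>(2)
    have 1: "\<kappa> a ?x g \<doteq> - (\<chi> k g + \<chi> \<theta> g * \<beta> a k)"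
      by (rule cong_lin(3)[where u = 1 and u' = "-1" and u'' = "- \<chi> k g"]) (simp add: algebra_simps)
    from \<kappa>_pow[OF a r(1) g, of ?m] \<kappa>_pe[OF a \<theta>(1) \<theta>(1) g] \<theta>(2) half
    have 2: "\<kappa> a ?y g \<doteq> \<chi> \<theta> g * \<beta> a k"
      by (rule cong_lin(4)[where u = 1 and u' = "half * \<beta> a k" and u'' = "2 * half * \<beta> a k * \<chi> \<theta> g"
            and u''' = "\<chi> \<theta> g * \<beta> a k"]) (simp add: algebra_simps)
    from \<kappa>_mult[OF a xT yT g] 1 2 show ?thesis
      by (rule cong_lin(3)[where u = 1 and u' = 1 and u'' = 1]) simp
  qed
  from hgt_T_mult[OF xT yT] hgt_T_pow[OF s(1), of "-1"] hgt_T_pow[OF r(1), of ?m]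
  show "hgt (?x \<otimes> ?y) \<doteq> half * \<beta> a k * \<beta> \<theta> \<theta> - \<beta> \<theta> k"
    unfolding \<beta>_def[of \<theta> k] \<beta>_def[of \<theta> \<theta>]
    by (rule cong_lin(3)[where u = 1 and u' = 1 and u'' = 1]) simp
qed

lemma D_hgt_zero_N: assumes d: "d \<in> D" "hgt d \<doteq> 0" shows "d \<in> N"
proof -
  obtain c where c: "c \<in> Z" "(d \<otimes> c) [^] p = \<one>"
    using hgt_zero[OF D_closed[OF d(1)] D_pow[OF d(1)] d(2)] by blast
  have "d \<otimes> c \<in> W" using subgroup.m_closed[OF D_subgroup d(1) center_D[OF c(1)]] c(2) by (simp add: W_def)
  then have "d \<otimes> c \<in> N" using W_N by blast
  moreover have "inv c \<in> N" using subgroup.m_inv_closed[OF N_sub] Z_N c(1) by blast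
  ultimately have "d \<otimes> c \<otimes> inv c \<in> N" by (rule subgroup.m_closed[OF N_sub])
  then show ?thesis using D_closed[OF d(1)] center_closed[OF c(1)] by (simp add: m_assoc)
qed

text \<open>If \<open>D\<close> has an element of nonzero height, a power of it brings
  \<open>t\<close> to height zero. The obstruction does not change, because commutators with
  elements of \<open>D\<close> are powers of \<open>z\<close> and \<open>\<beta> a\<close> vanishes
  on those.\<close>

lemma no_annihilated_element:
  assumes t: "t \<in> T" "t \<notin> N" and alt: "D \<subseteq> N \<or> t \<notin> \<Phi>"
    and a: "a \<in> W" "a \<notin> Z"
    and \<kappa>0: "\<And>g. g \<in> carrier G \<Longrightarrow> \<kappa> a t g \<doteq> 0"
    and h: "hgt t \<doteq> 0 \<or> (\<exists>x \<in> D. \<not> hgt x \<doteq> 0)"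
  shows False
proof (cases "hgt t \<doteq> 0")
  case True
  then show False using cubic_obstruction[OF t _ alt a] \<kappa>0 unfolding \<kappa>_def by blast
next
  case False
  then obtain x where x: "x \<in> D" "hgt x \<doteq> 1" using h normalized_height by metis
  have xT: "x \<in> T" using D_T x(1) by blast
  let ?y = "x [^] (- hgt t)"
  have yD: "?y \<in> D" by (rule subgroup_int_pow_closed[OF D_subgroup x(1)])
  have yT: "?y \<in> T" using D_T yD by blast
  have cancel: "t \<in> H" if H: "subgroup H G" "t \<otimes> ?y \<in> H" "?y \<in> H" for H
  proof -
    have "t \<otimes> ?y \<otimes> inv ?y \<in> H" by (intro subgroup.m_closed[OF H(1)] subgroup.m_inv_closed[OF H(1)] H(2,3))
    then show ?thesis using T_closed[OF t(1)] T_closed[OF yT] by (simp add: m_assoc)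
  qed
  have alt': "D \<subseteq> N \<or> t \<otimes> ?y \<notin> \<Phi>" using alt cancel[OF \<Phi>_subgroup] D_\<Phi> yD by blast
  have "t \<otimes> ?y \<notin> N"
  proof (cases "D \<subseteq> N")
    case True
    then show ?thesis using cancel[OF N_sub] yD t(2) by blast
  next
    case False
    then show ?thesis using alt' N_\<Phi> by blast
  qed
  moreover have "hgt (t \<otimes> ?y) \<doteq> 0"
    using hgt_T_mult[OF t(1) yT] hgt_T_pow[OF xT, of "- hgt t"] x(2)
    by (rule cong_lin(3)[where u = 1 and u' = 1 and u'' = "- hgt t"]) (simp add: algebra_simps)
  moreover have "\<beta> a (cm g (t \<otimes> ?y)) \<doteq> 0" if g: "g \<in> carrier G" for g
    using \<kappa>_mult[OF a(1) t(1) yT g] \<kappa>0[OF g] \<kappa>_D[OF a(1) yD g] unfolding \<kappa>_def[of a "t \<otimes> ?y"]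
    by (rule cong_lin(3)[where u = 1 and u' = 1 and u'' = 1]) simp
  ultimately show False
    using cubic_obstruction[OF subgroup.m_closed[OF T_subgroup t(1) yT] _ _ alt' a] by blast
qed

text \<open>An element \<open>t\<close> of \<open>T\<close> outside \<open>N\<close> is sought to
  which \<open>no_annihilated_element\<close> applies, possibly after multiplication by an element
  of \<open>T \<inter> N\<close>. When \<open>\<beta> a\<close> is nonzero,
  \<open>\<kappa>_correction\<close> supplies that factor provided the homomorphism
  \<open>\<kappa> a t\<close> is realized in \<open>W\<close>, that is, by an element of height
  zero.\<close>

lemma inconsistent: False
proof -
  obtain a where a: "a \<in> W" "a \<notin> Z" using W_noncentral by blast
  have T_D: "d \<in> T" if "d \<in> D" for d using D_T that by blast
  \<comment> \<open>An \<open>x \<in> D\<close> outside \<open>N\<close> has nonzero height by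
    \<open>D_hgt_zero_N\<close>. Any \<open>t\<close> that does not commute with it lies outside
    \<open>\<Phi> = C(D)\<close>.\<close>
  have outside: "\<exists>x \<in> D. \<exists>t \<in> T. \<not> hgt x \<doteq> 0 \<and> t \<notin> \<Phi> \<and> \<not> \<chi> x t \<doteq> 0" if DN: "\<not> D \<subseteq> N"
  proof -
    obtain x where x: "x \<in> D" "x \<notin> N" using DN by blast
    then obtain t where t: "t \<in> T" "x \<otimes> t \<noteq> t \<otimes> x" using separating_T D_\<Phi> by blast
    have "\<not> dex x t \<doteq> 0" using commute_dex[OF x(1) T_closed[OF t(1)]] t(2) by metis
    then have "t \<notin> \<Phi>" "\<not> \<chi> x t \<doteq> 0"
      using x(1) \<chi>_D[OF x(1) T_closed[OF t(1)]] cong_trans cong_sym unfolding \<Phi>_def by blast+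
    then show ?thesis using x t(1) D_hgt_zero_N by blast
  qed
  show False
  proof (cases "\<forall>w \<in> W. \<beta> a w \<doteq> 0")
    case True
    then have \<kappa>0: "\<kappa> a t g \<doteq> 0" if "t \<in> T" "g \<in> carrier G" for t g unfolding \<kappa>_def using cm_T that by blast
    show False
    proof (cases "D \<subseteq> N")
      case True
      obtain t where "t \<in> T" "t \<notin> N" "hgt t \<doteq> 0" using kernel_not_N[OF hgt_addmod_T] by blast
      then show False using no_annihilated_element[of t a] a True \<kappa>0 by blast
    next
      case False
      then obtain x t where "x \<in> D" "t \<in> T" "\<not> hgt x \<doteq> 0" "t \<notin> \<Phi>" using outside by blast
      then show False using no_annihilated_element[of t a] a N_\<Phi> \<kappa>0 by blast
    qed
  next
    case False
    then obtain \<theta>0 where \<theta>0: "\<theta>0 \<in> W" "\<not> \<beta> a \<theta>0 \<doteq> 0" by blast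
    then obtain l where l: "\<beta> a \<theta>0 * l \<doteq> 1" using exists_inverse by blast
    define \<theta> where "\<theta> = \<theta>0 [^] l"
    have \<theta>W: "\<theta> \<in> W" unfolding \<theta>_def by (rule subgroup_int_pow_closed[OF W_subgroup \<theta>0(1)])
    from \<beta>_pow[OF a(1) \<theta>0(1), of l] l have \<theta>1: "\<beta> a \<theta> \<doteq> 1" unfolding \<theta>_def
      by (rule cong_lin(2)[where u = 1 and u' = 1]) (simp add: algebra_simps)
    obtain k where k: "\<And>t. t \<in> T \<Longrightarrow> k t \<in> D" "\<And>t g. t \<in> T \<Longrightarrow> g \<in> carrier G \<Longrightarrow> \<chi> (k t) g \<doteq> \<kappa> a t g"
      using hom_\<chi>[OF \<kappa>_addmod[OF a(1)]] by metis
    have kmult: "\<chi> (k (t \<otimes> t')) g \<doteq> \<chi> (k t \<otimes> k t') g" if t: "t \<in> T" "t' \<in> T" and g: "g \<in> carrier G" for t t' g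
    proof -
      from k(2)[OF subgroup.m_closed[OF T_subgroup t] g] \<kappa>_mult[OF a(1) t g] k(2)[OF t(1) g] k(2)[OF t(2) g]
      have "\<chi> (k (t \<otimes> t')) g \<doteq> \<chi> (k t) g + \<chi> (k t') g"
        by (rule cong_lin(4)[where u = 1 and u' = 1 and u'' = "-1" and u''' = "-1"]) simp
      then show ?thesis
        using \<chi>_mult[OF T_D[OF k(1)[OF t(1)]] T_D[OF k(1)[OF t(2)]] g] cong_trans cong_sym by blast
    qed
    have hk: "addmod T (int p) (\<lambda>t. hgt (k t))" unfolding addmod_def
    proof (intro ballI)
      fix t t' assume t: "t \<in> T" "t' \<in> T"
      note kk = T_D[OF k(1)[OF t(1)]] T_D[OF k(1)[OF t(2)]]
      have "hgt (k (t \<otimes> t')) \<doteq> hgt (k t \<otimes> k t')"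
        by (rule hgt_\<chi>[OF T_D[OF k(1)[OF subgroup.m_closed[OF T_subgroup t]]] subgroup.m_closed[OF T_subgroup kk]])
          (rule kmult[OF t])
      then show "hgt (k (t \<otimes> t')) \<doteq> hgt (k t) + hgt (k t')" using hgt_T_mult[OF kk] cong_trans by blast
    qed
    \<comment> \<open>Here \<open>w\<close> realizes \<open>\<kappa> a t\<close>, so multiplying
      \<open>t\<close> by \<open>\<sigma>\<close> from \<open>\<kappa>_correction\<close> removes
      the obstruction. The second alternative of \<open>ht\<close> says that the product has height
      zero; under the first, its height can be adjusted by \<open>D\<close>.\<close>
    have step: False if t: "t \<in> T" "t \<notin> N" "D \<subseteq> N \<or> t \<notin> \<Phi>" and w: "w \<in> W" "\<And>g. g \<in> carrier G \<Longrightarrow> \<chi> w g \<doteq> \<kappa> a t g"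
      and ht: "(\<exists>x \<in> D. \<not> hgt x \<doteq> 0) \<or> hgt t + (half * \<beta> a w * \<beta> \<theta> \<theta> - \<beta> \<theta> w) \<doteq> 0" for t w
    proof -
      obtain \<sigma> where \<sigma>: "\<sigma> \<in> T" "\<sigma> \<in> N" "\<And>g. g \<in> carrier G \<Longrightarrow> \<kappa> a \<sigma> g \<doteq> - \<chi> w g"
        "hgt \<sigma> \<doteq> half * \<beta> a w * \<beta> \<theta> \<theta> - \<beta> \<theta> w"
        using \<kappa>_correction[OF a(1) \<theta>W \<theta>1 w(1)] by blast
      have cancel: "t \<in> H" if H: "subgroup H G" "t \<otimes> \<sigma> \<in> H" "\<sigma> \<in> H" for H
      proof -
        have "t \<otimes> \<sigma> \<otimes> inv \<sigma> \<in> H" by (intro subgroup.m_closed[OF H(1)] subgroup.m_inv_closed[OF H(1)] H(2,3))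
        then show ?thesis using T_closed[OF t(1)] T_closed[OF \<sigma>(1)] by (simp add: m_assoc)
      qed
      show False
      proof (rule no_annihilated_element[OF _ _ _ a])
        show "t \<otimes> \<sigma> \<in> T" by (rule subgroup.m_closed[OF T_subgroup t(1) \<sigma>(1)])
        show "t \<otimes> \<sigma> \<notin> N" using cancel[OF N_sub] \<sigma>(2) t(2) by blast
        show "D \<subseteq> N \<or> t \<otimes> \<sigma> \<notin> \<Phi>" using cancel[OF \<Phi>_subgroup] \<sigma>(2) N_\<Phi> t(3) by blast
        show "\<kappa> a (t \<otimes> \<sigma>) g \<doteq> 0" if g: "g \<in> carrier G" for g
          using \<kappa>_mult[OF a(1) t(1) \<sigma>(1) g] \<sigma>(3)[OF g] w(2)[OF g]
          by (rule cong_lin(3)[where u = 1 and u' = 1 and u'' = "-1"]) simp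
        show "hgt (t \<otimes> \<sigma>) \<doteq> 0 \<or> (\<exists>x \<in> D. \<not> hgt x \<doteq> 0)"
          using ht
        proof
          assume 0: "hgt t + (half * \<beta> a w * \<beta> \<theta> \<theta> - \<beta> \<theta> w) \<doteq> 0"
          from hgt_T_mult[OF t(1) \<sigma>(1)] \<sigma>(4) 0 have "hgt (t \<otimes> \<sigma>) \<doteq> 0"
            by (rule cong_lin(3)[where u = 1 and u' = 1 and u'' = 1]) simp
          then show ?thesis by blast
        qed blast
      qed
    qed
    show False
    proof (cases "\<exists>x \<in> D. \<not> hgt x \<doteq> 0")
      case E: True
      have "\<exists>t \<in> T. t \<notin> N \<and> (D \<subseteq> N \<or> t \<notin> \<Phi>) \<and> hgt (k t) \<doteq> 0"
      proof (cases "D \<subseteq> N")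
        case True
        then show ?thesis using kernel_not_N[OF hk] by metis
      next
        case False
        then obtain x t where x: "x \<in> D" "\<not> hgt x \<doteq> 0" and t: "t \<in> T" "t \<notin> \<Phi>" "\<not> \<chi> x t \<doteq> 0"
          using outside by blast
        have tG: "t \<in> carrier G" by (rule T_closed[OF t(1)])
        obtain m where m: "hgt x * m \<doteq> 1" using exists_inverse[OF x(2)] by blast
        \<comment> \<open>\<open>x [^] j\<close> brings \<open>k t\<close> to height zero, so the
          product has the function of some \<open>w \<in> W\<close>, which vanishes at
          \<open>t\<close>. The function of \<open>k t\<close> vanishes at \<open>t\<close> as well,
          since \<open>[t,t]\<close> is trivial. As \<open>x\<close> and \<open>t\<close> do not
          commute, \<open>j\<close> is zero modulo \<open>p\<close>: the height of
          \<open>k t\<close> was zero from the start.\<close>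
        define j where "j = - hgt (k t) * m"
        have xj: "x [^] j \<in> D" by (rule subgroup_int_pow_closed[OF D_subgroup x(1)])
        note kT = T_D[OF k(1)[OF t(1)]] and kD = k(1)[OF t(1)]
        from hgt_T_mult[OF kT T_D[OF xj]] hgt_T_pow[OF T_D[OF x(1)], of j] m
        have "hgt (k t \<otimes> x [^] j) \<doteq> 0"
          by (rule cong_lin(3)[where u = 1 and u' = 1 and u'' = "- hgt (k t)"]) (simp add: j_def algebra_simps)
        then obtain w where w: "w \<in> W" "\<And>h. h \<in> carrier G \<Longrightarrow> \<chi> w h \<doteq> \<chi> (k t \<otimes> x [^] j) h"
          using hgt_zero_W[OF subgroup.m_closed[OF D_subgroup kD xj]] by blast
        have "cm t t = \<one>" using tG by (simp add: cm_def m_assoc)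
        then have "\<kappa> a t t \<doteq> 0"
          unfolding \<kappa>_def using addmod_one[OF \<beta>_addmod[OF a(1)] W_subgroup] by simp
        then have kt: "\<chi> (k t) t \<doteq> 0" using k(2)[OF t(1) tG] cong_trans by blast
        from w(2)[OF tG] \<chi>_W_T[OF w(1) t(1)] have "\<chi> (k t \<otimes> x [^] j) t \<doteq> 0"
          by (rule cong_lin(2)[where u = "-1" and u' = 1]) simp
        from this \<chi>_mult[OF kT T_D[OF xj] tG] kt \<chi>_pow[OF T_D[OF x(1)] tG, of j]
        have "j * \<chi> x t \<doteq> 0"
          by (rule cong_lin(4)[where u = 1 and u' = "-1" and u'' = "-1" and u''' = "-1"]) simp
        then have "j \<doteq> 0" using mult_cong_zero t(3) by blast
        from this m have "hgt (k t) \<doteq> 0"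
          by (rule cong_lin(2)[where u = "- hgt x" and u' = "- hgt (k t)"]) (simp add: j_def algebra_simps)
        then show ?thesis using t(1,2) N_\<Phi> by blast
      qed
      then obtain t where t: "t \<in> T" "t \<notin> N" "D \<subseteq> N \<or> t \<notin> \<Phi>" "hgt (k t) \<doteq> 0" by blast
      obtain w where w: "w \<in> W" "\<And>h. h \<in> carrier G \<Longrightarrow> \<chi> w h \<doteq> \<chi> (k t) h"
        using hgt_zero_W[OF k(1)[OF t(1)] t(4)] by blast
      show False
        by (rule step[OF t(1-3) w(1)]) (use w(2) k(2)[OF t(1)] cong_trans E in blast)+
    next
      case nE: False
      then have DN: "D \<subseteq> N" using D_hgt_zero_N by blast
      have "\<exists>w \<in> W. \<forall>g \<in> carrier G. \<chi> w g \<doteq> \<chi> (k t) g" if "t \<in> T" for t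
        using hgt_zero_W[OF k(1)[OF that]] nE k(1)[OF that] by metis
      then obtain w where w: "\<And>t. t \<in> T \<Longrightarrow> w t \<in> W"
        "\<And>t g. t \<in> T \<Longrightarrow> g \<in> carrier G \<Longrightarrow> \<chi> (w t) g \<doteq> \<chi> (k t) g" by metis
      have \<beta>w: "addmod T (int p) (\<lambda>t. \<beta> b (w t))" if b: "b \<in> W" for b
        unfolding addmod_def
      proof (intro ballI)
        fix t t' assume t: "t \<in> T" "t' \<in> T"
        note tt = subgroup.m_closed[OF T_subgroup t]
        have "\<beta> b (w (t \<otimes> t')) \<doteq> \<beta> b (w t \<otimes> w t')"
        proof (rule \<beta>_cong[OF b w(1)[OF tt] subgroup.m_closed[OF W_subgroup w(1)[OF t(1)] w(1)[OF t(2)]]])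
          fix g assume g: "g \<in> carrier G"
          have 1: "\<chi> (w (t \<otimes> t')) g \<doteq> \<chi> (k t \<otimes> k t') g"
            using w(2)[OF tt g] kmult[OF t g] cong_trans by blast
          from \<chi>_mult[OF T_D[OF k(1)[OF t(1)]] T_D[OF k(1)[OF t(2)]] g] w(2)[OF t(1) g] w(2)[OF t(2) g]
            \<chi>_mult[OF W_in_T[OF w(1)[OF t(1)]] W_in_T[OF w(1)[OF t(2)]] g]
          have 2: "\<chi> (k t \<otimes> k t') g \<doteq> \<chi> (w t \<otimes> w t') g"
            by (rule cong_lin(4)[where u = 1 and u' = "-1" and u'' = "-1" and u''' = "-1"]) simp
          show "\<chi> (w (t \<otimes> t')) g \<doteq> \<chi> (w t \<otimes> w t') g" by (rule cong_trans[OF 1 2])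
        qed
        then show "\<beta> b (w (t \<otimes> t')) \<doteq> \<beta> b (w t) + \<beta> b (w t')"
          using \<beta>_mult[OF b w(1)[OF t(1)] w(1)[OF t(2)]] cong_trans by blast
      qed
      \<comment> \<open>All heights in \<open>D\<close> vanish, so each \<open>\<kappa> a t\<close>
        is realized in \<open>W\<close>. The one remaining condition is that the corrected element
        has height zero; \<open>\<psi> t\<close> is this height and is additive in
        \<open>t\<close>.\<close>
      define \<psi> where "\<psi> t = hgt t + ((half * \<beta> \<theta> \<theta>) * \<beta> a (w t) + -1 * \<beta> \<theta> (w t))" for t
      have "addmod T (int p) \<psi>" unfolding \<psi>_def
        by (intro addmod_add addmod_scale hgt_addmod_T \<beta>w a(1) \<theta>W)
      then obtain t where t: "t \<in> T" "t \<notin> N" "\<psi> t \<doteq> 0" by (rule kernel_not_N)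
      show False
      proof (rule step[OF t(1,2) _ w(1)[OF t(1)]])
        show "D \<subseteq> N \<or> t \<notin> \<Phi>" using DN by blast
        show "\<chi> (w t) g \<doteq> \<kappa> a t g" if "g \<in> carrier G" for g
          using w(2)[OF t(1) that] k(2)[OF t(1) that] cong_trans by blast
        have "hgt t + (half * \<beta> a (w t) * \<beta> \<theta> \<theta> - \<beta> \<theta> (w t)) = \<psi> t" by (simp add: \<psi>_def algebra_simps)
        then show "(\<exists>x \<in> D. \<not> hgt x \<doteq> 0) \<or> hgt t + (half * \<beta> a (w t) * \<beta> \<theta> \<theta> - \<beta> \<theta> (w t)) \<doteq> 0"
          using t(3) by simp
      qed
    qed
  qed
qed

end

section \<open>Existence of a non-inner automorphism\<close>

context group
begin

lemma exists_noninner_automorphism: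
  assumes "Factorial_Ring.prime p" and "odd p" and "finite (carrier G)"
    and "\<exists>n. card (carrier G) = p ^ n" and "\<not> comm_group G"
    and cyc: "cyclic_group (subgroup_generated G (grp_center G))"
    and "\<not> centralizer G (subgroup_center G (lower_central G 3 <#> power_subgroup G p))
      \<subseteq> lower_central G 3 <#> power_subgroup G p"
  shows "\<exists>f \<in> auto G. \<not> inner_auto G f \<and> group.ord (AutoGroup G) f = p"
proof (rule ccontr)
  assume neg: "\<not> ?thesis"
  let ?C = "commutator_subgroup G (carrier G) (carrier G)"
  let ?L = "lower_central G 3" and ?P = "power_subgroup G p"
  let ?N = "?L <#> ?P"
  have L: "?L = commutator_subgroup G ?C (carrier G)" by (simp add: numeral_3_eq_3)
  have CN: "?C \<lhd> G" by (intro commutator_subgroup_normal normal_invI subgroup_self) simp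
  have LN: "?L \<lhd> G" unfolding L by (rule commutator_subgroup_normal[OF CN])
  have PN: "?P \<lhd> G" by (rule power_subgroup_normal)
  note subL = normal_imp_subgroup[OF LN] and subP = normal_imp_subgroup[OF PN]
  let ?H = "subgroup_generated G (grp_center G)"
  have carH: "carrier ?H = grp_center G"
    by (rule subgroup.carrier_subgroup_generated_subgroup[OF subgroup_grp_center])
  obtain \<zeta> where \<zeta>: "\<zeta> \<in> carrier ?H" "carrier ?H = range (\<lambda>n::int. \<zeta> [^]\<^bsub>?H\<^esub> n)"
    using group.cyclic_group[OF group_subgroup_generated] cyc by blast
  interpret inner_p_group G p \<zeta> ?N
  proof (intro inner_p_group.intro inner_p_group_axioms.intro is_group)
    show "\<zeta> \<in> carrier G" using \<zeta>(1) carH center_closed by blast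
    show "grp_center G = range (\<lambda>i::int. \<zeta> [^] i)"
      using \<zeta>(2) int_pow_subgroup_generated[OF \<zeta>(1)] carH by simp
    show "inner_auto G f" if "f \<in> auto G" "group.ord (AutoGroup G) f = p" for f using neg that by blast
    show "?N \<lhd> G" by (rule normal_set_mult[OF LN PN])
    show "g [^] p \<in> ?N" if g: "g \<in> carrier G" for g
    proof -
      have "g [^] p \<in> ?P" unfolding power_subgroup_def by (rule generate.incl) (use g in blast)
      moreover have "\<one> \<otimes> g [^] p = g [^] p" using g by simp
      ultimately show ?thesis using subgroup.one_closed[OF subL] unfolding set_mult_def by force
    qed
    show "cm g (cm a b) \<in> ?N" if g: "g \<in> carrier G" and ab: "a \<in> carrier G" "b \<in> carrier G" for g a b
    proof -
      have "cm (cm a b) g \<in> ?L" unfolding L by (intro commutator_subgroup_mem ab g)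
      then have "inv (cm (cm a b) g) \<in> ?L" by (rule subgroup.m_inv_closed[OF subL])
      then have "cm g (cm a b) \<in> ?L" using cm_inv[OF cm_closed[OF ab] g] by simp
      moreover have "cm g (cm a b) \<otimes> \<one> = cm g (cm a b)" using g ab by simp
      ultimately show ?thesis using subgroup.one_closed[OF subP] unfolding set_mult_def by force
    qed
    show "?N \<subseteq> H" if H: "subgroup H G" "\<And>g. g \<in> carrier G \<Longrightarrow> g [^] p \<in> H"
      "\<And>a b. a \<in> carrier G \<Longrightarrow> b \<in> carrier G \<Longrightarrow> cm a b \<in> H" for H
    proof -
      have CG: "c \<in> carrier G" if "c \<in> ?C" for c
        using subgroup.mem_carrier[OF normal_imp_subgroup[OF CN] that] .
      have "?L \<subseteq> H" unfolding L commutator_subgroup_cm[of ?C]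
        by (rule generate_subgroup_incl[OF _ H(1)]) (use H(3) CG in blast)
      moreover have "?P \<subseteq> H" unfolding power_subgroup_def
        by (rule generate_subgroup_incl[OF _ H(1)]) (use H(2) in blast)
      ultimately show ?thesis using subgroup.m_closed[OF H(1)] unfolding set_mult_def by blast
    qed
  qed (fact assms)+
  show False by (rule inconsistent)
qed

end

theorem theorem5p2:
  fixes G :: "('a, 'b) monoid_scheme" and p :: nat
  assumes "group G"
    and "Factorial_Ring.prime p" and "odd p"
    and "finite (carrier G)"
    and "\<exists>n. card (carrier G) = p ^ n"
    and "\<not> comm_group G"
    and "cyclic_group (subgroup_generated G (grp_center G))"
    and "\<not> centralizer G (subgroup_center G
              (lower_central G 3 <#>\<^bsub>G\<^esub> power_subgroup G p))
            \<subseteq> lower_central G 3 <#>\<^bsub>G\<^esub> power_subgroup G p"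
  shows "\<exists>f \<in> auto G. \<not> inner_auto G f \<and> group.ord (AutoGroup G) f = p"
  by (rule group.exists_noninner_automorphism[OF assms])

end
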